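(* Let $p>0$. There exists a negative, continuous, subharmonic exhaustion function $u$ on the unit disc $\mathbb{D}$ with finite Monge-Ampère mass $\int_{\mathbb{D}}dd^c u<\infty$ such that $H^{p}_{u}(\mathbb{D})\subsetneqq H^{p}(\mathbb{D})$.
   Context: $H^p(\mathbb{D})$ is the classical Hardy space, i.e. the set of holomorphic $f$ on $\mathbb{D}$ such that $|f|^p$ has a harmonic majorant in $\mathbb{D}$. For a negative, continuous (extended-real-valued), subharmonic exhaustion function $u:\mathbb{D}\to[-\infty,0)$ (exhaustion: $B_u(r)=\{u<r\}$ is relatively compact in $\mathbb{D}$ for all $r<0$), put $S_u(r)=\{u=r\}$ and $u_r=\max\{u,r\}$, and for $r\in(-\infty,0)$ define $\mu_{u,r}=dd^c u_r-\chi_{\mathbb{D}\setminus B_u(r)}\,dd^c u$, a positive measure supported on $S_u(r)$. Here, for subharmonic $v$, $dd^c v$ denotes the positive Borel measure given by a fixed positive constant multiple of the distributional Laplacian $\Delta v$ (the choice of constant is immaterial). $H^p_u(\mathbb{D})$ is the space of holomorphic $f$ on $\mathbb{D}$ with $\limsup_{r\to0^-}\int_{S_u(r)}|f|^p\,d\mu_{u,r}<\infty$. *)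

theory Defs
  imports "HOL-Complex_Analysis.Complex_Analysis"
begin

abbreviation unit_disc :: "complex set"
  where "unit_disc \<equiv> ball 0 1"

definition dir_deriv :: "complex \<Rightarrow> (complex \<Rightarrow> real) \<Rightarrow> complex \<Rightarrow> real"
  where "dir_deriv b f z = frechet_derivative f (at z) b"

text \<open>Intended for open sets \<open>S\<close> only.\<close>

primrec Ck_on :: "nat \<Rightarrow> (complex \<Rightarrow> real) \<Rightarrow> complex set \<Rightarrow> bool"
  where
    "Ck_on 0 f S \<longleftrightarrow> continuous_on S f"
  | "Ck_on (Suc k) f S \<longleftrightarrow> f differentiable_on S \<and> (\<forall>b. Ck_on k (dir_deriv b f) S)"

definition laplacian :: "(complex \<Rightarrow> real) \<Rightarrow> complex \<Rightarrow> real"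
  where "laplacian f z = (\<Sum>b\<in>Basis. dir_deriv b (dir_deriv b f) z)"

definition harmonic_on :: "(complex \<Rightarrow> real) \<Rightarrow> complex set \<Rightarrow> bool"
  where "harmonic_on h S \<longleftrightarrow> Ck_on 2 h S \<and> (\<forall>z\<in>S. laplacian h z = 0)"

text \<open>
  The definition by harmonic majorants on relatively compact open subsets, which needs no
  integration of functions taking the value \<open>-\<infinity>\<close>. The second conjunct is upper
  semicontinuity. The function that is constantly \<open>-\<infinity>\<close> is excluded; \<open>S\<close> is meant to be
  a domain.
\<close>

definition subharmonic_on :: "(complex \<Rightarrow> ereal) \<Rightarrow> complex set \<Rightarrow> bool"
  where "subharmonic_on u S \<longleftrightarrow>
    (\<forall>z\<in>S. u z \<noteq> \<infinity>) \<and>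
    (\<forall>c. openin (top_of_set S) {z \<in> S. u z < c}) \<and>
    (\<exists>z\<in>S. u z \<noteq> -\<infinity>) \<and>
    (\<forall>G h. open G \<longrightarrow> compact (closure G) \<longrightarrow> closure G \<subseteq> S \<longrightarrow>
       continuous_on (closure G) h \<longrightarrow> harmonic_on h G \<longrightarrow>
       (\<forall>z\<in>frontier G. u z \<le> ereal (h z)) \<longrightarrow> (\<forall>z\<in>G. u z \<le> ereal (h z)))"

definition test_fun :: "complex set \<Rightarrow> (complex \<Rightarrow> real) \<Rightarrow> bool"
  where "test_fun S \<phi> \<longleftrightarrow>
    (\<forall>k. Ck_on k \<phi> UNIV) \<and> (\<exists>K. compact K \<and> K \<subseteq> S \<and> (\<forall>z. z \<notin> K \<longrightarrow> \<phi> z = 0))"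

text \<open>
  Normalization: \<open>dd\<^sup>c = \<Delta> / (2 \<pi>)\<close>, so that \<open>dd\<^sup>c log |z|\<close> is the Dirac measure at
  \<open>0\<close>. The conversion \<open>real_of_ereal\<close> sends \<open>-\<infinity>\<close> to \<open>0\<close>, which does not affect the
  integral because a subharmonic function equals \<open>-\<infinity>\<close> only on a Lebesgue null set.
\<close>

definition is_ddc :: "(complex \<Rightarrow> ereal) \<Rightarrow> complex measure \<Rightarrow> bool"
  where "is_ddc v M \<longleftrightarrow>
    sets M = sets (restrict_space borel unit_disc) \<and>
    (\<forall>K. compact K \<longrightarrow> K \<subseteq> unit_disc \<longrightarrow> emeasure M K < \<infinity>) \<and>
    (\<forall>\<phi>. test_fun unit_disc \<phi> \<longrightarrow>
       (LINT z:unit_disc|lborel. real_of_ereal (v z) * laplacian \<phi> z) / (2 * pi) =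
       (LINT z|M. \<phi> z))"

definition ddc :: "(complex \<Rightarrow> ereal) \<Rightarrow> complex measure"
  where "ddc v = (THE M. is_ddc v M)"

definition sublevel :: "(complex \<Rightarrow> ereal) \<Rightarrow> real \<Rightarrow> complex set"
  where "sublevel u r = {z \<in> unit_disc. u z < ereal r}"

definition level :: "(complex \<Rightarrow> ereal) \<Rightarrow> real \<Rightarrow> complex set"
  where "level u r = {z \<in> unit_disc. u z = ereal r}"

definition exhaustion :: "(complex \<Rightarrow> ereal) \<Rightarrow> bool"
  where "exhaustion u \<longleftrightarrow>
    (\<forall>r<0. compact (closure (sublevel u r)) \<and> closure (sublevel u r) \<subseteq> unit_disc)"

definition neg_subharmonic_exhaustion :: "(complex \<Rightarrow> ereal) \<Rightarrow> bool"
  where "neg_subharmonic_exhaustion u \<longleftrightarrow>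
    (\<forall>z\<in>unit_disc. u z < 0) \<and> continuous_on unit_disc u \<and>
    subharmonic_on u unit_disc \<and> exhaustion u"

text \<open>
  The difference \<open>dd\<^sup>c u\<^sub>r - \<chi> dd\<^sup>c u\<close> is written additively, which stays meaningful when
  both measures are infinite. It determines \<open>\<mu>\<close> because both are finite on compact
  subsets of the disc.
\<close>

definition level_measure :: "(complex \<Rightarrow> ereal) \<Rightarrow> real \<Rightarrow> complex measure"
  where "level_measure u r = (THE \<mu>.
    sets \<mu> = sets (restrict_space borel unit_disc) \<and>
    (\<forall>A\<in>sets (restrict_space borel unit_disc).
       emeasure (ddc (\<lambda>z. max (u z) (ereal r))) A =
       emeasure \<mu> A + emeasure (ddc u) (A \<inter> (unit_disc - sublevel u r))))"

text \<open>
  Elements are total functions whose values outside the disc are irrelevant; membership in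
  either space depends only on the restriction to the disc.
\<close>

definition Hardy :: "real \<Rightarrow> (complex \<Rightarrow> complex) set"
  where "Hardy p = {f. f holomorphic_on unit_disc \<and>
    (\<exists>h. harmonic_on h unit_disc \<and> (\<forall>z\<in>unit_disc. norm (f z) powr p \<le> h z))}"

definition Hardy_exh :: "(complex \<Rightarrow> ereal) \<Rightarrow> real \<Rightarrow> (complex \<Rightarrow> complex) set"
  where "Hardy_exh u p = {f. f holomorphic_on unit_disc \<and>
    Limsup (at_left 0)
      (\<lambda>r. \<integral>\<^sup>+z\<in>level u r. ennreal (norm (f z) powr p) \<partial>(level_measure u r)) < \<infinity>}"

end

theory Submission
  imports Defs
begin

text \<open>
  Take \<open>u(z) = - (1 - |z|^2) |1 - z|^(-1/2)\<close>. It is smooth on the disc, its Laplacian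
  \<open>3 |1 - z|^(-1/2) + (3/4) (1 - |z|^2) |1 - z|^(-5/2)\<close> is positive and integrable, and horizontal
  and vertical lines meet the sublevel sets \<open>B = {u < r}\<close> in intervals. Integrating by parts on
  these intervals exhibits the level measure explicitly, as an integral over the end points of
  the intervals, and gives for smooth \<open>\<psi>\<close> the Lelong-Jensen formula
  \<open>2\<pi> \<integral> \<psi> d\<mu> = \<integral> (\<psi> \<Delta>u + (r - u) \<Delta>\<psi>)\<close>, the second integral being over \<open>B\<close>.

  For \<open>f\<close> in the weighted space, \<open>\<psi> = (|f|^2 + 1)^(p/2)\<close> is subharmonic, so this formula bounds the
  integrals of \<open>\<psi>\<close> and of \<open>(R^2 - |z|^2) \<Delta>\<psi>\<close> over \<open>|z| < R\<close> uniformly in \<open>R < 1\<close>. The same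
  formula for \<open>|z|^2\<close> in place of \<open>u\<close> then bounds the integral of a harmonic polynomial that agrees with
  \<open>\<psi>\<close> on \<open>|z| = R\<close> up to an error of at most one, and a normal family argument produces a harmonic
  majorant of \<open>|f|^p\<close>.

  The function \<open>f(z) = (1 - z)^(-1/(2p))\<close> satisfies \<open>|f|^p = |1 - z|^(-1/2)\<close>, which has the harmonic
  majorant \<open>2^(1/2) Re ((1 - z)^(-1/2))\<close>, whereas \<open>\<integral> |f|^p \<Delta>u = \<infinity>\<close>.
\<close>

section \<open>Slices and second derivatives along a direction\<close>

text \<open>The exponents: with the weight |1 - z|^(-a), 0 < a < 1, the Laplacian of
  \<open>u\<close> is of order |1 - z|^(-1-a) in nontangential approach to 1. Both finite mass and u
  tending to 0 at 1 need a < 1. A function with |f|^p = |1 - z|^(-b) is in the Hardy space for b <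
  1, and the integral of |f|^p times the Laplacian diverges as soon as 1 + a + b \<ge> 2. The choice
  a = b = 1/2 is the symmetric borderline case, where the divergence is logarithmic. Both
  \<open>ddc\<close> and \<open>level_measure\<close> are definite descriptions, so a candidate must
  be exhibited and shown unique before anything can be said about them; finite mass is what permits
  cancellation there. Building the candidate from slices asks for no regularity or parametrisation
  of the level curves; the price is that the slices of the sublevel sets must be intervals, which is
  checked for this particular \<open>u\<close>. The inclusion rests on comparing \<open>u\<close>
  with (|z|^2 - 1) / 4, from which \<open>u\<close> differs only in the direction of more weight.
  For the majorants, a lower bound of Re F does not bound F itself, which is why the limit is taken
  for inverses.\<close>

text \<open>
  The coordinate \<open>t\<close> is along \<open>b\<close> and \<open>s\<close> is orthogonal to it; \<open>b = 1\<close> and \<open>b = \<i>\<close> yield the two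
  orders of integration in the plane.
\<close>

definition line_pt :: "complex \<Rightarrow> real \<Rightarrow> real \<Rightarrow> complex"
  where "line_pt b s t = of_real s * (\<i> * cnj b) + of_real t * b"

lemma line_pt_1: "line_pt 1 s t = Complex t s"
  by (simp add: line_pt_def complex_eq_iff)

lemma line_pt_i: "line_pt \<i> s t = Complex s t"
  by (simp add: line_pt_def complex_eq_iff)

lemma line_pt_add: "line_pt b s (t + h) = line_pt b s t + of_real h * b"
  by (simp add: line_pt_def algebra_simps)

lemma continuous_on_line_pt [continuous_intros]:
  "continuous_on S f \<Longrightarrow> continuous_on S g \<Longrightarrow> continuous_on S (\<lambda>x. line_pt b (f x) (g x))"
  unfolding line_pt_def by (intro continuous_intros)

lemma borel_measurable_line_pt [measurable (raw)]:
  "f \<in> borel_measurable M \<Longrightarrow> g \<in> borel_measurable M \<Longrightarrow> (\<lambda>x. line_pt b (f x) (g x)) \<in> borel_measurable M"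
  unfolding line_pt_def by (intro borel_measurable_add borel_measurable_times borel_measurable_const) auto

lemma norm_line_pt: "b \<in> Basis \<Longrightarrow> norm (line_pt b s t) ^ 2 = s^2 + t^2"
  by (auto simp: Basis_complex_def line_pt_1 line_pt_i cmod_power2)

lemma abs_le_norm_line_pt:
  assumes "b \<in> Basis" shows "\<bar>s\<bar> \<le> norm (line_pt b s t)" "\<bar>t\<bar> \<le> norm (line_pt b s t)"
  using norm_line_pt[OF assms, of s t] by (auto intro!: abs_le_square_iff[THEN iffD2, of _ "norm (line_pt b s t)", simplified])

text \<open>The map identifies the plane with pairs of reals for \<open>b = \<i>\<close>, and does
  so up to a swap for \<open>b = 1\<close>; hence it preserves the volume of boxes. Plane integrals
  are iterated through it, with the inner integral along \<open>b\<close>.\<close>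

lemma lborel_line_pt:
  assumes "b \<in> Basis"
  shows "distr (lborel \<Otimes>\<^sub>M lborel) borel (\<lambda>(s, t). line_pt b s t) = lborel"
proof (rule lborel_eqI[symmetric])
  fix l u :: complex assume le: "\<And>b. b \<in> Basis \<Longrightarrow> l \<bullet> b \<le> u \<bullet> b"
  have le': "Re l \<le> Re u" "Im l \<le> Im u"
    using le[of 1] le[of \<i>] by (auto simp: Basis_complex_def)
  have prod: "(\<Prod>b\<in>Basis. (u - l) \<bullet> b) = (Re u - Re l) * (Im u - Im l)"
    by (simp add: Basis_complex_def)
  have "emeasure (distr (lborel \<Otimes>\<^sub>M lborel) borel (\<lambda>(s, t). line_pt b s t)) (box l u) =
     emeasure (lborel \<Otimes>\<^sub>M lborel) ((\<lambda>(s, t). line_pt b s t) -` box l u \<inter> space (lborel \<Otimes>\<^sub>M lborel))"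
    by (intro emeasure_distr) (measurable, auto)
  also have "\<dots> = ennreal (\<Prod>b\<in>Basis. (u - l) \<bullet> b)"
  proof (cases "b = 1")
    case True
    have eq: "(\<lambda>(s, t). line_pt b s t) -` box l u \<inter> space (lborel \<Otimes>\<^sub>M lborel) =
        {Im l<..<Im u} \<times> {Re l<..<Re u}"
      by (auto simp: space_pair_measure box_def Basis_complex_def True line_pt_1)
    show ?thesis unfolding eq prod using le'
      by (subst lborel.emeasure_pair_measure_Times) (auto simp: ennreal_mult mult.commute)
  next
    case False
    then have b: "b = \<i>" using assms by (auto simp: Basis_complex_def)
    have eq: "(\<lambda>(s, t). line_pt b s t) -` box l u \<inter> space (lborel \<Otimes>\<^sub>M lborel) =
        {Re l<..<Re u} \<times> {Im l<..<Im u}"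
      by (auto simp: space_pair_measure box_def Basis_complex_def b line_pt_i)
    show ?thesis unfolding eq prod using le'
      by (subst lborel.emeasure_pair_measure_Times) (auto simp: ennreal_mult mult.commute)
  qed
  finally show "emeasure (distr (lborel \<Otimes>\<^sub>M lborel) borel (\<lambda>(s, t). line_pt b s t)) (box l u)
      = (\<Prod>b\<in>Basis. (u - l) \<bullet> b)" .
qed simp

lemma nn_integral_line_pt:
  assumes "b \<in> Basis" and [measurable]: "f \<in> borel_measurable borel"
  shows "(\<integral>\<^sup>+z. f z \<partial>lborel) = (\<integral>\<^sup>+s. \<integral>\<^sup>+t. f (line_pt b s t) \<partial>lborel \<partial>lborel)"
proof -
  have "(\<integral>\<^sup>+z. f z \<partial>lborel) = (\<integral>\<^sup>+z. f z \<partial>distr (lborel \<Otimes>\<^sub>M lborel) borel (\<lambda>(s, t). line_pt b s t))"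
    by (simp add: lborel_line_pt[OF assms(1)])
  also have "\<dots> = (\<integral>\<^sup>+x. f (line_pt b (fst x) (snd x)) \<partial>(lborel \<Otimes>\<^sub>M lborel))"
    by (subst nn_integral_distr) (measurable, auto simp: case_prod_beta)
  also have "\<dots> = (\<integral>\<^sup>+s. \<integral>\<^sup>+t. f (line_pt b s t) \<partial>lborel \<partial>lborel)"
    by (subst lborel.nn_integral_fst[symmetric]) auto
  finally show ?thesis .
qed

lemma integral_line_pt:
  fixes f :: "complex \<Rightarrow> real"
  assumes "b \<in> Basis" and f: "integrable lborel f"
  shows "(LINT z|lborel. f z) = (LINT s|lborel. LINT t|lborel. f (line_pt b s t))"
    and "integrable lborel (\<lambda>s. LINT t|lborel. f (line_pt b s t))"
proof -
  have [measurable]: "f \<in> borel_measurable borel" using f by auto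
  have i: "integrable (distr (lborel \<Otimes>\<^sub>M lborel) borel (\<lambda>(s, t). line_pt b s t)) f"
    using f by (simp add: lborel_line_pt[OF assms(1)])
  have i2: "integrable (lborel \<Otimes>\<^sub>M lborel) (\<lambda>x. f (line_pt b (fst x) (snd x)))"
    using integrable_distr[OF _ i] by (simp add: case_prod_beta)
  have "(LINT z|lborel. f z) = (LINT z|distr (lborel \<Otimes>\<^sub>M lborel) borel (\<lambda>(s, t). line_pt b s t). f z)"
    by (simp add: lborel_line_pt[OF assms(1)])
  also have "\<dots> = (LINT x|(lborel \<Otimes>\<^sub>M lborel). f (line_pt b (fst x) (snd x)))"
    by (subst integral_distr) (measurable, auto simp: case_prod_beta)
  also have "\<dots> = (LINT s|lborel. LINT t|lborel. f (line_pt b s t))"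
    using lborel_pair.integral_fst'[OF i2] by simp
  finally show "(LINT z|lborel. f z) = (LINT s|lborel. LINT t|lborel. f (line_pt b s t))" .
  show "integrable lborel (\<lambda>s. LINT t|lborel. f (line_pt b s t))"
    using lborel_pair.integrable_fst'[OF i2] by simp
qed

text \<open>Only derivatives along one direction are asked for, and they are supplied as explicit
  functions: concrete functions can then be differentiated by one-variable rules instead of Frechet
  derivatives. Continuity on \<open>S\<close> is what makes the slice integrands and plane integrals
  tractable.\<close>

definition D2_along :: "complex \<Rightarrow> (complex \<Rightarrow> real) \<Rightarrow> (complex \<Rightarrow> real) \<Rightarrow> (complex \<Rightarrow> real) \<Rightarrow> complex set \<Rightarrow> bool"
  where "D2_along b f f1 f2 S \<longleftrightarrow> continuous_on S f \<and> continuous_on S f1 \<and> continuous_on S f2 \<and>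
    (\<forall>z\<in>S. ((\<lambda>t. f (z + of_real t * b)) has_real_derivative f1 z) (at 0) \<and>
            ((\<lambda>t. f1 (z + of_real t * b)) has_real_derivative f2 z) (at 0))"

lemma D2_along_subset: "D2_along b f f1 f2 S \<Longrightarrow> T \<subseteq> S \<Longrightarrow> D2_along b f f1 f2 T"
  unfolding D2_along_def by (blast intro: continuous_on_subset)

lemma D2_along_cont:
  assumes "D2_along b f f1 f2 S"
  shows "continuous_on S f" "continuous_on S f1" "continuous_on S f2"
  using assms unfolding D2_along_def by auto

lemma D2_along_line:
  assumes "D2_along b f f1 f2 S" "line_pt b s t \<in> S"
  shows "((\<lambda>t. f (line_pt b s t)) has_real_derivative f1 (line_pt b s t)) (at t)"
    and "((\<lambda>t. f1 (line_pt b s t)) has_real_derivative f2 (line_pt b s t)) (at t)"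
proof -
  have "((\<lambda>h. f (line_pt b s (h + t))) has_real_derivative f1 (line_pt b s t)) (at 0)"
       "((\<lambda>h. f1 (line_pt b s (h + t))) has_real_derivative f2 (line_pt b s t)) (at 0)"
    using assms unfolding D2_along_def by (auto simp: line_pt_add add.commute[of _ t])
  then show "((\<lambda>t. f (line_pt b s t)) has_real_derivative f1 (line_pt b s t)) (at t)"
    "((\<lambda>t. f1 (line_pt b s t)) has_real_derivative f2 (line_pt b s t)) (at t)"
    using DERIV_shift[of "\<lambda>t. f (line_pt b s t)" _ 0 t] DERIV_shift[of "\<lambda>t. f1 (line_pt b s t)" _ 0 t] by auto
qed

lemma D2_along_add:
  assumes "D2_along b f f1 f2 S" "D2_along b g g1 g2 S"
  shows "D2_along b (\<lambda>z. f z + g z) (\<lambda>z. f1 z + g1 z) (\<lambda>z. f2 z + g2 z) S"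
  using assms unfolding D2_along_def by (auto intro!: continuous_intros DERIV_add)

lemma D2_along_diff:
  assumes "D2_along b f f1 f2 S" "D2_along b g g1 g2 S"
  shows "D2_along b (\<lambda>z. f z - g z) (\<lambda>z. f1 z - g1 z) (\<lambda>z. f2 z - g2 z) S"
  using assms unfolding D2_along_def by (auto intro!: continuous_intros DERIV_diff)

lemma D2_along_const: "D2_along b (\<lambda>z. c) (\<lambda>z. 0) (\<lambda>z. 0) S"
  unfolding D2_along_def by auto

lemma has_real_derivative_Re_line:
  assumes "F holomorphic_on S" "open S" "z \<in> S"
  shows "((\<lambda>t. Re (F (z + of_real t * b))) has_real_derivative Re (deriv F z * b)) (at 0)"
proof -
  have "(F has_field_derivative deriv F z) (at (z + of_real 0 * b))"
    using assms by (simp add: holomorphic_derivI)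
  then have "((\<lambda>w. F (z + w * b)) has_field_derivative deriv F z * b) (at (of_real 0))"
    by (rule DERIV_chain2) (auto intro!: derivative_eq_intros)
  then have "((\<lambda>t. F (z + of_real t * b)) has_vector_derivative deriv F z * b) (at 0)"
    by (rule has_vector_derivative_real_field)
  then show ?thesis
    unfolding has_real_derivative_iff_has_vector_derivative
    by (rule bounded_linear.has_vector_derivative[OF bounded_linear_Re])
qed

text \<open>Each derivative along \<open>b\<close> multiplies by \<open>b\<close>. Since 1 and
  \<open>\<i>\<close> have squares 1 and -1, the two second derivatives cancel in the
  Laplacian.\<close>

lemma D2_along_Re:
  assumes F: "F holomorphic_on S" and S: "open S"
  shows "D2_along b (\<lambda>z. Re (F z)) (\<lambda>z. Re (deriv F z * b)) (\<lambda>z. Re (deriv (deriv F) z * b * b)) S"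
proof -
  have F1: "deriv F holomorphic_on S" and F2: "deriv (deriv F) holomorphic_on S"
    using holomorphic_deriv[OF F S] holomorphic_deriv[OF holomorphic_deriv[OF F S] S] by blast+
  have c: "continuous_on S F" "continuous_on S (deriv F)" "continuous_on S (deriv (deriv F))"
    by (fact F[THEN holomorphic_on_imp_continuous_on] F1[THEN holomorphic_on_imp_continuous_on]
        F2[THEN holomorphic_on_imp_continuous_on])+
  have "((\<lambda>t. Re (deriv F (z + of_real t * b) * b)) has_real_derivative Re (deriv (deriv F) z * b * b)) (at 0)"
    if "z \<in> S" for z
  proof -
    have h: "(\<lambda>w. deriv F w * b) holomorphic_on S" by (rule holomorphic_on_mult[OF F1 holomorphic_on_const])
    have "deriv (\<lambda>w. deriv F w * b) z = deriv (deriv F) z * b"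
      using F1 S that by (intro deriv_cmult_right holomorphic_on_imp_differentiable_at)
    then show ?thesis using has_real_derivative_Re_line[OF h S that, of b] by simp
  qed
  then show ?thesis unfolding D2_along_def
    using has_real_derivative_Re_line[OF F S] c by (auto intro!: continuous_intros)
qed

section \<open>Iterated directional derivatives and harmonicity of real parts\<close>

lemma Ck_on_cong:
  assumes "open S" "\<And>z. z \<in> S \<Longrightarrow> f z = g z" "Ck_on k f S"
  shows "Ck_on k g S"
  using assms
proof (induction k arbitrary: f g)
  case 0 then show ?case by (auto simp: continuous_on_eq)
next
  case (Suc k)
  have hd: "(f has_derivative D) (at z) \<longleftrightarrow> (g has_derivative D) (at z)" if "z \<in> S" for D z
    using has_derivative_transform_within_open[of f D z UNIV S g]
      has_derivative_transform_within_open[of g D z UNIV S f] Suc.prems(1,2) that by auto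
  have d: "dir_deriv b f z = dir_deriv b g z" if "z \<in> S" for b z
    using hd[OF that] unfolding dir_deriv_def frechet_derivative_def by simp
  have "Ck_on k (dir_deriv b g) S" for b
    using Suc.IH[OF Suc.prems(1) d] Suc.prems(3) by auto
  moreover have "g differentiable_on S"
    using Suc.prems hd by (auto simp: differentiable_on_eq_differentiable_at differentiable_def)
  ultimately show ?case by simp
qed

lemma dir_deriv_eqI:
  assumes "(f has_derivative D) (at z)"
  shows "dir_deriv b f z = D b"
  using frechet_derivative_at[OF assms] unfolding dir_deriv_def by simp

text \<open>Bridge from the Frechet derivatives in the definitions of harmonic and test functions to
  explicit derivatives along lines.\<close>

lemma Ck_on_2D:
  assumes "Ck_on 2 f S" "open S"
  shows "D2_along b f (dir_deriv b f) (dir_deriv b (dir_deriv b f)) S"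
proof -
  have 1: "f differentiable_on S" "dir_deriv b f differentiable_on S"
    "continuous_on S (dir_deriv b (dir_deriv b f))"
    using assms(1) by (auto simp: numeral_2_eq_2)
  have line: "((\<lambda>t. g (z + of_real t * b)) has_real_derivative dir_deriv b g z) (at 0)"
    if g: "g differentiable_on S" and z: "z \<in> S" for g z
  proof -
    have "g differentiable (at z)"
      using g z assms(2) by (simp add: differentiable_on_eq_differentiable_at)
    then have d: "(g has_derivative frechet_derivative g (at z)) (at (z + of_real 0 * b))"
      by (simp add: frechet_derivative_works)
    have "((\<lambda>t::real. z + of_real t * b) has_derivative (\<lambda>t. of_real t * b)) (at 0)"
      by (auto intro!: derivative_eq_intros)
    from has_derivative_compose[OF this d]
    have "((\<lambda>t. g (z + of_real t * b)) has_derivative (\<lambda>t. frechet_derivative g (at z) (of_real t * b))) (at 0)" .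
    moreover have "frechet_derivative g (at z) (of_real t * b) = dir_deriv b g z * t" for t
      using linear_frechet_derivative[OF \<open>g differentiable (at z)\<close>]
      by (metis dir_deriv_def linear_cmul mult.commute of_real_def real_scaleR_def scaleR_conv_of_real)
    ultimately show ?thesis by (simp add: has_field_derivative_def)
  qed
  show ?thesis unfolding D2_along_def
    using 1 line by (auto intro: differentiable_imp_continuous_on)
qed

lemma laplacian_alt: "laplacian f z = dir_deriv 1 (dir_deriv 1 f) z + dir_deriv \<i> (dir_deriv \<i> f) z"
  by (simp add: laplacian_def Basis_complex_def)

lemma dir_deriv_Re:
  assumes "F holomorphic_on S" "open S" "z \<in> S"
  shows "((\<lambda>z. Re (F z)) has_derivative (\<lambda>h. Re (deriv F z * h))) (at z)"
proof -
  have "(F has_derivative (*) (deriv F z)) (at z)"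
    using assms holomorphic_derivI has_field_derivative_def by blast
  then show ?thesis by (rule has_derivative_Re)
qed

text \<open>A directional derivative of Re F is Re (F' b), again the real part of a holomorphic
  function, so the induction runs over all \<open>F\<close> at once.\<close>

lemma Ck_on_Re:
  assumes "F holomorphic_on S" "open S"
  shows "Ck_on k (\<lambda>z. Re (F z)) S"
  using assms(1)
proof (induction k arbitrary: F)
  case 0 then show ?case by (auto intro!: continuous_intros holomorphic_on_imp_continuous_on)
next
  case (Suc k)
  have "Ck_on k (\<lambda>z. Re (deriv F z * b)) S" for b
    using Suc.prems assms(2) by (intro Suc.IH holomorphic_intros holomorphic_deriv)
  then have "Ck_on k (dir_deriv b (\<lambda>z. Re (F z))) S" for b
    by (rule Ck_on_cong[OF assms(2), rotated])
      (simp add: dir_deriv_eqI[OF dir_deriv_Re[OF Suc.prems assms(2)]])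
  then show ?case using dir_deriv_Re[OF Suc.prems assms(2)] assms(2)
    by (auto simp: differentiable_on_eq_differentiable_at differentiable_def)
qed

lemma harmonic_on_Re:
  assumes F: "F holomorphic_on S" and S: "open S"
  shows "harmonic_on (\<lambda>z. Re (F z)) S"
proof -
  have "dir_deriv b (dir_deriv b (\<lambda>z. Re (F z))) z = Re (deriv (deriv F) z * b * b)" if "z \<in> S" for b z
  proof -
    have h: "(\<lambda>w. deriv F w * b) holomorphic_on S"
      using assms by (intro holomorphic_intros holomorphic_deriv)
    have "((\<lambda>w. Re (deriv F w * b)) has_derivative (\<lambda>h. Re (deriv (\<lambda>w. deriv F w * b) z * h))) (at z)"
      by (rule dir_deriv_Re[OF h S that])
    then have "(dir_deriv b (\<lambda>z. Re (F z)) has_derivative (\<lambda>h. Re (deriv (\<lambda>w. deriv F w * b) z * h))) (at z)"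
      using dir_deriv_eqI[OF dir_deriv_Re[OF F S]] S that
      by (auto elim!: has_derivative_transform_within_open)
    moreover have "deriv (\<lambda>w. deriv F w * b) z = deriv (deriv F) z * b"
      using F S that by (intro deriv_cmult_right holomorphic_on_imp_differentiable_at holomorphic_deriv)
    ultimately show ?thesis by (simp add: dir_deriv_eqI)
  qed
  then show ?thesis using Ck_on_Re[OF assms] unfolding harmonic_on_def by (simp add: laplacian_alt)
qed

section \<open>Measures carried by the slices\<close>

text \<open>Level measures are assembled with it from four pieces: the lower and the upper end
  points of the slices, in each of the two directions.\<close>

definition add_measure :: "'a measure \<Rightarrow> 'a measure \<Rightarrow> 'a measure"
  where "add_measure M N = measure_of (space M) (sets M) (\<lambda>A. emeasure M A + emeasure N A)"

lemma sets_add_measure [simp, measurable_cong]: "sets (add_measure M N) = sets M"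
  by (simp add: add_measure_def sets.sigma_sets_eq)

lemma space_add_measure [simp]: "space (add_measure M N) = space M"
  by (simp add: add_measure_def)

lemma emeasure_add_measure:
  assumes "sets N = sets M" "A \<in> sets M"
  shows "emeasure (add_measure M N) A = emeasure M A + emeasure N A"
  unfolding add_measure_def
proof (rule emeasure_measure_of_sigma)
  show "sigma_algebra (space M) (sets M)" ..
  show "positive (sets M) (\<lambda>A. emeasure M A + emeasure N A)" by (simp add: positive_def)
  show "countably_additive (sets M) (\<lambda>A. emeasure M A + emeasure N A)"
  proof (rule countably_additiveI)
    fix A :: "nat \<Rightarrow> _" assume A: "range A \<subseteq> sets M" "disjoint_family A"
    then have "(\<Sum>i. emeasure M (A i)) = emeasure M (\<Union>i. A i)" "(\<Sum>i. emeasure N (A i)) = emeasure N (\<Union>i. A i)"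
      using assms by (auto intro!: suminf_emeasure)
    then show "(\<Sum>i. emeasure M (A i) + emeasure N (A i)) = emeasure M (\<Union>i. A i) + emeasure N (\<Union>i. A i)"
      by (subst suminf_add[symmetric]) auto
  qed
qed fact

lemma nn_integral_add_measure:
  assumes s: "sets N = sets M" and f: "f \<in> borel_measurable M"
  shows "(\<integral>\<^sup>+x. f x \<partial>add_measure M N) = (\<integral>\<^sup>+x. f x \<partial>M) + (\<integral>\<^sup>+x. f x \<partial>N)"
  using f
proof induct
  case (cong f g)
  then show ?case using sets_eq_imp_space_eq[OF s] by (metis nn_integral_cong space_add_measure)
next
  case (set A)
  then show ?case using s by (simp add: emeasure_add_measure)
next
  case (mult u c)
  then have "u \<in> borel_measurable N" using measurable_cong_sets[OF s refl] by blast
  then show ?case using mult by (simp add: nn_integral_cmult distrib_left)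
next
  case (add u v)
  then have "u \<in> borel_measurable N" "v \<in> borel_measurable N" using measurable_cong_sets[OF s refl] by blast+
  then show ?case using add by (simp add: nn_integral_add ac_simps)
next
  case (seq U)
  have N: "U i \<in> borel_measurable N" for i using seq measurable_cong_sets[OF s refl] by blast
  have m: "incseq (\<lambda>i. \<integral>\<^sup>+x. U i x \<partial>M)" "incseq (\<lambda>i. \<integral>\<^sup>+x. U i x \<partial>N)"
    using seq(4) by (auto simp: incseq_def le_fun_def intro!: nn_integral_mono)
  have "(\<integral>\<^sup>+x. (SUP i. U i x) \<partial>K) = (SUP i. \<integral>\<^sup>+x. U i x \<partial>K)"
    if "\<And>i. U i \<in> borel_measurable K" for K
    using seq(4) that by (intro nn_integral_monotone_convergence_SUP) auto
  then have "(\<integral>\<^sup>+x. (SUP i. U i x) \<partial>add_measure M N) = (SUP i. (\<integral>\<^sup>+x. U i x \<partial>M) + (\<integral>\<^sup>+x. U i x \<partial>N))"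
    "(\<integral>\<^sup>+x. (SUP i. U i x) \<partial>M) = (SUP i. \<integral>\<^sup>+x. U i x \<partial>M)"
    "(\<integral>\<^sup>+x. (SUP i. U i x) \<partial>N) = (SUP i. \<integral>\<^sup>+x. U i x \<partial>N)"
    using seq N by auto
  then show ?case using m by (simp add: ennreal_SUP_add SUP_image image_comp)
qed

lemma integral_add_measure:
  fixes f :: "'a \<Rightarrow> real"
  assumes s: "sets N = sets M" and f: "integrable M f" "integrable N f"
  shows "integrable (add_measure M N) f" "(LINT x|add_measure M N. f x) = (LINT x|M. f x) + (LINT x|N. f x)"
proof -
  have [measurable]: "f \<in> borel_measurable M" using f by auto
  show i: "integrable (add_measure M N) f"
    using f unfolding integrable_iff_bounded
    by (auto simp: nn_integral_add_measure[OF s])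
  have "(\<integral>\<^sup>+x. ennreal (f x) \<partial>M) < \<infinity>" "(\<integral>\<^sup>+x. ennreal (f x) \<partial>N) < \<infinity>"
    "(\<integral>\<^sup>+x. ennreal (- f x) \<partial>M) < \<infinity>" "(\<integral>\<^sup>+x. ennreal (- f x) \<partial>N) < \<infinity>"
    using f unfolding real_integrable_def by (auto simp: less_top)
  then show "(LINT x|add_measure M N. f x) = (LINT x|M. f x) + (LINT x|N. f x)"
    by (simp add: real_lebesgue_integral_def[OF i] real_lebesgue_integral_def[OF f(1)]
        real_lebesgue_integral_def[OF f(2)] nn_integral_add_measure[OF s] enn2real_plus)
qed

abbreviation borel_disc :: "complex measure"
  where "borel_disc \<equiv> restrict_space borel unit_disc"

lemma space_borel_disc [simp]: "space borel_disc = unit_disc"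
  by (simp add: space_restrict_space)

lemma borel_measurable_disc:
  "continuous_on unit_disc f \<Longrightarrow> sets M = sets borel_disc \<Longrightarrow> f \<in> borel_measurable M"
  for f :: "complex \<Rightarrow> 'b::topological_space"
  using borel_measurable_continuous_on_restrict[of unit_disc f] measurable_cong_sets[of M borel_disc borel borel]
  by auto

text \<open>\<open>\<Gamma>\<close> will follow one end point of the slices, and \<open>w\<close>
  will be the derivative of \<open>u\<close> there up to sign and a constant. The compact set
  \<open>K\<close> keeps the curve away from the unit circle, where \<open>\<psi>\<close> may be
  unbounded; with the bounded support of \<open>w\<close> this gives integrability.\<close>

lemma push_measure:
  fixes \<Gamma> :: "real \<Rightarrow> complex" and w :: "real \<Rightarrow> real"
  assumes [measurable]: "\<Gamma> \<in> borel_measurable borel" "w \<in> borel_measurable borel"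
    and K: "compact K" "K \<subseteq> unit_disc" "\<And>s. \<Gamma> s \<in> K"
    and w: "\<And>s. 0 \<le> w s" "\<And>s. w s \<le> C" "\<And>s. \<bar>s\<bar> > 1 \<Longrightarrow> w s = 0"
    and L: "\<And>s. w s \<noteq> 0 \<Longrightarrow> \<Gamma> s \<in> L" "unit_disc - L \<in> sets borel_disc"
  defines "\<mu> \<equiv> distr (density lborel (\<lambda>s. ennreal (w s))) borel_disc \<Gamma>"
  shows "emeasure \<mu> unit_disc < \<infinity>" "emeasure \<mu> (unit_disc - L) = 0"
    "continuous_on unit_disc \<psi> \<Longrightarrow> integrable \<mu> \<psi> \<and> integrable lborel (\<lambda>s. w s * \<psi> (\<Gamma> s)) \<and>
       (LINT z|\<mu>. \<psi> z) = (LINT s|lborel. w s * \<psi> (\<Gamma> s))"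
proof -
  have D: "\<Gamma> s \<in> unit_disc" for s using K(2,3) by blast
  have m[measurable]: "\<Gamma> \<in> measurable (density lborel (\<lambda>s. ennreal (w s))) borel_disc"
    by (rule measurable_restrict_space2) (use D in auto)
  have sd: "unit_disc \<in> sets borel_disc" using sets.top[of borel_disc] by simp
  have vim: "\<Gamma> -` A \<inter> space (density lborel (\<lambda>s. ennreal (w s))) \<in> sets lborel" if "A \<in> sets borel_disc" for A
    using measurable_sets[OF m that] by simp
  have e: "emeasure \<mu> A = (\<integral>\<^sup>+s. ennreal (w s) * indicator (\<Gamma> -` A) s \<partial>lborel)" if "A \<in> sets borel_disc" for A
    unfolding \<mu>_def using that vim[OF that]
    by (subst emeasure_distr[OF m that], subst emeasure_density) (auto)
  have "emeasure \<mu> unit_disc \<le> (\<integral>\<^sup>+s. ennreal C * indicator {-1..1::real} s \<partial>lborel)"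
    unfolding e[OF sd]
  proof (rule nn_integral_mono)
    fix s show "ennreal (w s) * indicator (\<Gamma> -` unit_disc) s \<le> ennreal C * indicator {-1..1} s"
      using w(1,2,3)[of s] by (auto split: split_indicator intro!: ennreal_leI)
  qed
  also have "\<dots> < \<infinity>" by (subst nn_integral_cmult_indicator) (auto simp: ennreal_mult_less_top)
  finally show "emeasure \<mu> unit_disc < \<infinity>" .
  have "ennreal (w s) * indicator (\<Gamma> -` (unit_disc - L)) s = 0" for s
    using L(1)[of s] by (cases "w s = 0") (auto split: split_indicator)
  then have "(\<lambda>s. ennreal (w s) * indicator (\<Gamma> -` (unit_disc - L)) s) = (\<lambda>s. 0)" by (rule ext)
  then show "emeasure \<mu> (unit_disc - L) = 0" unfolding e[OF L(2)] by (simp only: nn_integral_const) simp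
  assume c: "continuous_on unit_disc \<psi>"
  then have p[measurable]: "\<psi> \<in> borel_measurable borel_disc" by (rule borel_measurable_disc) simp
  have [measurable]: "(\<lambda>s. \<psi> (\<Gamma> s)) \<in> borel_measurable borel"
    using measurable_compose[OF m p] by (simp cong: measurable_cong_sets)
  obtain B where B: "\<And>z. z \<in> K \<Longrightarrow> \<bar>\<psi> z\<bar> \<le> B"
    using compact_imp_bounded[OF compact_continuous_image[OF continuous_on_subset[OF c K(2)] K(1)]]
    unfolding bounded_iff by auto
  have bd: "\<bar>w s * \<psi> (\<Gamma> s)\<bar> \<le> C * B * indicator {-1..1} s" for s
  proof (cases "\<bar>s\<bar> > 1")
    case True then show ?thesis using w(3) by (auto split: split_indicator)
  next
    case False
    have "\<bar>w s * \<psi> (\<Gamma> s)\<bar> \<le> C * B" unfolding abs_mult using w(1,2)[of s] B[OF K(3)[of s]]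
      by (intro mult_mono) auto
    with False show ?thesis by (auto split: split_indicator)
  qed
  have i: "integrable lborel (\<lambda>s. w s * \<psi> (\<Gamma> s))"
  proof (rule Bochner_Integration.integrable_bound)
    show "integrable lborel (\<lambda>s::real. C * B * indicator {-1..1} s)" by auto
    show "AE s in lborel. norm (w s * \<psi> (\<Gamma> s)) \<le> norm (C * B * indicator {- 1..1} s)"
      using bd by (auto intro!: AE_I2 order_trans[OF bd])
  qed simp
  have "integrable \<mu> \<psi>" unfolding \<mu>_def using i w(1)
    by (simp add: integrable_distr_eq[OF m p] integrable_density)
  moreover have "(LINT z|\<mu>. \<psi> z) = (LINT s|lborel. w s * \<psi> (\<Gamma> s))" unfolding \<mu>_def using w(1)
    by (simp add: integral_distr[OF m p] integral_density)
  ultimately show "integrable \<mu> \<psi> \<and> integrable lborel (\<lambda>s. w s * \<psi> (\<Gamma> s)) \<and>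
       (LINT z|\<mu>. \<psi> z) = (LINT s|lborel. w s * \<psi> (\<Gamma> s))" using i by blast
qed

section \<open>Slices of sublevel sets and the measure carried by their end points\<close>

lemma open_convex_real_eq:
  fixes T :: "real set"
  assumes "open T" "convex T" "bounded T" "T \<noteq> {}"
  shows "T = {Inf T<..<Sup T}"
proof -
  have bd: "bdd_above T" "bdd_below T"
    using assms(3) by (auto simp: bounded_imp_bdd_above bounded_imp_bdd_below)
  have "Inf T < t" "t < Sup T" if "t \<in> T" for t
  proof -
    obtain e where e: "e > 0" "ball t e \<subseteq> T" using assms(1) \<open>t \<in> T\<close> openE by blast
    then have "t - e / 2 \<in> T" "t + e / 2 \<in> T" by (auto simp: dist_real_def subset_iff)
    then show "Inf T < t" "t < Sup T"
      using cInf_lower[OF _ bd(2), of "t - e/2"] cSup_upper[OF _ bd(1), of "t + e/2"] e(1) by auto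
  qed
  moreover have "t \<in> T" if "Inf T < t" "t < Sup T" for t
  proof -
    have "\<exists>a\<in>T. a < t" using that(1) by (subst (asm) cInf_less_iff[OF assms(4) bd(2)])
    then obtain a where "a \<in> T" "a < t" by blast
    moreover have "\<exists>b\<in>T. t < b" using that(2) by (subst (asm) less_cSup_iff[OF assms(4) bd(1)])
    then obtain b where "b \<in> T" "t < b" by blast
    ultimately show ?thesis using assms(2)
      by (meson is_interval_1 is_interval_convex_1 less_imp_le)
  qed
  ultimately show ?thesis by auto
qed

lemma derivative_nonneg_at_right_end:
  fixes f :: "real \<Rightarrow> real"
  assumes "(f has_real_derivative l) (at b)" "a < b" "\<And>t. a < t \<Longrightarrow> t < b \<Longrightarrow> f t < f b"
  shows "0 \<le> l"
proof (rule ccontr)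
  assume "\<not> 0 \<le> l"
  then obtain d where d: "d > 0" "\<And>h. h > 0 \<Longrightarrow> h < d \<Longrightarrow> f b < f (b - h)"
    using DERIV_neg_dec_left[OF assms(1)] by auto
  define h where "h = min (d / 2) ((b - a) / 2)"
  have "h > 0" "h < d" "a < b - h" using d(1) assms(2) unfolding h_def min_def by (auto simp: field_simps)
  then show False using d(2)[of h] assms(3)[of "b - h"] by auto
qed

lemma derivative_nonpos_at_left_end:
  fixes f :: "real \<Rightarrow> real"
  assumes "(f has_real_derivative l) (at a)" "a < b" "\<And>t. a < t \<Longrightarrow> t < b \<Longrightarrow> f t < f a"
  shows "l \<le> 0"
proof (rule ccontr)
  assume "\<not> l \<le> 0"
  then obtain d where d: "d > 0" "\<And>h. h > 0 \<Longrightarrow> h < d \<Longrightarrow> f a < f (a + h)"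
    using DERIV_pos_inc_right[OF assms(1)] by auto
  define h where "h = min (d / 2) ((b - a) / 2)"
  have "h > 0" "h < d" "a + h < b" using d(1) assms(2) unfolding h_def min_def by (auto simp: field_simps)
  then show False using d(2)[of h] assms(3)[of "a + h"] by auto
qed

lemma open_sublevel:
  fixes u :: "complex \<Rightarrow> real"
  assumes "continuous_on unit_disc u"
  shows "open {z\<in>unit_disc. u z < r}"
proof -
  have "{z\<in>unit_disc. u z < r} = unit_disc \<inter> u -` {..<r}" by auto
  then show ?thesis using continuous_open_preimage[OF assms open_ball open_lessThan] by simp
qed

lemma compact_closure_disc: "A \<subseteq> unit_disc \<Longrightarrow> compact (closure A)"
  using bounded_subset[OF bounded_ball] by (simp add: compact_closure)

lemma level_complement_sets:
  fixes u :: "complex \<Rightarrow> real"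
  assumes "continuous_on unit_disc u" "sets M = sets borel_disc"
  shows "unit_disc - {z\<in>unit_disc. u z = r} \<in> sets M"
proof -
  have [measurable]: "u \<in> borel_measurable M" by (rule borel_measurable_disc[OF assms])
  have sp: "space M = unit_disc" using sets_eq_imp_space_eq[OF assms(2)] by simp
  have "unit_disc - {z\<in>unit_disc. u z = r} = {z \<in> space M. u z \<noteq> r}" unfolding sp by blast
  moreover have "{z \<in> space M. u z \<noteq> r} \<in> sets M" by measurable
  ultimately show ?thesis by simp
qed

lemma integrable_indicator_disc:
  fixes h :: "complex \<Rightarrow> real"
  assumes B: "B \<in> sets borel" and cl: "closure B \<subseteq> unit_disc" and hc: "continuous_on unit_disc h"
  shows "integrable lborel (\<lambda>z. indicator B z * h z)"
proof -
  have "B \<subseteq> unit_disc" using cl closure_subset by blast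
  then have "compact (closure B)" by (rule compact_closure_disc)
  then have "integrable lborel (\<lambda>z. indicator (closure B) z *\<^sub>R h z)"
    by (rule borel_integrable_compact) (rule continuous_on_subset[OF hc cl])
  then have "integrable lborel (\<lambda>z. indicator B z *\<^sub>R (indicator (closure B) z *\<^sub>R h z))"
    by (rule integrable_mult_indicator[rotated]) (use B in simp)
  moreover have "(\<lambda>z. indicator B z *\<^sub>R (indicator (closure B) z *\<^sub>R h z)) = (\<lambda>z. indicator B z * h z)"
    using closure_subset[of B] by (auto simp: fun_eq_iff split: split_indicator)
  ultimately show ?thesis by (simp only:)
qed

text \<open>
  On a slice, \<open>(r - u) \<psi>' + u' \<psi>\<close> is an antiderivative of \<open>\<psi> u'' + (r - u) \<psi>''\<close>, and at the end points
  of the slice only \<open>u' \<psi>\<close> remains; the sign of \<open>u'\<close> there makes the resulting functional positive.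
\<close>

lemma slice_level_measure:
  fixes u ub ubb :: "complex \<Rightarrow> real"
  assumes b: "b \<in> Basis" and u: "D2_along b u ub ubb unit_disc"
    and cl: "closure {z\<in>unit_disc. u z < r} \<subseteq> unit_disc"
    and conv: "\<And>s. convex {t. line_pt b s t \<in> unit_disc \<and> u (line_pt b s t) < r}"
    and c: "c > 0"
  obtains \<mu> where "sets \<mu> = sets borel_disc" "emeasure \<mu> unit_disc < \<infinity>"
    "emeasure \<mu> (unit_disc - {z\<in>unit_disc. u z = r}) = 0"
    "\<And>\<psi> \<psi>1 \<psi>2. D2_along b \<psi> \<psi>1 \<psi>2 unit_disc \<Longrightarrow> integrable \<mu> \<psi> \<and>
       (LINT z|\<mu>. \<psi> z) = c * (LINT z|lborel. indicator {z\<in>unit_disc. u z < r} z * (\<psi> z * ubb z + (r - u z) * \<psi>2 z))"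
proof -
  define B where "B = {z\<in>unit_disc. u z < r}"
  define L where "L = {z\<in>unit_disc. u z = r}"
  define T where "T s = {t. line_pt b s t \<in> B}" for s
  define Y where "Y = {s. T s \<noteq> {}}"
  define p where "p s = (if s \<in> Y then Sup (T s) else 0)" for s
  define q where "q s = (if s \<in> Y then Inf (T s) else 0)" for s
  note uc = D2_along_cont[OF u]
  have B: "open B" "B \<subseteq> unit_disc"
    unfolding B_def using open_sublevel[OF uc(1)] by auto
  have LB: "unit_disc - L \<in> sets borel_disc"
    unfolding L_def by (rule level_complement_sets[OF uc(1) refl])
  have clB: "closure B \<subseteq> unit_disc" using cl by (simp add: B_def)
  have comp: "compact (closure B)"
    by (rule compact_closure_disc[OF B(2)])
  have Top: "open (T s)" for s
  proof -
    have "continuous_on UNIV (line_pt b s)" by (intro continuous_intros)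
    then have "open (line_pt b s -` B)" using B(1) open_vimage by blast
    then show ?thesis by (simp add: T_def vimage_def)
  qed
  have Tconv: "convex (T s)" for s using conv[of s] by (simp add: T_def B_def)
  have Tb: "\<bar>s\<bar> < 1" "\<bar>t\<bar> < 1" if "t \<in> T s" for s t
    using that B(2) abs_le_norm_line_pt[OF b, of s t] abs_le_norm_line_pt[OF b, of t s] by (auto simp: T_def)
  have Tbd: "bounded (T s)" for s
    using Tb(2) unfolding bounded_iff by (metis less_imp_le real_norm_def)
  have Teq: "T s = {q s<..<p s}" if "s \<in> Y" for s
    using open_convex_real_eq[OF Top Tconv Tbd, of s] that by (simp add: p_def q_def Y_def)
  have memB: "line_pt b s t \<in> B \<longleftrightarrow> q s < t \<and> t < p s" if "s \<in> Y" for s t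
  proof -
    have "t \<in> T s \<longleftrightarrow> t \<in> {q s<..<p s}" using Teq[OF that] by (simp only:)
    then show ?thesis by (simp add: T_def)
  qed
  have qp: "q s < p s" if "s \<in> Y" for s
    using Teq[OF that] that by (auto simp: Y_def)
  have Yb: "\<bar>s\<bar> < 1" if "s \<in> Y" for s using that Tb(1) by (auto simp: Y_def)
  \<comment> \<open>An end point is a limit of points of \<open>B\<close>, so it stays in the disc
    and has u at most r. It does not belong to the open slice itself, which leaves only
    equality.\<close>
  have end_in: "line_pt b s t \<in> closure B \<inter> L" if "s \<in> Y" "t \<in> {q s, p s}" for s t
  proof -
    have "t \<in> closure (T s)" using Teq[OF that(1)] qp[OF that(1)] that(2) by auto
    moreover have "continuous_on (closure (T s)) (line_pt b s)" by (intro continuous_intros)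
    moreover have "line_pt b s ` T s \<subseteq> closure B" using closure_subset by (auto simp: T_def)
    ultimately have cb: "line_pt b s t \<in> closure B"
      using image_closure_subset[of "T s" "line_pt b s" "closure B"] by blast
    have "u (line_pt b s t) \<le> r"
      by (rule continuous_le_on_closure[of B u]) (use cb clB uc(1) in \<open>auto simp: B_def intro: continuous_on_subset\<close>)
    moreover have "t \<notin> T s" using Teq[OF that(1)] that(2) by auto
    ultimately show ?thesis using cb clB by (auto simp: T_def B_def L_def)
  qed
  \<comment> \<open>Measurability of the end points: the supremum of a slice exceeds
    \<open>a\<close> exactly when the slice meets \<open>{a<..}\<close>, and the set of such
    \<open>s\<close> is a union of open sections of \<open>B\<close>. The infimum is
    symmetric.\<close>
  have Yopen: "open {s. \<exists>t\<in>I. line_pt b s t \<in> B}" for I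
  proof -
    have "open ((\<lambda>s. line_pt b s t) -` B)" for t
      using B(1) by (intro open_vimage continuous_intros)
    then have "open (\<Union>t\<in>I. (\<lambda>s. line_pt b s t) -` B)" by blast
    moreover have "(\<Union>t\<in>I. (\<lambda>s. line_pt b s t) -` B) = {s. \<exists>t\<in>I. line_pt b s t \<in> B}" by auto
    ultimately show ?thesis by simp
  qed
  have "Y = {s. \<exists>t\<in>UNIV. line_pt b s t \<in> B}" by (auto simp: Y_def T_def)
  then have Ym[measurable]: "Y \<in> sets borel" using Yopen[of UNIV] by simp
  have pm[measurable]: "p \<in> borel_measurable borel"
  proof (subst borel_measurable_iff_greater, intro allI)
    fix a
    have "a < p s \<longleftrightarrow> (\<exists>t\<in>{a<..}. line_pt b s t \<in> B)" if "s \<in> Y" for s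
    proof -
      have "(\<exists>t\<in>{a<..}. line_pt b s t \<in> B) \<longleftrightarrow> (\<exists>t>a. q s < t \<and> t < p s)"
        by (auto simp: memB[OF that])
      also have "\<dots> \<longleftrightarrow> a < p s"
        using dense[of "max a (q s)" "p s"] qp[OF that] by (auto)
      finally show ?thesis by simp
    qed
    then have "{s \<in> space borel. a < p s} = (Y \<inter> {s. \<exists>t\<in>{a<..}. line_pt b s t \<in> B}) \<union> ((-Y) \<inter> {s. a < 0})"
      by (auto simp: p_def)
    then show "{s \<in> space borel. a < p s} \<in> sets borel" using Yopen[of "{a<..}"] by auto
  qed
  have qm[measurable]: "q \<in> borel_measurable borel"
  proof (subst borel_measurable_iff_less, intro allI)
    fix a
    have "q s < a \<longleftrightarrow> (\<exists>t\<in>{..<a}. line_pt b s t \<in> B)" if "s \<in> Y" for s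
    proof -
      have "(\<exists>t\<in>{..<a}. line_pt b s t \<in> B) \<longleftrightarrow> (\<exists>t<a. q s < t \<and> t < p s)"
        by (auto simp: memB[OF that])
      also have "\<dots> \<longleftrightarrow> q s < a"
        using dense[of "q s" "min a (p s)"] qp[OF that] by (auto)
      finally show ?thesis by simp
    qed
    then have "{s \<in> space borel. q s < a} = (Y \<inter> {s. \<exists>t\<in>{..<a}. line_pt b s t \<in> B}) \<union> ((-Y) \<inter> {s. 0 < a})"
      by (auto simp: q_def)
    then show "{s \<in> space borel. q s < a} \<in> sets borel" using Yopen[of "{..<a}"] by auto
  qed
  \<comment> \<open>Slices that miss \<open>B\<close> get the dummy point 0 and weight 0; the point
    has to lie in the disc so that both curves stay in one compact set \<open>K\<close>.\<close>
  define \<Gamma>p where "\<Gamma>p s = (if s \<in> Y then line_pt b s (p s) else 0)" for s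
  define \<Gamma>q where "\<Gamma>q s = (if s \<in> Y then line_pt b s (q s) else 0)" for s
  define wp where "wp s = (if s \<in> Y then c * ub (\<Gamma>p s) else 0)" for s
  define wq where "wq s = (if s \<in> Y then - c * ub (\<Gamma>q s) else 0)" for s
  have \<Gamma>m[measurable]: "\<Gamma>p \<in> borel_measurable borel" "\<Gamma>q \<in> borel_measurable borel"
    unfolding \<Gamma>p_def \<Gamma>q_def by measurable
  define K where "K = insert 0 (closure B)"
  have K: "compact K" "K \<subseteq> unit_disc" using comp clB by (auto simp: K_def)
  have \<Gamma>K: "\<Gamma>p s \<in> K" "\<Gamma>q s \<in> K" for s
    using end_in[of s] by (auto simp: \<Gamma>p_def \<Gamma>q_def K_def)
  have ubm: "(\<lambda>z. indicator unit_disc z * ub z) \<in> borel_measurable borel"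
    using borel_measurable_continuous_on_indicator[OF _ uc(2)] by simp
  have wm[measurable]: "wp \<in> borel_measurable borel" "wq \<in> borel_measurable borel"
  proof -
    have "wp = (\<lambda>s. if s \<in> Y then c * (indicator unit_disc (\<Gamma>p s) * ub (\<Gamma>p s)) else 0)"
      "wq = (\<lambda>s. if s \<in> Y then - c * (indicator unit_disc (\<Gamma>q s) * ub (\<Gamma>q s)) else 0)"
      using subsetD[OF K(2) \<Gamma>K(1)] subsetD[OF K(2) \<Gamma>K(2)] by (auto simp: fun_eq_iff wp_def wq_def)
    then show "wp \<in> borel_measurable borel" "wq \<in> borel_measurable borel"
      using measurable_compose[OF \<Gamma>m(1) ubm] measurable_compose[OF \<Gamma>m(2) ubm] by auto
  qed
  obtain C where C: "\<And>z. z \<in> K \<Longrightarrow> \<bar>ub z\<bar> \<le> C"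
    using compact_imp_bounded[OF compact_continuous_image[OF continuous_on_subset[OF uc(2) K(2)] K(1)]]
    unfolding bounded_iff by auto
  have C0: "0 \<le> C" using C[of 0] by (auto simp: K_def)
  have lt: "u (line_pt b s t) < u (line_pt b s (p s))" "u (line_pt b s t) < u (line_pt b s (q s))"
    if "s \<in> Y" "q s < t" "t < p s" for s t
  proof -
    have "line_pt b s t \<in> B" using that by (simp add: memB)
    then show "u (line_pt b s t) < u (line_pt b s (p s))" "u (line_pt b s t) < u (line_pt b s (q s))"
      using end_in[OF that(1), of "p s"] end_in[OF that(1), of "q s"] by (auto simp: L_def B_def)
  qed
  have Dend: "line_pt b s (p s) \<in> unit_disc" "line_pt b s (q s) \<in> unit_disc" if "s \<in> Y" for s
    using end_in[OF that] by (auto simp: L_def)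
  have w0: "0 \<le> wp s" "0 \<le> wq s" for s
  proof -
    show "0 \<le> wp s"
    proof (cases "s \<in> Y")
      case True
      have "0 \<le> ub (line_pt b s (p s))"
        by (rule derivative_nonneg_at_right_end[OF D2_along_line(1)[OF u Dend(1)[OF True]] qp[OF True]])
           (use lt[OF True] in auto)
      then show ?thesis using c by (simp add: wp_def \<Gamma>p_def True)
    qed (simp add: wp_def)
    show "0 \<le> wq s"
    proof (cases "s \<in> Y")
      case True
      have "ub (line_pt b s (q s)) \<le> 0"
        by (rule derivative_nonpos_at_left_end[OF D2_along_line(1)[OF u Dend(2)[OF True]] qp[OF True]])
           (use lt[OF True] in auto)
      then show ?thesis using c by (simp add: wq_def \<Gamma>q_def True mult_nonneg_nonpos)
    qed (simp add: wq_def)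
  qed
  have wC: "wp s \<le> c * C" "wq s \<le> c * C" for s
  proof -
    have "c * ub (\<Gamma>p s) \<le> c * C" "c * (- ub (\<Gamma>q s)) \<le> c * C"
      using C[OF \<Gamma>K(1)[of s]] C[OF \<Gamma>K(2)[of s]] c by (intro mult_left_mono; simp add: abs_le_iff)+
    then show "wp s \<le> c * C" "wq s \<le> c * C" using c C0 by (auto simp: wp_def wq_def)
  qed
  have wz: "\<bar>s\<bar> > 1 \<Longrightarrow> wp s = 0" "\<bar>s\<bar> > 1 \<Longrightarrow> wq s = 0" for s
    using Yb[of s] by (auto simp: wp_def wq_def)
  have wL: "wp s \<noteq> 0 \<Longrightarrow> \<Gamma>p s \<in> L" "wq s \<noteq> 0 \<Longrightarrow> \<Gamma>q s \<in> L" for s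
    using end_in[of s] by (auto simp: wp_def wq_def \<Gamma>p_def \<Gamma>q_def split: if_splits)
  define M where "M = distr (density lborel (\<lambda>s. ennreal (wp s))) borel_disc \<Gamma>p"
  define N where "N = distr (density lborel (\<lambda>s. ennreal (wq s))) borel_disc \<Gamma>q"
  note M = push_measure[OF \<Gamma>m(1) wm(1) K \<Gamma>K(1) w0(1) wC(1) wz(1) wL(1) LB, folded M_def]
  note N = push_measure[OF \<Gamma>m(2) wm(2) K \<Gamma>K(2) w0(2) wC(2) wz(2) wL(2) LB, folded N_def]
  define \<mu> where "\<mu> = add_measure M N"
  have sMN: "sets M = sets borel_disc" "sets N = sets M" by (simp_all add: M_def N_def)
  have sd: "unit_disc \<in> sets borel_disc" using sets.top[of borel_disc] by simp
  show ?thesis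
  proof (rule that[of \<mu>])
    show "sets \<mu> = sets borel_disc" by (simp add: \<mu>_def sMN)
    show "emeasure \<mu> unit_disc < \<infinity>"
      unfolding \<mu>_def using sd by (subst emeasure_add_measure[OF sMN(2)]) (use M(1) N(1) sMN in auto)
    show "emeasure \<mu> (unit_disc - {z\<in>unit_disc. u z = r}) = 0"
      unfolding \<mu>_def L_def[symmetric] using LB by (subst emeasure_add_measure[OF sMN(2)]) (use M(2) N(2) sMN in auto)
    fix \<psi> \<psi>1 \<psi>2 assume \<psi>: "D2_along b \<psi> \<psi>1 \<psi>2 unit_disc"
    note \<psi>c = D2_along_cont[OF \<psi>]
    define h where "h z = \<psi> z * ubb z + (r - u z) * \<psi>2 z" for z
    have hc: "continuous_on unit_disc h" unfolding h_def by (intro continuous_intros uc \<psi>c)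
    have MI: "integrable M \<psi>" "integrable lborel (\<lambda>s. wp s * \<psi> (\<Gamma>p s))" "(LINT z|M. \<psi> z) = (LINT s|lborel. wp s * \<psi> (\<Gamma>p s))"
      and NI: "integrable N \<psi>" "integrable lborel (\<lambda>s. wq s * \<psi> (\<Gamma>q s))" "(LINT z|N. \<psi> z) = (LINT s|lborel. wq s * \<psi> (\<Gamma>q s))"
      using M(3)[of \<psi>] N(3)[of \<psi>] \<psi>c(1) by auto
    have ih: "integrable lborel (\<lambda>z. indicator B z * h z)"
      by (rule integrable_indicator_disc[OF _ clB hc]) (use B(1) in simp)
    have slice: "c * (LINT t|lborel. indicator B (line_pt b s t) * h (line_pt b s t)) = wp s * \<psi> (\<Gamma>p s) + wq s * \<psi> (\<Gamma>q s)" for s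
    proof (cases "s \<in> Y")
      case False
      then have "indicator B (line_pt b s t) = (0::real)" for t by (auto simp: Y_def T_def indicator_def)
      then show ?thesis using False by (simp add: wp_def wq_def)
    next
      case True
      have D: "line_pt b s t \<in> unit_disc" if "q s \<le> t" "t \<le> p s" for t
      proof (cases "t \<in> {q s, p s}")
        case True then show ?thesis using Dend[OF \<open>s \<in> Y\<close>] by auto
      next
        case False
        then have "line_pt b s t \<in> B" using that by (simp add: memB[OF \<open>s \<in> Y\<close>])
        then show ?thesis using B(2) by (rule subsetD[rotated])
      qed
      have "(LINT t|lborel. indicator B (line_pt b s t) * h (line_pt b s t)) = (LINT t|lborel. h (line_pt b s t) * indicator {q s..p s} t)"
      proof (rule integral_cong_AE)
        have hm: "(\<lambda>z. indicator B z * h z) \<in> borel_measurable borel" using ih by auto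
        show "(\<lambda>t. indicator B (line_pt b s t) * h (line_pt b s t)) \<in> borel_measurable lborel"
          using measurable_compose[OF borel_measurable_line_pt[of "\<lambda>_. s" lborel "\<lambda>t. t" b] hm] by simp
        have "continuous_on {q s..p s} (\<lambda>t. h (line_pt b s t))"
          by (rule continuous_on_compose2[OF hc]) (auto intro!: continuous_intros D)
        then show "(\<lambda>t. h (line_pt b s t) * indicator {q s..p s} t) \<in> borel_measurable lborel"
          using borel_measurable_continuous_on_indicator[of "{q s..p s}" "\<lambda>t. h (line_pt b s t)"]
          by (simp add: mult.commute)
        \<comment> \<open>\<open>B\<close> cuts out the open interval, whereas the fundamental
          theorem speaks of the closed one; they differ in two points.\<close>
        show "AE t in lborel. indicator B (line_pt b s t) * h (line_pt b s t) = h (line_pt b s t) * indicator {q s..p s} t"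
          using AE_lborel_singleton[of "q s"] AE_lborel_singleton[of "p s"]
        proof eventually_elim
          fix t assume t: "t \<noteq> q s" "t \<noteq> p s"
          then show "indicator B (line_pt b s t) * h (line_pt b s t) = h (line_pt b s t) * indicator {q s..p s} t"
            by (auto simp: indicator_def memB[OF True])
        qed
      qed
      also have "\<dots> = ((r - u (line_pt b s (p s))) * \<psi>1 (line_pt b s (p s)) + ub (line_pt b s (p s)) * \<psi> (line_pt b s (p s)))
          - ((r - u (line_pt b s (q s))) * \<psi>1 (line_pt b s (q s)) + ub (line_pt b s (q s)) * \<psi> (line_pt b s (q s)))"
      proof (rule integral_FTC_Icc_real)
        show "q s \<le> p s" using qp[OF True] by simp
        fix t assume t: "q s \<le> t" "t \<le> p s"
        note D2_along_line[OF u D[OF t]] D2_along_line[OF \<psi> D[OF t]]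
        then show "DERIV (\<lambda>t. (r - u (line_pt b s t)) * \<psi>1 (line_pt b s t) + ub (line_pt b s t) * \<psi> (line_pt b s t)) t :> h (line_pt b s t)"
          by (auto intro!: derivative_eq_intros simp: h_def algebra_simps)
        have "isCont h (line_pt b s t)" using hc D[OF t] by (simp add: continuous_on_eq_continuous_at)
        moreover have "isCont (line_pt b s) t"
          unfolding line_pt_def by (intro continuous_intros)
        ultimately show "isCont (\<lambda>t. h (line_pt b s t)) t" using isCont_o2[of t "line_pt b s" h] by simp
      qed
      also have "\<dots> = ub (line_pt b s (p s)) * \<psi> (line_pt b s (p s)) - ub (line_pt b s (q s)) * \<psi> (line_pt b s (q s))"
        using end_in[OF True] by (simp add: L_def)
      finally show ?thesis using True by (simp add: wp_def wq_def \<Gamma>p_def \<Gamma>q_def right_diff_distrib mult.assoc)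
    qed
    have "c * (LINT z|lborel. indicator B z * h z) = (LINT s|lborel. c * (LINT t|lborel. indicator B (line_pt b s t) * h (line_pt b s t)))"
      by (subst integral_line_pt(1)[OF b ih]) simp
    also have "\<dots> = (LINT s|lborel. wp s * \<psi> (\<Gamma>p s)) + (LINT s|lborel. wq s * \<psi> (\<Gamma>q s))"
      unfolding slice using MI NI by simp
    also have "\<dots> = (LINT z|\<mu>. \<psi> z)"
      unfolding \<mu>_def using integral_add_measure(2)[OF sMN(2) MI(1) NI(1)] MI NI by simp
    finally show "integrable \<mu> \<psi> \<and>
       (LINT z|\<mu>. \<psi> z) = c * (LINT z|lborel. indicator {z\<in>unit_disc. u z < r} z * (\<psi> z * ubb z + (r - u z) * \<psi>2 z))"
      using integral_add_measure(1)[OF sMN(2) MI(1) NI(1)] by (simp add: \<mu>_def h_def B_def)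
  qed
qed

text \<open>Adding the measures of the horizontal and the vertical slices completes the
  one-directional second derivatives to Laplacians. The factor \<open>c\<close> is left free because
  the formula serves twice: with 1 / (2 pi) for level measures in the sense of the definition, and
  with 1 for |z|^2 and its circles.\<close>

lemma level_measure_exists:
  fixes u :: "complex \<Rightarrow> real" and u1 u2 :: "complex \<Rightarrow> complex \<Rightarrow> real"
  assumes u: "\<And>b. b \<in> Basis \<Longrightarrow> D2_along b u (u1 b) (u2 b) unit_disc"
    and cl: "closure {z\<in>unit_disc. u z < r} \<subseteq> unit_disc"
    and conv: "\<And>b s. b \<in> Basis \<Longrightarrow> convex {t. line_pt b s t \<in> unit_disc \<and> u (line_pt b s t) < r}"
    and c: "c > 0"
  obtains \<mu> where "sets \<mu> = sets borel_disc" "emeasure \<mu> unit_disc < \<infinity>"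
    "emeasure \<mu> (unit_disc - {z\<in>unit_disc. u z = r}) = 0"
    "\<And>\<psi> \<psi>1 \<psi>2. (\<And>b. b \<in> Basis \<Longrightarrow> D2_along b \<psi> (\<psi>1 b) (\<psi>2 b) unit_disc) \<Longrightarrow> integrable \<mu> \<psi> \<and>
       (LINT z|\<mu>. \<psi> z) = c * (LINT z|lborel. indicator {z\<in>unit_disc. u z < r} z *
          (\<psi> z * (\<Sum>b\<in>Basis. u2 b z) + (r - u z) * (\<Sum>b\<in>Basis. \<psi>2 b z)))"
proof -
  let ?B = "{z\<in>unit_disc. u z < r}"
  let ?L = "{z\<in>unit_disc. u z = r}"
  have Bs: "(1::complex) \<in> Basis" "\<i> \<in> Basis" by (auto simp: Basis_complex_def)
  obtain M where M: "sets M = sets borel_disc" "emeasure M unit_disc < \<infinity>" "emeasure M (unit_disc - ?L) = 0"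
    "\<And>\<psi> \<psi>1 \<psi>2. D2_along 1 \<psi> \<psi>1 \<psi>2 unit_disc \<Longrightarrow> integrable M \<psi> \<and>
       (LINT z|M. \<psi> z) = c * (LINT z|lborel. indicator ?B z * (\<psi> z * u2 1 z + (r - u z) * \<psi>2 z))"
    using slice_level_measure[OF Bs(1) u[OF Bs(1)] cl conv[OF Bs(1)] c] by blast
  obtain N where N: "sets N = sets borel_disc" "emeasure N unit_disc < \<infinity>" "emeasure N (unit_disc - ?L) = 0"
    "\<And>\<psi> \<psi>1 \<psi>2. D2_along \<i> \<psi> \<psi>1 \<psi>2 unit_disc \<Longrightarrow> integrable N \<psi> \<and>
       (LINT z|N. \<psi> z) = c * (LINT z|lborel. indicator ?B z * (\<psi> z * u2 \<i> z + (r - u z) * \<psi>2 z))"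
    using slice_level_measure[OF Bs(2) u[OF Bs(2)] cl conv[OF Bs(2)] c] by blast
  have s: "sets N = sets M" using M N by simp
  have sd: "unit_disc \<in> sets M" using sets.top[of borel_disc] M(1) by simp
  have Bo: "open ?B"
    by (rule open_sublevel[OF D2_along_cont(1)[OF u[OF Bs(1)]]])
  have L: "unit_disc - ?L \<in> sets M"
    by (rule level_complement_sets[OF D2_along_cont(1)[OF u[OF Bs(1)]] M(1)])
  show ?thesis
  proof (rule that[of "add_measure M N"])
    show "sets (add_measure M N) = sets borel_disc" using M by simp
    show "emeasure (add_measure M N) unit_disc < \<infinity>" using M N sd by (simp add: emeasure_add_measure[OF s])
    show "emeasure (add_measure M N) (unit_disc - ?L) = 0" using M N L by (simp add: emeasure_add_measure[OF s])
    fix \<psi> \<psi>1 \<psi>2 assume \<psi>: "\<And>b. b \<in> Basis \<Longrightarrow> D2_along b \<psi> (\<psi>1 b) (\<psi>2 b) unit_disc"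
    have I: "integrable lborel (\<lambda>z. indicator ?B z * h z)" if hc: "continuous_on unit_disc h" for h :: "complex \<Rightarrow> real"
      by (rule integrable_indicator_disc[OF _ cl hc]) (use Bo in simp)
    have c1: "continuous_on unit_disc (\<lambda>z. \<psi> z * u2 b z + (r - u z) * \<psi>2 b z)" if "b \<in> Basis" for b
      by (intro continuous_intros D2_along_cont[OF u[OF that]] D2_along_cont[OF \<psi>[OF that]])
    have "(LINT z|lborel. indicator ?B z * (\<psi> z * u2 1 z + (r - u z) * \<psi>2 1 z))
        + (LINT z|lborel. indicator ?B z * (\<psi> z * u2 \<i> z + (r - u z) * \<psi>2 \<i> z))
        = (LINT z|lborel. indicator ?B z * (\<psi> z * u2 1 z + (r - u z) * \<psi>2 1 z) +
             indicator ?B z * (\<psi> z * u2 \<i> z + (r - u z) * \<psi>2 \<i> z))"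
      using I[OF c1[OF Bs(1)]] I[OF c1[OF Bs(2)]] by simp
    also have "\<dots> = (LINT z|lborel. indicator ?B z *
          (\<psi> z * (\<Sum>b\<in>Basis. u2 b z) + (r - u z) * (\<Sum>b\<in>Basis. \<psi>2 b z)))"
      by (rule Bochner_Integration.integral_cong) (auto simp: Basis_complex_def algebra_simps)
    finally show "integrable (add_measure M N) \<psi> \<and>
       (LINT z|add_measure M N. \<psi> z) = c * (LINT z|lborel. indicator ?B z *
          (\<psi> z * (\<Sum>b\<in>Basis. u2 b z) + (r - u z) * (\<Sum>b\<in>Basis. \<psi>2 b z)))"
      using integral_add_measure[OF s] M(4)[OF \<psi>[OF Bs(1)]] N(4)[OF \<psi>[OF Bs(2)]]
      by (simp add: distrib_left[symmetric])
  qed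
qed

section \<open>The maximum principle\<close>

text \<open>The first derivative vanishes at the maximum. A positive second derivative would make it
  positive just to the right, and the mean value theorem would lift \<open>f\<close> above its
  maximum.\<close>

lemma second_derivative_test:
  fixes f f1 :: "real \<Rightarrow> real"
  assumes "d > 0" and f: "\<And>t. \<bar>t\<bar> < d \<Longrightarrow> (f has_real_derivative f1 t) (at t)"
    and f1: "(f1 has_real_derivative l) (at 0)"
    and max: "\<And>t. \<bar>t\<bar> < d \<Longrightarrow> f t \<le> f 0"
  shows "l \<le> 0"
proof (rule ccontr)
  assume "\<not> l \<le> 0"
  have z: "f1 0 = 0"
    by (rule DERIV_local_max[OF f[of 0] \<open>d > 0\<close>]) (use max \<open>d > 0\<close> in auto)
  obtain e where e: "e > 0" "\<And>h. h > 0 \<Longrightarrow> h < e \<Longrightarrow> f1 0 < f1 h"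
    using DERIV_pos_inc_right[OF f1] \<open>\<not> l \<le> 0\<close> by auto
  define h where "h = min d e / 2"
  have h: "h > 0" "h < d" "h < e" using \<open>d > 0\<close> e(1) by (auto simp: h_def min_def)
  obtain x where "0 < x" "x < h" "f h - f 0 = (h - 0) * f1 x"
    using MVT2[of 0 h f f1] h f by auto
  moreover have "f h \<le> f 0" using max h by auto
  ultimately show False using e(2)[of x] z h by (simp add: zero_less_mult_iff) (smt (verit) mult_pos_pos)
qed

lemma D2_along_shift:
  assumes "D2_along b f f1 f2 S" "z + of_real t * b \<in> S"
  shows "((\<lambda>t. f (z + of_real t * b)) has_real_derivative f1 (z + of_real t * b)) (at t)"
    and "((\<lambda>t. f1 (z + of_real t * b)) has_real_derivative f2 (z + of_real t * b)) (at t)"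
proof -
  have "((\<lambda>h. f (z + of_real (h + t) * b)) has_real_derivative f1 (z + of_real t * b)) (at 0)"
       "((\<lambda>h. f1 (z + of_real (h + t) * b)) has_real_derivative f2 (z + of_real t * b)) (at 0)"
    using assms unfolding D2_along_def by (auto simp: algebra_simps)
  then show "((\<lambda>t. f (z + of_real t * b)) has_real_derivative f1 (z + of_real t * b)) (at t)"
    "((\<lambda>t. f1 (z + of_real t * b)) has_real_derivative f2 (z + of_real t * b)) (at t)"
    using DERIV_shift[of "\<lambda>t. f (z + of_real t * b)" _ 0 t] DERIV_shift[of "\<lambda>t. f1 (z + of_real t * b)" _ 0 t] by auto
qed

lemma norm_line:
  fixes z b :: complex
  assumes "b \<in> Basis"
  shows "norm (z + of_real t * b) ^ 2 = norm z ^ 2 + 2 * t * (z \<bullet> b) + t ^ 2"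
  using assms by (auto simp: Basis_complex_def cmod_power2 inner_complex_def)
    (auto simp: power2_eq_square algebra_simps)

lemma inner_line:
  fixes z b :: complex
  assumes "b \<in> Basis"
  shows "(z + of_real t * b) \<bullet> b = z \<bullet> b + t"
  using assms by (auto simp: Basis_complex_def inner_complex_def)

lemma D2_along_norm2:
  assumes "b \<in> Basis"
  shows "D2_along b (\<lambda>z. norm z ^ 2) (\<lambda>z. 2 * (z \<bullet> b)) (\<lambda>z. 2) S"
proof -
  have "((\<lambda>t. norm (z + of_real t * b) ^ 2) has_real_derivative 2 * (z \<bullet> b)) (at 0)"
    "((\<lambda>t. 2 * ((z + of_real t * b) \<bullet> b)) has_real_derivative 2) (at 0)" for z
    unfolding norm_line[OF assms] inner_line[OF assms]
    by (rule derivative_eq_intros refl | simp)+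
  moreover have "continuous_on S (\<lambda>z. norm z ^ 2)" "continuous_on S (\<lambda>z. 2 * (z \<bullet> b))"
    by (intro continuous_intros)+
  ultimately show ?thesis unfolding D2_along_def by simp
qed

lemma D2_along_cmult:
  assumes "D2_along b f f1 f2 S"
  shows "D2_along b (\<lambda>z. c * f z) (\<lambda>z. c * f1 z) (\<lambda>z. c * f2 z) S"
  unfolding D2_along_def
proof (intro conjI ballI)
  fix z assume "z \<in> S"
  then have d: "((\<lambda>t. f (z + of_real t * b)) has_real_derivative f1 z) (at 0)"
    "((\<lambda>t. f1 (z + of_real t * b)) has_real_derivative f2 z) (at 0)"
    using assms unfolding D2_along_def by blast+
  show "((\<lambda>t. c * f (z + of_real t * b)) has_real_derivative c * f1 z) (at 0)"
    by (rule DERIV_cmult[OF d(1)])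
  show "((\<lambda>t. c * f1 (z + of_real t * b)) has_real_derivative c * f2 z) (at 0)"
    by (rule DERIV_cmult[OF d(2)])
qed (intro continuous_intros D2_along_cont[OF assms])+

text \<open>Adding a small multiple of |z|^2 makes the Laplacian strictly positive, which is
  impossible at an interior maximum, where both pure second derivatives are at most 0.\<close>

lemma maximum_principle:
  fixes w :: "complex \<Rightarrow> real"
  assumes G: "open G" "bounded G" and wc: "continuous_on (closure G) w"
    and fr: "\<And>z. z \<in> frontier G \<Longrightarrow> w z \<le> 0"
    and D: "\<And>b. b \<in> Basis \<Longrightarrow> D2_along b w (w1 b) (w2 b) G"
    and L: "\<And>z. z \<in> G \<Longrightarrow> 0 \<le> (\<Sum>b\<in>Basis. w2 b z)"
    and z0: "z0 \<in> G"
  shows "w z0 \<le> 0"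
proof (rule ccontr)
  assume neg: "\<not> w z0 \<le> 0"
  have comp: "compact (closure G)" using G(2) by (simp add: compact_closure)
  obtain M where M: "M > 0" "\<And>z. z \<in> closure G \<Longrightarrow> norm z \<le> M"
    using bounded_closure[OF G(2)] unfolding bounded_pos by auto
  \<comment> \<open>Chosen so that \<open>\<eta> * M^2\<close> is half of \<open>w z0\<close>: on
    the frontier the perturbed function stays below \<open>w z0\<close>, so its maximum is attained
    inside \<open>G\<close>.\<close>
  define \<eta> where "\<eta> = w z0 / (2 * M^2)"
  have \<eta>: "\<eta> > 0" using neg M by (auto simp: \<eta>_def)
  define v where "v z = w z + \<eta> * norm z ^ 2" for z
  have vc: "continuous_on (closure G) v" unfolding v_def by (intro continuous_intros wc)
  have z0c: "z0 \<in> closure G" using z0 closure_subset by blast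
  obtain z1 where z1: "z1 \<in> closure G" "\<And>z. z \<in> closure G \<Longrightarrow> v z \<le> v z1"
  proof -
    have ne: "closure G \<noteq> {}" using z0 by auto
    show thesis using continuous_attains_sup[OF comp ne vc] that by (elim bexE) simp
  qed
  have "z1 \<notin> frontier G"
  proof
    assume f: "z1 \<in> frontier G"
    have "norm z1 ^ 2 \<le> M ^ 2" using M(2)[OF z1(1)] by (simp add: power_mono)
    then have "v z1 \<le> 0 + \<eta> * M ^ 2" unfolding v_def using fr[OF f] \<eta> by (intro add_mono mult_left_mono) auto
    also have "\<dots> = w z0 / 2" using M(1) by (simp add: \<eta>_def)
    also have "\<dots> < w z0" using neg by simp
    also have "\<dots> \<le> v z0" unfolding v_def using \<eta> by simp
    finally show False using z1(2)[OF z0c] by simp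
  qed
  then have z1G: "z1 \<in> G" using z1(1) G(1) by (simp add: frontier_def interior_open)
  obtain d where d: "d > 0" "ball z1 d \<subseteq> G" using G(1) z1G openE by blast
  have le: "w2 b z1 + \<eta> * 2 \<le> 0" if b: "b \<in> Basis" for b
  proof (rule second_derivative_test[OF d(1)])
    have vD: "D2_along b v (\<lambda>z. w1 b z + \<eta> * (2 * (z \<bullet> b))) (\<lambda>z. w2 b z + \<eta> * 2) G"
      unfolding v_def by (intro D2_along_add D2_along_cmult D2_along_norm2 D b)
    have inG: "z1 + of_real t * b \<in> G" if "\<bar>t\<bar> < d" for t
      using that d(2) b by (auto simp: subset_iff dist_norm norm_mult)
    show "((\<lambda>t. v (z1 + of_real t * b)) has_real_derivative (\<lambda>t. w1 b (z1 + of_real t * b) + \<eta> * (2 * ((z1 + of_real t * b) \<bullet> b))) t) (at t)"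
      if "\<bar>t\<bar> < d" for t using D2_along_shift(1)[OF vD inG[OF that]] .
    show "((\<lambda>t. w1 b (z1 + of_real t * b) + \<eta> * (2 * ((z1 + of_real t * b) \<bullet> b))) has_real_derivative w2 b z1 + \<eta> * 2) (at 0)"
      using D2_along_shift(2)[OF vD inG[of 0]] d(1) by simp
    show "v (z1 + of_real t * b) \<le> v (z1 + of_real 0 * b)" if "\<bar>t\<bar> < d" for t
      using z1(2)[of "z1 + of_real t * b"] inG[OF that] closure_subset by auto
  qed
  have "(\<Sum>b\<in>Basis. w2 b z1 + \<eta> * 2) \<le> (\<Sum>b\<in>(Basis::complex set). 0)"
    by (rule sum_mono) (use le in auto)
  then have "(\<Sum>b\<in>Basis. w2 b z1) + 4 * \<eta> \<le> 0"
    by (simp add: Basis_complex_def)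
  then show False using L[OF z1G] \<eta> by simp
qed

text \<open>Semicontinuity follows from continuity; domination by a harmonic \<open>h\<close> is the
  maximum principle for the difference, whose Laplacian on \<open>G\<close> is that of
  \<open>u\<close>.\<close>

lemma subharmonic_on_C2:
  fixes u :: "complex \<Rightarrow> real"
  assumes u: "\<And>b. b \<in> Basis \<Longrightarrow> D2_along b u (u1 b) (u2 b) unit_disc"
    and L: "\<And>z. z \<in> unit_disc \<Longrightarrow> 0 \<le> (\<Sum>b\<in>Basis. u2 b z)"
  shows "subharmonic_on (\<lambda>z. ereal (u z)) unit_disc"
proof -
  have uc: "continuous_on unit_disc u" using D2_along_cont(1)[OF u[of 1]] by (simp add: Basis_complex_def)
  have "openin (top_of_set unit_disc) {z \<in> unit_disc. ereal (u z) < c}" for c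
  proof (cases c)
    case (real r)
    then show ?thesis using open_sublevel[OF uc, of r] by (auto intro: open_subset)
  next
    case PInf
    then have "{z \<in> unit_disc. ereal (u z) < c} = unit_disc" by (auto simp del: mem_ball_0)
    then show ?thesis by (simp only:) (rule open_subset[OF subset_refl open_ball])
  qed simp
  moreover have "u z \<le> h z"
    if G: "open G" "compact (closure G)" "closure G \<subseteq> unit_disc" and hc: "continuous_on (closure G) h"
      and h: "harmonic_on h G" and fr: "\<forall>z\<in>frontier G. ereal (u z) \<le> ereal (h z)" and z: "z \<in> G"
    for G h z
  proof -
    have Gs: "G \<subseteq> unit_disc" using G(3) closure_subset by blast
    have hD: "D2_along b h (dir_deriv b h) (dir_deriv b (dir_deriv b h)) G" for b
      using h G(1) unfolding harmonic_on_def by (intro Ck_on_2D) auto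
    have "u z - h z \<le> 0"
    proof (rule maximum_principle[OF G(1)])
      show "bounded G" using Gs bounded_ball bounded_subset by blast
      show "continuous_on (closure G) (\<lambda>z. u z - h z)"
        by (intro continuous_intros hc continuous_on_subset[OF uc G(3)])
      show "D2_along b (\<lambda>z. u z - h z) (\<lambda>z. u1 b z - dir_deriv b h z) (\<lambda>z. u2 b z - dir_deriv b (dir_deriv b h) z) G"
        if "b \<in> Basis" for b
        by (intro D2_along_diff hD D2_along_subset[OF u[OF that] Gs])
      fix z assume "z \<in> G"
      then have "(\<Sum>b\<in>Basis. dir_deriv b (dir_deriv b h) z) = 0"
        using h unfolding harmonic_on_def laplacian_def by auto
      then show "0 \<le> (\<Sum>b\<in>Basis. u2 b z - dir_deriv b (dir_deriv b h) z)"
        using L[of z] \<open>z \<in> G\<close> Gs by (simp add: sum_subtractf subset_iff)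
    qed (use fr z in auto)
    then show ?thesis by simp
  qed
  moreover have "\<exists>z\<in>unit_disc. ereal (u z) \<noteq> - \<infinity>" by (rule bexI[of _ 0]) auto
  ultimately show ?thesis unfolding subharmonic_on_def by (auto simp del: mem_ball_0)
qed

section \<open>Uniqueness of the Riesz measure\<close>

text \<open>The derivatives of exp (-1/t) are combinations of exp (-1/t) / t^m. Taking all powers
  \<open>m\<close> into one family makes it closed under differentiation, so smoothness, including
  smoothness at 0, becomes an induction.\<close>

definition bump :: "nat \<Rightarrow> real \<Rightarrow> real"
  where "bump m t = (if t > 0 then exp (- inverse t) * inverse t ^ m else 0)"

lemma bump_over_id_tendsto_0: "((\<lambda>h. bump m h / h) \<longlongrightarrow> 0) (at 0)"
proof -
  have "((\<lambda>x. x ^ Suc m / exp x) \<longlongrightarrow> (0::real)) at_top" by (rule tendsto_power_div_exp_0)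
  then have "((\<lambda>h. inverse h ^ Suc m / exp (inverse h)) \<longlongrightarrow> (0::real)) (at_right 0)"
    by (rule filterlim_compose[OF _ filterlim_inverse_at_top_right])
  moreover have "\<forall>\<^sub>F h in at_right 0. inverse h ^ Suc m / exp (inverse h) = bump m h / h"
    unfolding eventually_at_right_field
    by (auto simp: bump_def exp_minus field_simps intro!: exI[of _ 1])
  ultimately have r: "((\<lambda>h. bump m h / h) \<longlongrightarrow> 0) (at_right 0)"
    by (rule Lim_transform_eventually)
  have "\<forall>\<^sub>F h in at_left 0. 0 = bump m h / h"
    unfolding eventually_at_left_field by (auto simp: bump_def intro!: exI[of _ "-1"])
  then have "((\<lambda>h. bump m h / h) \<longlongrightarrow> 0) (at_left 0)"
    by (rule Lim_transform_eventually[OF tendsto_const])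
  then show ?thesis using r by (simp add: filterlim_split_at)
qed

lemma DERIV_bump: "(bump m has_real_derivative (bump (m + 2) t - real m * bump (m + 1) t)) (at t)"
proof (cases t "0::real" rule: linorder_cases)
  case less
  have "((\<lambda>t. 0) has_real_derivative 0) (at t)" by simp
  then have "(bump m has_real_derivative 0) (at t)"
    by (rule has_field_derivative_transform_within_open[of _ _ _ "{..<0}"])
       (use less in \<open>auto simp: bump_def\<close>)
  then show ?thesis using less by (simp add: bump_def)
next
  case equal
  have "((\<lambda>h. (bump m h - bump m 0) / (h - 0)) \<longlongrightarrow> 0) (at 0)"
    using bump_over_id_tendsto_0[of m] by (simp add: bump_def)
  then show ?thesis using equal by (simp add: has_field_derivative_iff bump_def)
next
  case greater
  have "((\<lambda>t. exp (- inverse t) * inverse t ^ m) has_real_derivative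
      exp (- inverse t) * (inverse t ^ 2) * inverse t ^ m - exp (- inverse t) * (real m * inverse t ^ (m + 1))) (at t)"
  proof -
    have i: "(inverse has_real_derivative - (inverse t ^ 2)) (at t)"
      using DERIV_inverse[of t] greater by (simp add: numeral_2_eq_2)
    have e: "((\<lambda>t. exp (- inverse t)) has_real_derivative exp (- inverse t) * (inverse t ^ 2)) (at t)"
      using greater by (auto intro!: derivative_eq_intros simp: power2_eq_square)
    have eq: "real m * (- (inverse t ^ 2) * inverse t ^ (m - Suc 0)) = - (real m * inverse t ^ (m + 1))"
      by (cases m) (auto simp: power2_eq_square)
    show ?thesis
      by (rule DERIV_cong[OF DERIV_mult[OF e DERIV_power[OF i, of m]]])
        (subst eq, simp add: algebra_simps)
  qed
  then have "(bump m has_real_derivative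
      exp (- inverse t) * (inverse t ^ 2) * inverse t ^ m - exp (- inverse t) * (real m * inverse t ^ (m + 1))) (at t)"
    by (rule has_field_derivative_transform_within_open[of _ _ _ "{0<..}"])
       (use greater in \<open>auto simp: bump_def\<close>)
  then show ?thesis using greater by (simp add: bump_def power2_eq_square mult.left_commute mult.commute)
qed

lemma Ck_on_UNIV_Suc: "Ck_on (Suc k) f UNIV \<longleftrightarrow> (\<forall>z. f differentiable (at z)) \<and> (\<forall>b. Ck_on k (dir_deriv b f) UNIV)"
  by (simp add: differentiable_on_def)

lemma Ck_on_SucD: "Ck_on (Suc k) f UNIV \<Longrightarrow> Ck_on k f UNIV"
proof (induction k arbitrary: f)
  case 0 then show ?case by (auto intro: differentiable_imp_continuous_on)
qed auto

lemma Ck_on_add: "Ck_on k f UNIV \<Longrightarrow> Ck_on k g UNIV \<Longrightarrow> Ck_on k (\<lambda>z. f z + g z) UNIV"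
proof (induction k arbitrary: f g)
  case 0 then show ?case by (auto intro!: continuous_intros)
next
  case (Suc k)
  then have d: "f differentiable (at z)" "g differentiable (at z)" for z by (auto simp: differentiable_on_def)
  have "dir_deriv b (\<lambda>z. f z + g z) = (\<lambda>z. dir_deriv b f z + dir_deriv b g z)" for b
  proof
    fix z
    have "((\<lambda>z. f z + g z) has_derivative
        (\<lambda>h. frechet_derivative f (at z) h + frechet_derivative g (at z) h)) (at z)"
      using d[of z] by (intro has_derivative_add) (simp_all add: frechet_derivative_works)
    then show "dir_deriv b (\<lambda>z. f z + g z) z = dir_deriv b f z + dir_deriv b g z"
      by (simp add: dir_deriv_eqI) (simp add: dir_deriv_def)
  qed
  then show ?case using Suc d by (auto simp: Ck_on_UNIV_Suc simp del: Ck_on.simps(2) intro!: derivative_intros)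
qed

lemma Ck_on_const: "Ck_on k (\<lambda>z. c) UNIV"
proof (induction k arbitrary: c)
  case (Suc k)
  have "dir_deriv b (\<lambda>z. c) = (\<lambda>z. 0)" for b
    by (auto simp: fun_eq_iff dir_deriv_def frechet_derivative_const)
  then show ?case using Suc by (auto simp: Ck_on_UNIV_Suc simp del: Ck_on.simps(2))
qed auto

lemma Ck_on_mult: "Ck_on k f UNIV \<Longrightarrow> Ck_on k g UNIV \<Longrightarrow> Ck_on k (\<lambda>z. f z * g z) UNIV"
proof (induction k arbitrary: f g)
  case 0 then show ?case by (auto intro!: continuous_intros)
next
  case (Suc k)
  then have d: "f differentiable (at z)" "g differentiable (at z)" for z by (auto simp: differentiable_on_def)
  have "dir_deriv b (\<lambda>z. f z * g z) = (\<lambda>z. f z * dir_deriv b g z + dir_deriv b f z * g z)" for b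
  proof
    fix z
    have "((\<lambda>z. f z * g z) has_derivative
        (\<lambda>h. f z * frechet_derivative g (at z) h + frechet_derivative f (at z) h * g z)) (at z)"
      using d[of z] by (intro has_derivative_mult) (simp_all add: frechet_derivative_works)
    then show "dir_deriv b (\<lambda>z. f z * g z) z = f z * dir_deriv b g z + dir_deriv b f z * g z"
      by (simp add: dir_deriv_eqI) (simp add: dir_deriv_def)
  qed
  moreover have "Ck_on k (\<lambda>z. f z * dir_deriv b g z + dir_deriv b f z * g z) UNIV" for b
    using Suc.prems by (intro Ck_on_add Suc.IH) (auto intro: Ck_on_SucD simp: Ck_on_UNIV_Suc simp del: Ck_on.simps(2))
  ultimately show ?case using d by (auto simp: Ck_on_UNIV_Suc simp del: Ck_on.simps(2) intro!: derivative_intros)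
qed

text \<open>A directional derivative is a linear combination of the members \<open>m + 1\<close> and
  \<open>m + 2\<close> at the same affine argument, so the induction keeps \<open>m\<close>
  arbitrary.\<close>

lemma Ck_on_bump: "Ck_on k (\<lambda>z. bump m (c * (e \<bullet> z) + d)) UNIV"
proof (induction k arbitrary: m)
  case 0
  have "continuous_on UNIV (bump m)"
    using DERIV_bump DERIV_isCont continuous_at_imp_continuous_on by blast
  then show ?case by (auto intro!: continuous_on_compose2[of UNIV "bump m"] continuous_intros)
next
  case (Suc k)
  let ?l = "\<lambda>z. c * (e \<bullet> z) + d"
  have d: "((\<lambda>z. bump m (?l z)) has_derivative
       (\<lambda>h. (bump (m + 2) (?l z) - real m * bump (m + 1) (?l z)) * (c * (e \<bullet> h)))) (at z)" for z
  proof -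
    have "(bump m has_derivative (*) (bump (m + 2) (?l z) - real m * bump (m + 1) (?l z))) (at (?l z))"
      using DERIV_bump[of m "?l z"] by (simp add: has_field_derivative_def)
    moreover have "(?l has_derivative (\<lambda>h. c * (e \<bullet> h))) (at z)"
      by (auto intro!: derivative_eq_intros)
    ultimately show ?thesis using has_derivative_compose[of ?l _ z UNIV "bump m"] by blast
  qed
  have "dir_deriv b (\<lambda>z. bump m (?l z)) =
      (\<lambda>z. (c * (e \<bullet> b)) * bump (m + 2) (?l z) + (- real m * (c * (e \<bullet> b))) * bump (m + 1) (?l z))" for b
    by (rule ext, subst dir_deriv_eqI[OF d]) (simp add: algebra_simps)
  moreover have "Ck_on k (\<lambda>z. (c * (e \<bullet> b)) * bump (m + 2) (?l z) + (- real m * (c * (e \<bullet> b))) * bump (m + 1) (?l z)) UNIV" for b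
    by (intro Ck_on_add Ck_on_mult Ck_on_const Suc)
  moreover have "(\<lambda>z. bump m (?l z)) differentiable (at z)" for z using d differentiable_def by blast
  ultimately show ?case by (auto simp: Ck_on_UNIV_Suc simp del: Ck_on.simps(2))
qed

section \<open>Test functions increasing to the indicator of a box\<close>

lemma bump_0_props:
  shows bump_0_nonneg: "0 \<le> bump 0 t" and bump_0_le_1: "bump 0 t \<le> 1"
    and bump_0_mono: "s \<le> t \<Longrightarrow> bump 0 s \<le> bump 0 t"
  by (auto simp: bump_def le_imp_inverse_le)

text \<open>A product of four one-sided cut-offs, spelled with affine functions of inner products so
  as to match \<open>Ck_on_bump\<close>; \<open>box_fun_eq\<close> is the readable form.\<close>

definition box_fun :: "complex \<Rightarrow> complex \<Rightarrow> nat \<Rightarrow> complex \<Rightarrow> real"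
  where "box_fun a b n z = bump 0 (real n * (1 \<bullet> z) + (- real n * Re a - 1)) * bump 0 (- real n * (1 \<bullet> z) + (real n * Re b - 1))
    * (bump 0 (real n * (\<i> \<bullet> z) + (- real n * Im a - 1)) * bump 0 (- real n * (\<i> \<bullet> z) + (real n * Im b - 1)))"

lemma box_fun_eq: "box_fun a b n z = bump 0 (real n * (Re z - Re a) - 1) * bump 0 (real n * (Re b - Re z) - 1)
    * (bump 0 (real n * (Im z - Im a) - 1) * bump 0 (real n * (Im b - Im z) - 1))"
  by (simp add: box_fun_def inner_complex_def algebra_simps)

text \<open>
  The shift by one keeps the support of the approximations of the indicator of \<open>x > 0\<close> away
  from zero.
\<close>

lemma bump_scaled_mono:
  assumes "n \<le> m" shows "bump 0 (real n * x - 1) \<le> bump 0 (real m * x - 1)"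
proof (cases "x \<ge> 0")
  case True
  then show ?thesis using assms by (intro bump_0_mono) (simp add: mult_right_mono)
next
  case False
  then have "real n * x - 1 \<le> 0" using mult_nonneg_nonpos[of "real n" x] by simp
  then show ?thesis using bump_0_nonneg[of "real m * x - 1"] by (simp add: bump_def)
qed

lemma bump_scaled_tendsto:
  "(\<lambda>n. bump 0 (real n * x - 1)) \<longlonglongrightarrow> (if x > 0 then 1 else 0)"
proof (cases "x > 0")
  case True
  have "filterlim (\<lambda>n. real n * x - 1) at_top sequentially" using True by real_asymp
  then have l: "(\<lambda>n. exp (- inverse (real n * x - 1))) \<longlonglongrightarrow> exp (- 0)"
    by (intro tendsto_intros tendsto_inverse_0_at_top)
  moreover have "\<forall>\<^sub>F n in sequentially. real n * x - 1 > 0"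
    using True by real_asymp
  then have "\<forall>\<^sub>F n in sequentially. exp (- inverse (real n * x - 1)) = bump 0 (real n * x - 1)"
    by eventually_elim (simp add: bump_def)
  ultimately show ?thesis using True by (simp add: Lim_transform_eventually)
next
  case False
  then have "real n * x - 1 \<le> 0" for n using mult_nonneg_nonpos[of "real n" x] by simp
  then show ?thesis using False by (simp add: bump_def not_less[symmetric])
qed

lemma box_fun_props:
  shows box_fun_nonneg: "0 \<le> box_fun a b n z" and box_fun_le_1: "box_fun a b n z \<le> 1"
    and box_fun_mono: "n \<le> m \<Longrightarrow> box_fun a b n z \<le> box_fun a b m z"
    and box_fun_tendsto: "(\<lambda>n. box_fun a b n z) \<longlonglongrightarrow> indicator (box a b) z"
proof -
  show "0 \<le> box_fun a b n z" unfolding box_fun_eq by (intro mult_nonneg_nonneg bump_0_nonneg)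
  show "box_fun a b n z \<le> 1" unfolding box_fun_eq
    by (intro mult_le_one mult_nonneg_nonneg bump_0_nonneg bump_0_le_1)
  show "box_fun a b n z \<le> box_fun a b m z" if "n \<le> m"
    unfolding box_fun_eq using that
    by (intro mult_mono bump_scaled_mono mult_nonneg_nonneg bump_0_nonneg)
  have "(\<lambda>n. box_fun a b n z) \<longlonglongrightarrow> (if Re z - Re a > 0 then 1 else 0) * (if Re b - Re z > 0 then 1 else 0)
    * ((if Im z - Im a > 0 then 1 else 0) * (if Im b - Im z > 0 then 1 else 0))"
    unfolding box_fun_eq by (intro tendsto_mult bump_scaled_tendsto)
  then show "(\<lambda>n. box_fun a b n z) \<longlonglongrightarrow> indicator (box a b) z"
    by (auto simp: indicator_def box_def Basis_complex_def split: if_splits)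
qed

lemma test_fun_box_fun:
  assumes "box a b \<subseteq> S"
  shows "test_fun S (box_fun a b n)"
proof -
  let ?K = "cbox (a + Complex (1 / real n) (1 / real n)) (b - Complex (1 / real n) (1 / real n))"
  have "Ck_on k (box_fun a b n) UNIV" for k
    unfolding box_fun_def by (intro Ck_on_mult Ck_on_bump)
  moreover have "\<exists>K. compact K \<and> K \<subseteq> S \<and> (\<forall>z. z \<notin> K \<longrightarrow> box_fun a b n z = 0)"
  \<comment> \<open>As \<open>1 / real 0\<close> is 0, the box \<open>?K\<close> need not lie in
    \<open>S\<close> for \<open>n = 0\<close>; but then every argument of \<open>bump\<close> is -1
    and the function is identically zero.\<close>
  proof (cases "n = 0")
    case True
    then show ?thesis by (intro exI[of _ "{}"]) (auto simp: box_fun_eq bump_def)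
  next
    case False
    then have i: "1 / real n > 0" by simp
    have "cbox (a + Complex e e) (b - Complex e e) \<subseteq> box a b" if "e > 0" for e
      using that by (auto simp: box_def cbox_def Basis_complex_def)
    from this[OF i] have "?K \<subseteq> box a b" .
    moreover have "box_fun a b n z = 0" if "z \<notin> ?K" for z
    proof -
      have "real n * (Re z - Re a) - 1 \<le> 0 \<or> real n * (Re b - Re z) - 1 \<le> 0 \<or>
         real n * (Im z - Im a) - 1 \<le> 0 \<or> real n * (Im b - Im z) - 1 \<le> 0"
        using that False by (auto simp: cbox_def Basis_complex_def field_simps)
      then show ?thesis by (auto simp: box_fun_eq bump_def)
    qed
    ultimately show ?thesis using assms by (intro exI[of _ ?K]) auto
  qed
  ultimately show ?thesis by (auto simp: test_fun_def)
qed

text \<open>The sequence involves only \<open>v\<close>. Testing against functions that increase to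
  the indicator of a box therefore recovers the mass of the box from \<open>v\<close> alone, which
  is the core of uniqueness.\<close>

lemma is_ddc_box_LIMSEQ:
  assumes M: "is_ddc v M" and box: "box a b \<subseteq> unit_disc"
  shows "(\<lambda>n. ennreal ((LINT z:unit_disc|lborel. real_of_ereal (v z) * laplacian (box_fun a b n) z) / (2 * pi)))
    \<longlonglongrightarrow> emeasure M (box a b)"
proof -
  have sM: "sets M = sets borel_disc" using M by (simp add: is_ddc_def)
  have mem: "A \<in> sets M" if "A \<subseteq> unit_disc" "A \<in> sets borel" for A
    using that sM by (auto simp: sets_restrict_space)
  have eq: "ennreal ((LINT z:unit_disc|lborel. real_of_ereal (v z) * laplacian (box_fun a b n) z) / (2 * pi))
     = (\<integral>\<^sup>+z. ennreal (box_fun a b n z) \<partial>M)" for n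
  proof -
    note t = test_fun_box_fun[OF box, of n]
    obtain K where K: "compact K" "K \<subseteq> unit_disc" "\<And>z. z \<notin> K \<Longrightarrow> box_fun a b n z = 0"
      using t unfolding test_fun_def by blast
    have c: "continuous_on unit_disc (box_fun a b n)"
      using t unfolding test_fun_def by (metis Ck_on.simps(1) continuous_on_subset subset_UNIV)
    have KM: "K \<in> sets M" "emeasure M K < \<infinity>"
      using K M by (auto simp: is_ddc_def intro!: mem compact_imp_closed borel_closed)
    have "integrable M (box_fun a b n)"
    proof (rule Bochner_Integration.integrable_bound[of M "indicator K :: _ \<Rightarrow> real"])
      show "integrable M (indicator K :: _ \<Rightarrow> real)" using KM by simp
      show "box_fun a b n \<in> borel_measurable M" by (rule borel_measurable_disc[OF c sM])
      show "AE z in M. norm (box_fun a b n z) \<le> norm (indicator K z :: real)"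
        using K(3) box_fun_nonneg[of a b n] box_fun_le_1[of a b n] by (auto simp: indicator_def)
    qed
    then have "(\<integral>\<^sup>+z. ennreal (box_fun a b n z) \<partial>M) = ennreal (LINT z|M. box_fun a b n z)"
      by (intro nn_integral_eq_integral) (auto simp: box_fun_nonneg)
    then show ?thesis using M t by (simp add: is_ddc_def)
  qed
  have "(\<lambda>n. \<integral>\<^sup>+z. ennreal (box_fun a b n z) \<partial>M) \<longlonglongrightarrow> (\<integral>\<^sup>+z. indicator (box a b) z \<partial>M)"
  proof (rule nn_integral_LIMSEQ)
    show "incseq (\<lambda>n z. ennreal (box_fun a b n z))"
      by (auto simp: incseq_def le_fun_def intro!: ennreal_leI box_fun_mono)
    have c: "continuous_on unit_disc (box_fun a b n)" for n
      using test_fun_box_fun[OF box, of n] unfolding test_fun_def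
      by (metis Ck_on.simps(1) continuous_on_subset subset_UNIV)
    show "(\<lambda>z. ennreal (box_fun a b n z)) \<in> borel_measurable M" for n
      using borel_measurable_disc[OF c sM, of n] by measurable
    show "(\<lambda>n. ennreal (box_fun a b n z)) \<longlonglongrightarrow> indicator (box a b) z" for z
      using tendsto_ennrealI[OF box_fun_tendsto[of a b z]] by (cases "z \<in> box a b") simp_all
  qed
  also have "(\<integral>\<^sup>+z. indicator (box a b) z \<partial>M) = emeasure M (box a b)"
    using mem[OF box] by (intro nn_integral_indicator) auto
  finally show ?thesis unfolding eq .
qed

lemma ex_countable_boxes:
  fixes S :: "complex set"
  assumes "open S"
  shows "\<exists>D. countable D \<and> D \<subseteq> Pow S \<and> (\<forall>Y\<in>D. \<exists>a b. Y = box a b) \<and> \<Union>D = S"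
proof -
  obtain D where D: "countable D" "D \<subseteq> Pow S" "\<And>X. X \<in> D \<Longrightarrow> \<exists>a b. X = box a b" "\<Union>D = S"
    by (rule open_countable_Union_open_box[OF assms]) (rule that; assumption)
  show ?thesis by (intro exI[of _ D] conjI ballI D)
qed

text \<open>Boxes inside the disc form an intersection-stable generator on which both measures agree
  by \<open>is_ddc_box_LIMSEQ\<close>.\<close>

lemma is_ddc_unique:
  assumes M: "is_ddc v M" and N: "is_ddc v N"
  shows "M = N"
proof -
  define E where "E = {X. X \<subseteq> unit_disc \<and> (\<exists>a b. X = box a (b::complex))}"
  have sM: "sets M = sets borel_disc" "sets N = sets borel_disc" using M N by (simp_all add: is_ddc_def)
  have gen: "sets borel_disc = sigma_sets unit_disc E"
  proof
    have "X \<in> sets borel_disc" if "X \<in> E" for X using that by (auto simp: E_def sets_restrict_space)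
    then show "sigma_sets unit_disc E \<subseteq> sets borel_disc"
      using sets.sigma_sets_subset[of E borel_disc] by auto
    have "borel_disc = restrict_space (sigma UNIV {S. open S}) unit_disc" by (simp add: borel_def)
    have op: "unit_disc \<inter> X \<in> sigma_sets unit_disc E" if X: "open X" for X
    proof -
      have o: "open (unit_disc \<inter> X)" using X by (rule open_Int[OF open_ball])
      obtain \<D> where D: "countable \<D>" "\<D> \<subseteq> Pow (unit_disc \<inter> X)" "\<forall>Y\<in>\<D>. \<exists>a b. Y = box a b" "\<Union>\<D> = unit_disc \<inter> X"
        using ex_countable_boxes[OF o] by (elim exE conjE)
      have "\<Union>\<D> \<in> sigma_sets unit_disc E"
        using D(1-3) by (intro sigma_sets_UNION) (auto simp: E_def intro!: sigma_sets.Basic)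
      then show ?thesis using D(4) by simp
    qed
    have "sets borel_disc = sigma_sets unit_disc ((\<inter>) unit_disc ` {S. open S})"
    proof -
      have "sets borel_disc = (\<inter>) unit_disc ` sigma_sets UNIV {S. open S}"
        by (simp add: sets_restrict_space sets_borel)
      also have "\<dots> = sigma_sets unit_disc ((\<inter>) unit_disc ` {S. open S})"
        using sigma_sets_Int[of unit_disc "UNIV" "{S. open S}"] by (simp add: sets_borel[symmetric])
      finally show ?thesis .
    qed
    also have "\<dots> \<subseteq> sigma_sets unit_disc E"
      by (rule sigma_sets_mono) (use op in auto)
    finally show "sets borel_disc \<subseteq> sigma_sets unit_disc E" .
  qed
  \<comment> \<open>A box inside the disc may have corners on the unit circle and infinite mass. The
    countable cover is therefore taken from boxes in smaller discs, whose closures have finite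
    mass.\<close>
  have "\<exists>D. \<forall>n::nat. countable (D n) \<and> D n \<subseteq> Pow (ball 0 (1 - 1 / real (Suc n))) \<and>
        (\<forall>Y\<in>D n. \<exists>a b. Y = box a (b::complex)) \<and> \<Union>(D n) = ball 0 (1 - 1 / real (Suc n))"
    by (intro choice allI ex_countable_boxes open_ball)
  then obtain \<D> where DD: "\<forall>n::nat. countable (\<D> n) \<and> \<D> n \<subseteq> Pow (ball 0 (1 - 1 / real (Suc n))) \<and>
        (\<forall>Y\<in>\<D> n. \<exists>a b. Y = box a (b::complex)) \<and> \<Union>(\<D> n) = ball 0 (1 - 1 / real (Suc n))"
    by (elim exE)
  have D: "countable (\<D> n)" "\<D> n \<subseteq> Pow (ball 0 (1 - 1 / real (Suc n)))"
    "\<forall>Y\<in>\<D> n. \<exists>a b. Y = box a (b::complex)" "\<Union>(\<D> n) = ball 0 (1 - 1 / real (Suc n))" for n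
    by (rule spec[OF DD, of n, THEN conjunct1] spec[OF DD, of n, THEN conjunct2, THEN conjunct1]
      spec[OF DD, of n, THEN conjunct2, THEN conjunct2, THEN conjunct1]
      spec[OF DD, of n, THEN conjunct2, THEN conjunct2, THEN conjunct2])+
  have bs: "ball 0 (1 - 1 / real (Suc n)) \<subseteq> (unit_disc::complex set)" for n
    by (rule subset_ball) simp
  show ?thesis
  proof (rule measure_eqI_generator_eq_countable[of E unit_disc M N "\<Union>n. \<D> n"])
    show "Int_stable E"
    proof (rule Int_stableI)
      fix X Y assume "X \<in> E" "Y \<in> E"
      then obtain a b c d where "X = box a b" "Y = box c d" "X \<subseteq> unit_disc" unfolding E_def by blast
      then show "X \<inter> Y \<in> E" unfolding E_def using box_Int_box[of a b c d] by blast
    qed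
    show "E \<subseteq> Pow unit_disc" by (auto simp: E_def)
    show "emeasure M X = emeasure N X" if "X \<in> E" for X
    proof -
      obtain a b where "X = box a b" "box a b \<subseteq> unit_disc" using \<open>X \<in> E\<close> unfolding E_def by blast
      then show ?thesis using LIMSEQ_unique[OF is_ddc_box_LIMSEQ[OF M] is_ddc_box_LIMSEQ[OF N]] by simp
    qed
    show "sets M = sigma_sets unit_disc E" "sets N = sigma_sets unit_disc E" using gen sM by simp_all
    show "(\<Union>n. \<D> n) \<subseteq> E"
    proof
      fix X assume "X \<in> (\<Union>n. \<D> n)"
      then obtain n where "X \<in> \<D> n" by blast
      then have "X \<subseteq> ball 0 (1 - 1 / real (Suc n))" "\<exists>a b. X = box a b" using D(2,3)[of n] by auto
      then show "X \<in> E" using bs[of n] unfolding E_def by blast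
    qed
    show "\<Union>(\<Union>n. \<D> n) = unit_disc"
    proof
      have "\<Union>(\<D> n) \<subseteq> unit_disc" for n using D(4)[of n] bs[of n] by simp
      then show "\<Union>(\<Union>n. \<D> n) \<subseteq> unit_disc" by blast
      show "unit_disc \<subseteq> \<Union>(\<Union>n. \<D> n)"
      proof
        fix z :: complex assume "z \<in> unit_disc"
        then have "1 - norm z > 0" by simp
        then obtain n where "inverse (real (Suc n)) < 1 - norm z" using reals_Archimedean by blast
        then have "z \<in> ball 0 (1 - 1 / real (Suc n))" by (simp add: inverse_eq_divide)
        then show "z \<in> \<Union>(\<Union>n. \<D> n)" using D(4)[of n] by blast
      qed
    qed
    show "countable (\<Union>n. \<D> n)" using D(1) by auto
    fix X assume "X \<in> (\<Union>n. \<D> n)"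
    then obtain n where n: "X \<in> \<D> n" by blast
    let ?\<rho> = "1 - 1 / real (Suc n)"
    have X: "X \<subseteq> cball 0 ?\<rho>" using D(2)[of n] n ball_subset_cball[of 0 ?\<rho>] by (meson PowD order_trans subsetD)
    have "?\<rho> < 1" by simp
    then have c: "cball 0 ?\<rho> \<subseteq> (unit_disc::complex set)" by (simp add: cball_subset_ball_iff)
    have "unit_disc \<inter> cball 0 ?\<rho> \<in> sets borel_disc" unfolding sets_restrict_space by (rule imageI) simp
    then have "cball 0 ?\<rho> \<in> sets M" using sM(1) c by (simp add: Int_absorb1)
    then have "emeasure M X \<le> emeasure M (cball 0 (1 - 1 / real (Suc n)))" by (rule emeasure_mono[OF X])
    also have "\<dots> < \<infinity>" using M c by (simp add: is_ddc_def)
    finally show "emeasure M X \<noteq> \<infinity>" by simp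
  qed
qed

lemma ddc_eqI: "is_ddc v M \<Longrightarrow> ddc v = M"
  unfolding ddc_def using is_ddc_unique by blast

section \<open>Riesz and level measures of a smooth subharmonic function\<close>

lemma dir_deriv_zero:
  assumes "closed K" "\<And>z. z \<notin> K \<Longrightarrow> f z = 0" "z \<notin> K"
  shows "dir_deriv b f z = 0"
proof -
  have "((\<lambda>z. 0::real) has_derivative (\<lambda>h. 0)) (at z)" by simp
  then have "(f has_derivative (\<lambda>h. 0)) (at z)"
    by (rule has_derivative_transform_within_open[of _ _ _ _ "- K"]) (use assms in auto)
  then show ?thesis by (simp add: dir_deriv_eqI)
qed

lemma compact_in_disc_radius:
  assumes "compact K" "K \<subseteq> unit_disc"
  obtains \<rho> where "0 < \<rho>" "\<rho> < 1" "\<And>z. z \<in> K \<Longrightarrow> norm z < \<rho>"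
proof (cases "K = {}")
  case True
  then show ?thesis using that[of "1/2"] by simp
next
  case False
  obtain x where x: "x \<in> K" "\<forall>y\<in>K. norm y \<le> norm x"
    using continuous_attains_sup[OF assms(1) False continuous_on_norm_id] by (elim bexE)
  have "norm x < 1" using x(1) assms(2) by auto
  then have "0 < (1 + norm x) / 2" "(1 + norm x) / 2 < 1" "norm x < (1 + norm x) / 2"
    using norm_ge_zero[of x] by (auto simp: field_simps intro: add_pos_nonneg)
  moreover have "norm z < (1 + norm x) / 2" if "z \<in> K" for z
    using x(2) that \<open>norm x < (1 + norm x) / 2\<close> by force
  ultimately show ?thesis using that by blast
qed

lemma integrable_compact_support:
  fixes f :: "complex \<Rightarrow> real"
  assumes K: "compact K" "K \<subseteq> unit_disc" "\<And>z. z \<notin> K \<Longrightarrow> f z = 0" and f: "continuous_on unit_disc f"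
  shows "integrable lborel (\<lambda>z. indicator unit_disc z * f z)"
proof -
  have "integrable lborel (\<lambda>z. indicator K z *\<^sub>R f z)"
    by (rule borel_integrable_compact[OF K(1) continuous_on_subset[OF f K(2)]])
  moreover have "(\<lambda>z. indicator K z *\<^sub>R f z) = (\<lambda>z. indicator unit_disc z * f z)"
  proof
    fix z show "indicator K z *\<^sub>R f z = indicator unit_disc z * f z"
    proof (cases "z \<in> K")
      case True
      then have "z \<in> unit_disc" using K(2) by (rule subsetD[rotated])
      then show ?thesis using True by (simp del: mem_ball_0)
    qed (simp add: K(3))
  qed
  ultimately show ?thesis by (simp only:)
qed

lemma test_funE:
  assumes "test_fun unit_disc \<phi>"
  obtains K where "compact K" "K \<subseteq> unit_disc" "\<And>z. z \<notin> K \<Longrightarrow> \<phi> z = 0"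
    "\<And>z b. z \<notin> K \<Longrightarrow> dir_deriv b \<phi> z = 0" "\<And>z. z \<notin> K \<Longrightarrow> laplacian \<phi> z = 0"
    "\<And>z b. z \<notin> K \<Longrightarrow> dir_deriv b (dir_deriv b \<phi>) z = 0"
    "\<And>b. D2_along b \<phi> (dir_deriv b \<phi>) (dir_deriv b (dir_deriv b \<phi>)) UNIV"
    "continuous_on unit_disc \<phi>" "continuous_on unit_disc (laplacian \<phi>)"
    "\<And>b. continuous_on unit_disc (dir_deriv b (dir_deriv b \<phi>))"
proof -
  obtain K where K: "compact K" "K \<subseteq> unit_disc" "\<And>z. z \<notin> K \<Longrightarrow> \<phi> z = 0"
    using assms unfolding test_fun_def by blast
  have cl: "closed K" using K(1) by (rule compact_imp_closed)
  have d1: "dir_deriv b \<phi> z = 0" if "z \<notin> K" for z b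
    using dir_deriv_zero[OF cl K(3) that] .
  have d2: "dir_deriv b (dir_deriv b \<phi>) z = 0" if "z \<notin> K" for z b
    using dir_deriv_zero[OF cl d1 that] .
  have D: "D2_along b \<phi> (dir_deriv b \<phi>) (dir_deriv b (dir_deriv b \<phi>)) UNIV" for b
    using assms unfolding test_fun_def by (intro Ck_on_2D) auto
  have c: "continuous_on unit_disc (dir_deriv b (dir_deriv b \<phi>))" for b
    using D2_along_cont(3)[OF D] by (rule continuous_on_subset) simp
  have "continuous_on unit_disc (laplacian \<phi>)"
    unfolding laplacian_def[abs_def] by (intro continuous_intros c)
  moreover have "laplacian \<phi> z = 0" if "z \<notin> K" for z
    unfolding laplacian_def by (simp add: d2[OF that])
  moreover have "continuous_on unit_disc \<phi>"
    using D2_along_cont(1)[OF D] by (rule continuous_on_subset) simp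
  ultimately show ?thesis using that K d1 d2 D c by blast
qed

text \<open>On each line \<open>u * \<phi>1 - ub * \<phi>\<close> is an antiderivative of the
  integrand, and it vanishes outside \<open>K\<close>.\<close>

lemma Green_test_fun_direction:
  assumes b: "b \<in> Basis" and u: "D2_along b u ub ubb unit_disc"
    and \<phi>: "D2_along b \<phi> \<phi>1 \<phi>2 unit_disc"
    and K: "compact K" "K \<subseteq> unit_disc"
    and z: "\<And>z. z \<notin> K \<Longrightarrow> \<phi> z = 0" "\<And>z. z \<notin> K \<Longrightarrow> \<phi>1 z = 0" "\<And>z. z \<notin> K \<Longrightarrow> \<phi>2 z = 0"
  shows "(LINT z|lborel. indicator unit_disc z * (u z * \<phi>2 z - \<phi> z * ubb z)) = 0"
proof -
  obtain \<rho> where \<rho>: "0 < \<rho>" "\<rho> < 1" "\<And>z. z \<in> K \<Longrightarrow> norm z < \<rho>"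
    by (rule compact_in_disc_radius[OF K]) (rule that; assumption)
  define g where "g z = u z * \<phi>2 z - \<phi> z * ubb z" for z
  have gc: "continuous_on unit_disc g"
    unfolding g_def by (intro continuous_intros D2_along_cont[OF u] D2_along_cont[OF \<phi>])
  have gz: "g w = 0" if "\<rho> \<le> norm w" for w
    using \<rho>(3)[of w] z(1,3)[of w] that by (force simp: g_def)
  have i: "integrable lborel (\<lambda>z. indicator unit_disc z * g z)"
    by (rule integrable_compact_support[OF K _ gc]) (simp add: g_def z)
  have slice: "(LINT t|lborel. indicator unit_disc (line_pt b s t) * g (line_pt b s t)) = 0" for s
  proof (cases "\<bar>s\<bar> \<ge> \<rho>")
    case True
    then have "g (line_pt b s t) = 0" for t
      using gz abs_le_norm_line_pt(1)[OF b, of s t] by simp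
    then show ?thesis by simp
  next
    case False
    \<comment> \<open>Half the length of the chord at distance \<open>s\<close> from the center in
      the disc of radius \<open>\<rho>\<close>. Its end points have norm \<open>\<rho>\<close>, so
      they lie outside \<open>K\<close> and contribute no boundary terms.\<close>
    define \<tau> where "\<tau> = sqrt (\<rho>\<^sup>2 - s\<^sup>2)"
    have s2: "s\<^sup>2 \<le> \<rho>\<^sup>2" using False \<rho>(1) by (simp add: abs_le_square_iff[symmetric])
    have tau: "0 \<le> \<tau>" "\<tau>\<^sup>2 = \<rho>\<^sup>2 - s\<^sup>2" using s2 by (auto simp: \<tau>_def)
    have inn: "norm (line_pt b s t) \<le> \<rho>" if "-\<tau> \<le> t" "t \<le> \<tau>" for t
    proof -
      have "\<bar>t\<bar> \<le> \<bar>\<tau>\<bar>" using that by simp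
      then have "t\<^sup>2 \<le> \<tau>\<^sup>2" by (simp only: abs_le_square_iff)
      then have "(norm (line_pt b s t))\<^sup>2 \<le> \<rho>\<^sup>2" using tau(2) norm_line_pt[OF b, of s t] by simp
      then show ?thesis using \<rho>(1) by (simp add: power2_le_iff_abs_le)
    qed
    have out: "\<rho> \<le> norm (line_pt b s t)" if "\<tau> \<le> \<bar>t\<bar>" for t
    proof -
      have "\<bar>\<tau>\<bar> \<le> \<bar>t\<bar>" using that tau(1) by simp
      then have "\<tau>\<^sup>2 \<le> t\<^sup>2" by (simp only: abs_le_square_iff)
      then have "\<rho>\<^sup>2 \<le> (norm (line_pt b s t))\<^sup>2" using tau(2) norm_line_pt[OF b, of s t] by simp
      then show ?thesis by (rule power2_le_imp_le) simp
    qed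
    have D: "line_pt b s t \<in> unit_disc" if "-\<tau> \<le> t" "t \<le> \<tau>" for t
      using inn[OF that] \<rho>(2) by simp
    have "(LINT t|lborel. indicator unit_disc (line_pt b s t) * g (line_pt b s t)) = (LINT t|lborel. g (line_pt b s t) * indicator {-\<tau>..\<tau>} t)"
    proof (rule Bochner_Integration.integral_cong[OF refl])
      fix t
      show "indicator unit_disc (line_pt b s t) * g (line_pt b s t) = g (line_pt b s t) * indicator {-\<tau>..\<tau>} t"
      proof (cases "-\<tau> \<le> t \<and> t \<le> \<tau>")
        case True
        then show ?thesis using D[of t] by (simp del: mem_ball_0)
      next
        case False
        then have "g (line_pt b s t) = 0" by (intro gz out) auto
        then show ?thesis by simp
      qed
    qed
    also have "\<dots> = (u (line_pt b s \<tau>) * \<phi>1 (line_pt b s \<tau>) - ub (line_pt b s \<tau>) * \<phi> (line_pt b s \<tau>))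
        - (u (line_pt b s (-\<tau>)) * \<phi>1 (line_pt b s (-\<tau>)) - ub (line_pt b s (-\<tau>)) * \<phi> (line_pt b s (-\<tau>)))"
    proof (rule integral_FTC_Icc_real)
      show "-\<tau> \<le> \<tau>" using tau(1) by simp
      fix t assume t: "-\<tau> \<le> t" "t \<le> \<tau>"
      note D2_along_line[OF u D[OF t]] D2_along_line[OF \<phi> D[OF t]]
      then show "DERIV (\<lambda>t. u (line_pt b s t) * \<phi>1 (line_pt b s t) - ub (line_pt b s t) * \<phi> (line_pt b s t)) t :> g (line_pt b s t)"
        by (auto intro!: derivative_eq_intros simp: g_def algebra_simps)
      have "isCont g (line_pt b s t)" using gc D[OF t] by (simp add: continuous_on_eq_continuous_at)
      moreover have "isCont (line_pt b s) t" unfolding line_pt_def by (intro continuous_intros)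
      ultimately show "isCont (\<lambda>t. g (line_pt b s t)) t" using isCont_o2[of t "line_pt b s" g] by simp
    qed
    also have "\<dots> = 0"
    proof -
      have "line_pt b s \<tau> \<notin> K" "line_pt b s (-\<tau>) \<notin> K"
        using \<rho>(3)[of "line_pt b s \<tau>"] \<rho>(3)[of "line_pt b s (-\<tau>)"] out[of \<tau>] out[of "-\<tau>"] tau(1) by auto
      then show ?thesis by (simp add: z)
    qed
    finally show ?thesis .
  qed
  show ?thesis using integral_line_pt(1)[OF b i] unfolding slice by (simp add: g_def)
qed

lemma emeasure_compact_density:
  fixes g :: "complex \<Rightarrow> real"
  assumes K: "compact K" "K \<subseteq> unit_disc" and g: "continuous_on unit_disc g" and gn: "\<And>z. z \<in> unit_disc \<Longrightarrow> 0 \<le> g z"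
  shows "(\<integral>\<^sup>+z. indicator K z * ennreal (g z) \<partial>lborel) < \<infinity>"
proof -
  have "integrable lborel (\<lambda>z. indicator K z *\<^sub>R g z)"
    by (rule borel_integrable_compact[OF K(1) continuous_on_subset[OF g K(2)]])
  then have "(\<integral>\<^sup>+z. ennreal (norm (indicator K z *\<^sub>R g z)) \<partial>lborel) < \<infinity>"
    by (simp add: integrable_iff_bounded)
  also have "(\<integral>\<^sup>+z. ennreal (norm (indicator K z *\<^sub>R g z)) \<partial>lborel) = (\<integral>\<^sup>+z. indicator K z * ennreal (g z) \<partial>lborel)"
  proof (rule nn_integral_cong)
    fix z
    show "ennreal (norm (indicator K z *\<^sub>R g z)) = indicator K z * ennreal (g z)"
      using gn[OF subsetD[OF K(2)], of z] by (cases "z \<in> K") simp_all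
  qed
  finally show ?thesis .
qed

locale C2_subharmonic =
  fixes u :: "complex \<Rightarrow> real" and u1 u2 :: "complex \<Rightarrow> complex \<Rightarrow> real"
  assumes D2_along_u: "\<And>b. b \<in> Basis \<Longrightarrow> D2_along b u (u1 b) (u2 b) unit_disc"
    and Lap_nonneg: "\<And>z. z \<in> unit_disc \<Longrightarrow> 0 \<le> (\<Sum>b\<in>Basis. u2 b z)"
begin

definition Lap :: "complex \<Rightarrow> real"
  where "Lap z = (\<Sum>b\<in>Basis. u2 b z)"

lemma cont_u: "continuous_on unit_disc u"
  using D2_along_cont(1)[OF D2_along_u[of 1]] by (simp add: Basis_complex_def)

lemma cont_Lap: "continuous_on unit_disc Lap"
  unfolding Lap_def by (intro continuous_on_sum D2_along_cont(3)[OF D2_along_u])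

lemma Lap_ge_0: "z \<in> unit_disc \<Longrightarrow> 0 \<le> Lap z"
  unfolding Lap_def by (rule Lap_nonneg)

lemma Green_test_fun:
  assumes "test_fun unit_disc \<phi>"
  shows "(LINT z|lborel. indicator unit_disc z * (u z * laplacian \<phi> z)) = (LINT z|lborel. indicator unit_disc z * (\<phi> z * Lap z))"
    and "integrable lborel (\<lambda>z. indicator unit_disc z * (u z * laplacian \<phi> z))"
    and "integrable lborel (\<lambda>z. indicator unit_disc z * (\<phi> z * Lap z))"
proof -
  obtain K where K: "compact K" "K \<subseteq> unit_disc" "\<And>z. z \<notin> K \<Longrightarrow> \<phi> z = 0"
    "\<And>z b. z \<notin> K \<Longrightarrow> dir_deriv b \<phi> z = 0" "\<And>z. z \<notin> K \<Longrightarrow> laplacian \<phi> z = 0"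
    "\<And>z b. z \<notin> K \<Longrightarrow> dir_deriv b (dir_deriv b \<phi>) z = 0"
    "\<And>b. D2_along b \<phi> (dir_deriv b \<phi>) (dir_deriv b (dir_deriv b \<phi>)) UNIV"
    "continuous_on unit_disc \<phi>" "continuous_on unit_disc (laplacian \<phi>)"
    "\<And>b. continuous_on unit_disc (dir_deriv b (dir_deriv b \<phi>))"
    by (rule test_funE[OF assms]) (rule that; assumption)
  show i1: "integrable lborel (\<lambda>z. indicator unit_disc z * (u z * laplacian \<phi> z))"
    by (rule integrable_compact_support[OF K(1,2)]) (auto simp: K intro!: continuous_intros cont_u K)
  show i2: "integrable lborel (\<lambda>z. indicator unit_disc z * (\<phi> z * Lap z))"
    by (rule integrable_compact_support[OF K(1,2)]) (auto simp: K intro!: continuous_intros cont_Lap K)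
  let ?g = "\<lambda>b z. u z * dir_deriv b (dir_deriv b \<phi>) z - \<phi> z * u2 b z"
  have gi: "integrable lborel (\<lambda>z. indicator unit_disc z * ?g b z)" if "b \<in> Basis" for b
    by (rule integrable_compact_support[OF K(1,2)])
       (simp add: K, intro continuous_intros cont_u K D2_along_cont(3)[OF D2_along_u[OF that]])
  have g0: "(LINT z|lborel. indicator unit_disc z * ?g b z) = 0" if "b \<in> Basis" for b
    by (rule Green_test_fun_direction[OF that D2_along_u[OF that] D2_along_subset[OF K(7) subset_UNIV] K(1,2,3,4,6)])
  have "(LINT z|lborel. indicator unit_disc z * (u z * laplacian \<phi> z)) - (LINT z|lborel. indicator unit_disc z * (\<phi> z * Lap z))
     = (LINT z|lborel. (\<Sum>b\<in>Basis. indicator unit_disc z * ?g b z))"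
    using i1 i2 by (subst Bochner_Integration.integral_diff[symmetric])
      (auto intro!: Bochner_Integration.integral_cong simp: laplacian_def Lap_def sum_subtractf sum_distrib_left sum_distrib_right right_diff_distrib)
  also have "\<dots> = 0" using gi g0 by (subst Bochner_Integration.integral_sum) auto
  finally show "(LINT z|lborel. indicator unit_disc z * (u z * laplacian \<phi> z)) = (LINT z|lborel. indicator unit_disc z * (\<phi> z * Lap z))"
    by simp
qed

text \<open>\<open>Riesz UNIV\<close> will be dd^c of \<open>u\<close>. The cut-off by
  \<open>C\<close> provides its restriction to the complement of a sublevel set as a measure with
  the same sets, ready for \<open>add_measure\<close>.\<close>

definition Riesz :: "complex set \<Rightarrow> complex measure"
  where "Riesz C = density (restrict_space lborel unit_disc) (\<lambda>z. ennreal (indicator C z * Lap z / (2 * pi)))"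

lemma sets_Riesz [simp]: "sets (Riesz C) = sets borel_disc"
  by (simp add: Riesz_def sets_restrict_space)

lemma Lap_measurable: "Lap \<in> borel_measurable (restrict_space lborel unit_disc)"
  by (rule borel_measurable_disc[OF cont_Lap]) (simp add: sets_restrict_space)

lemma Riesz_density_measurable:
  assumes "C \<in> sets borel"
  shows "(\<lambda>z. indicator C z * Lap z / (2 * pi)) \<in> borel_measurable (restrict_space lborel unit_disc)"
proof -
  have "(indicator C :: complex \<Rightarrow> real) \<in> borel_measurable (restrict_space lborel unit_disc)"
    using assms by (intro measurable_restrict_space1) simp
  then show ?thesis using Lap_measurable by simp
qed

lemma emeasure_Riesz:
  assumes C: "C \<in> sets borel" and A: "A \<in> sets borel_disc"
  shows "emeasure (Riesz C) A = (\<integral>\<^sup>+z. indicator (A \<inter> C) z * ennreal (Lap z / (2 * pi)) \<partial>lborel)"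
proof -
  have A2: "A \<in> sets (restrict_space lborel unit_disc)" "A \<subseteq> unit_disc" using A sets.sets_into_space[OF A]
    by (auto simp: sets_restrict_space simp del: mem_ball_0)
  have "emeasure (Riesz C) A = (\<integral>\<^sup>+z. ennreal (indicator C z * Lap z / (2 * pi)) * indicator A z \<partial>restrict_space lborel unit_disc)"
    unfolding Riesz_def using Riesz_density_measurable[OF C] A2(1) by (intro emeasure_density) auto
  also have "\<dots> = (\<integral>\<^sup>+z. ennreal (indicator C z * Lap z / (2 * pi)) * indicator A z * indicator unit_disc z \<partial>lborel)"
    by (subst nn_integral_restrict_space) auto
  also have "\<dots> = (\<integral>\<^sup>+z. indicator (A \<inter> C) z * ennreal (Lap z / (2 * pi)) \<partial>lborel)"
    by (rule nn_integral_cong) (use A2(2) in \<open>auto simp: indicator_def simp del: mem_ball_0\<close>)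
  finally show ?thesis .
qed

lemma integral_Riesz:
  assumes C: "C \<in> sets borel" and f: "continuous_on unit_disc f"
    and i: "integrable lborel (\<lambda>z. indicator unit_disc z * (f z * Lap z))"
  shows "integrable (Riesz C) f"
    and "(LINT z|Riesz C. f z) = (LINT z|lborel. indicator unit_disc z * (indicator C z * (f z * Lap z))) / (2 * pi)"
proof -
  have m: "f \<in> borel_measurable (restrict_space lborel unit_disc)"
    by (rule borel_measurable_disc[OF f]) (simp add: sets_restrict_space)
  have nn: "AE z in restrict_space lborel unit_disc. 0 \<le> indicator C z * Lap z / (2 * pi)"
    by (rule AE_I2) (auto simp: space_restrict_space Lap_ge_0 simp del: mem_ball_0 intro!: divide_nonneg_pos mult_nonneg_nonneg)
  have "integrable lborel (\<lambda>z. indicator C z *\<^sub>R (indicator unit_disc z * (f z * Lap z)))"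
    using C by (intro integrable_mult_indicator i) simp
  then have "integrable lborel (\<lambda>z. (indicator C z *\<^sub>R (indicator unit_disc z * (f z * Lap z))) / (2 * pi))"
    by (rule integrable_divide_zero)
  moreover have eq: "(\<lambda>z. (indicator C z *\<^sub>R (indicator unit_disc z * (f z * Lap z))) / (2 * pi)) =
     (\<lambda>z. indicator unit_disc z *\<^sub>R ((indicator C z * Lap z / (2 * pi)) *\<^sub>R f z))"
    by (auto simp: fun_eq_iff)
  ultimately have i2: "integrable (restrict_space lborel unit_disc) (\<lambda>z. (indicator C z * Lap z / (2 * pi)) *\<^sub>R f z)"
    by (subst integrable_restrict_space) auto
  show "integrable (Riesz C) f" unfolding Riesz_def
    by (subst integrable_density[OF m Riesz_density_measurable[OF C] nn]) (rule i2)
  have "(LINT z|Riesz C. f z) = (LINT z|restrict_space lborel unit_disc. (indicator C z * Lap z / (2 * pi)) *\<^sub>R f z)"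
    unfolding Riesz_def by (rule integral_density[OF m Riesz_density_measurable[OF C] nn])
  also have "\<dots> = (LINT z|lborel. indicator unit_disc z *\<^sub>R ((indicator C z * Lap z / (2 * pi)) *\<^sub>R f z))"
    by (subst integral_restrict_space) auto
  also have "\<dots> = (LINT z|lborel. (indicator unit_disc z * (indicator C z * (f z * Lap z))) / (2 * pi))"
    by (rule Bochner_Integration.integral_cong) auto
  also have "\<dots> = (LINT z|lborel. indicator unit_disc z * (indicator C z * (f z * Lap z))) / (2 * pi)"
    by simp
  finally show "(LINT z|Riesz C. f z) = (LINT z|lborel. indicator unit_disc z * (indicator C z * (f z * Lap z))) / (2 * pi)" .
qed

lemma emeasure_Riesz_compact:
  assumes C: "C \<in> sets borel" and K: "compact K" "K \<subseteq> unit_disc"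
  shows "emeasure (Riesz C) K < \<infinity>"
proof -
  have "unit_disc \<inter> K \<in> sets borel_disc" unfolding sets_restrict_space
    by (rule imageI) (rule borel_closed[OF compact_imp_closed[OF K(1)]])
  then have KM: "K \<in> sets borel_disc" using K(2) by (simp add: Int_absorb1)
  have "emeasure (Riesz C) K \<le> (\<integral>\<^sup>+z. indicator K z * ennreal (Lap z / (2 * pi)) \<partial>lborel)"
    unfolding emeasure_Riesz[OF C KM] by (intro nn_integral_mono mult_right_mono) (auto simp: indicator_def)
  also have "\<dots> < \<infinity>"
    by (rule emeasure_compact_density[OF K])
      (auto intro!: continuous_intros cont_Lap divide_nonneg_pos Lap_ge_0 simp del: mem_ball_0)
  finally show ?thesis .
qed

lemma is_ddc_u: "is_ddc (\<lambda>z. ereal (u z)) (Riesz UNIV)"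
  unfolding is_ddc_def
proof (intro conjI allI impI)
  show "sets (Riesz UNIV) = sets borel_disc" by simp
  show "emeasure (Riesz UNIV) K < \<infinity>" if "compact K" "K \<subseteq> unit_disc" for K
    using emeasure_Riesz_compact[OF _ that] by simp
  fix \<phi> assume t: "test_fun unit_disc \<phi>"
  have "continuous_on unit_disc \<phi>" by (rule test_funE[OF t])
  from integral_Riesz(2)[OF _ this Green_test_fun(3)[OF t], of UNIV]
  show "(LINT z:unit_disc|lborel. real_of_ereal (ereal (u z)) * laplacian \<phi> z) / (2 * pi) = (LINT z|Riesz UNIV. \<phi> z)"
    using Green_test_fun(1)[OF t] by (simp add: set_lebesgue_integral_def)
qed

lemma ddc_u: "ddc (\<lambda>z. ereal (u z)) = Riesz UNIV"
  by (rule ddc_eqI[OF is_ddc_u])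

end

section \<open>Identification of the level measure\<close>

context C2_subharmonic
begin

text \<open>The maximum of u and r is u plus the function r - u cut off to \<open>B\<close>. Green's
  identity turns the first summand into the density of dd^c u, and \<open>J\<close> turns the second
  into \<open>\<mu>\<close> minus that density on \<open>B\<close>. Hence dd^c of the maximum is
  \<open>\<mu>\<close> plus the part of dd^c u outside \<open>B\<close>.\<close>

lemma level_measure_eqI:
  fixes r :: real and \<mu> :: "complex measure"
  defines "B \<equiv> {z\<in>unit_disc. u z < r}"
  assumes cl: "closure B \<subseteq> unit_disc"
    and mass: "emeasure (Riesz UNIV) unit_disc < \<infinity>"
    and \<mu>: "sets \<mu> = sets borel_disc" "emeasure \<mu> unit_disc < \<infinity>"
    and J: "\<And>\<psi> \<psi>1 \<psi>2. (\<And>b. b \<in> Basis \<Longrightarrow> D2_along b \<psi> (\<psi>1 b) (\<psi>2 b) unit_disc) \<Longrightarrow> integrable \<mu> \<psi> \<and>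
       (LINT z|\<mu>. \<psi> z) = 1 / (2 * pi) * (LINT z|lborel. indicator B z *
          (\<psi> z * Lap z + (r - u z) * (\<Sum>b\<in>Basis. \<psi>2 b z)))"
  shows "level_measure (\<lambda>z. ereal (u z)) r = \<mu>"
proof -
  define C where "C = unit_disc - B"
  define \<nu> where "\<nu> = add_measure \<mu> (Riesz C)"
  have Bo: "open B" unfolding B_def by (rule open_sublevel[OF cont_u])
  have BD: "B \<subseteq> unit_disc" by (auto simp: B_def)
  have Cb: "C \<in> sets borel" using Bo by (simp add: C_def)
  have sC: "sets (Riesz C) = sets \<mu>" using \<mu> by simp
  have fin: "emeasure \<mu> A < \<infinity>" "emeasure (Riesz UNIV) A < \<infinity>" if "A \<subseteq> unit_disc" for A
  proof -
    have "unit_disc \<in> sets borel_disc" using sets.top[of borel_disc] by simp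
    then have "emeasure \<mu> A \<le> emeasure \<mu> unit_disc" "emeasure (Riesz UNIV) A \<le> emeasure (Riesz UNIV) unit_disc"
      using \<mu>(1) by (auto intro!: emeasure_mono that)
    then show "emeasure \<mu> A < \<infinity>" "emeasure (Riesz UNIV) A < \<infinity>"
      using \<mu>(2) mass by (auto intro: le_less_trans)
  qed
  have "is_ddc (\<lambda>z. max (ereal (u z)) (ereal r)) \<nu>"
    unfolding is_ddc_def
  proof (intro conjI allI impI)
    show "sets \<nu> = sets borel_disc" by (simp add: \<nu>_def \<mu>)
    show "emeasure \<nu> K < \<infinity>" if K: "compact K" "K \<subseteq> unit_disc" for K
    proof -
      have "unit_disc \<inter> K \<in> sets borel_disc" unfolding sets_restrict_space
        by (rule imageI) (rule borel_closed[OF compact_imp_closed[OF K(1)]])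
      then have "K \<in> sets \<mu>" using K(2) \<mu>(1) by (simp add: Int_absorb1)
      then show ?thesis
        using fin(1)[OF K(2)] emeasure_Riesz_compact[OF Cb K] by (simp add: \<nu>_def emeasure_add_measure[OF sC])
    qed
    fix \<phi> assume t: "test_fun unit_disc \<phi>"
    obtain K where K: "compact K" "K \<subseteq> unit_disc" "\<And>z. z \<notin> K \<Longrightarrow> \<phi> z = 0"
      "\<And>z b. z \<notin> K \<Longrightarrow> dir_deriv b \<phi> z = 0" "\<And>z. z \<notin> K \<Longrightarrow> laplacian \<phi> z = 0"
      "\<And>z b. z \<notin> K \<Longrightarrow> dir_deriv b (dir_deriv b \<phi>) z = 0"
      "\<And>b. D2_along b \<phi> (dir_deriv b \<phi>) (dir_deriv b (dir_deriv b \<phi>)) UNIV"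
      "continuous_on unit_disc \<phi>" "continuous_on unit_disc (laplacian \<phi>)"
      "\<And>b. continuous_on unit_disc (dir_deriv b (dir_deriv b \<phi>))"
      by (rule test_funE[OF t]) (rule that; assumption)
    have j: "integrable \<mu> \<phi>" "(LINT z|\<mu>. \<phi> z) = 1 / (2 * pi) * (LINT z|lborel. indicator B z * (\<phi> z * Lap z + (r - u z) * laplacian \<phi> z))"
      using J[OF D2_along_subset[OF K(7) subset_UNIV]] unfolding laplacian_def by blast+
    note G = Green_test_fun[OF t]
    note R = integral_Riesz[OF Cb K(8) G(3)]
    have iB: "integrable lborel (\<lambda>z. indicator B z * ((r - u z) * laplacian \<phi> z))"
      by (rule integrable_indicator_disc[OF _ cl]) (use Bo in \<open>auto intro!: continuous_intros cont_u K\<close>)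
    have iB2: "integrable lborel (\<lambda>z. indicator B z * (\<phi> z * Lap z + (r - u z) * laplacian \<phi> z))"
      by (rule integrable_indicator_disc[OF _ cl]) (use Bo in \<open>auto intro!: continuous_intros cont_u cont_Lap K\<close>)
    have iC: "integrable lborel (\<lambda>z. indicator unit_disc z * (indicator C z * (\<phi> z * Lap z)))"
    proof -
      have "integrable lborel (\<lambda>z. indicator C z *\<^sub>R (indicator unit_disc z * (\<phi> z * Lap z)))"
        using Cb by (intro integrable_mult_indicator G(3)) simp
      then show ?thesis by (simp add: mult.left_commute)
    qed
    have ind: "indicator B z * indicator unit_disc z = (indicator B z :: real)"
      "indicator C z = (indicator unit_disc z - indicator B z :: real)" for z
      using BD by (auto simp: indicator_def C_def simp del: mem_ball_0)
    \<comment> \<open>The test function may be nonzero on the level curve, so the cut-off summand is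
      not handled by Green's identity; its boundary contribution is exactly what \<open>J\<close>
      accounts for.\<close>
    have "(LINT z|lborel. indicator unit_disc z * (max (u z) r * laplacian \<phi> z)) =
       (LINT z|lborel. indicator unit_disc z * (u z * laplacian \<phi> z) + indicator B z * ((r - u z) * laplacian \<phi> z))"
      by (rule Bochner_Integration.integral_cong)
        (auto simp: indicator_def B_def max_def algebra_simps simp del: mem_ball_0)
    also have "\<dots> = (LINT z|lborel. indicator unit_disc z * (\<phi> z * Lap z)) + (LINT z|lborel. indicator B z * ((r - u z) * laplacian \<phi> z))"
      using G iB by simp
    also have "\<dots> = (LINT z|lborel. indicator unit_disc z * (\<phi> z * Lap z) + indicator B z * ((r - u z) * laplacian \<phi> z))"
      using G iB by simp
    also have "\<dots> = (LINT z|lborel. indicator B z * (\<phi> z * Lap z + (r - u z) * laplacian \<phi> z)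
         + indicator unit_disc z * (indicator C z * (\<phi> z * Lap z)))"
    proof (rule Bochner_Integration.integral_cong[OF refl])
      fix z
      show "indicator unit_disc z * (\<phi> z * Lap z) + indicator B z * ((r - u z) * laplacian \<phi> z)
        = indicator B z * (\<phi> z * Lap z + (r - u z) * laplacian \<phi> z) + indicator unit_disc z * (indicator C z * (\<phi> z * Lap z))"
        using BD by (cases "z \<in> B"; cases "z \<in> unit_disc") (auto simp: C_def algebra_simps simp del: mem_ball_0)
    qed
    also have "\<dots> = (LINT z|lborel. indicator B z * (\<phi> z * Lap z + (r - u z) * laplacian \<phi> z))
         + (LINT z|lborel. indicator unit_disc z * (indicator C z * (\<phi> z * Lap z)))"
      using iB2 iC by simp
    finally have eq: "(LINT z|lborel. indicator unit_disc z * (max (u z) r * laplacian \<phi> z)) / (2 * pi) =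
       (LINT z|\<mu>. \<phi> z) + (LINT z|Riesz C. \<phi> z)"
      unfolding j(2) R(2) by (simp add: add_divide_distrib)
    show "(LINT z:unit_disc|lborel. real_of_ereal (max (ereal (u z)) (ereal r)) * laplacian \<phi> z) / (2 * pi) = (LINT z|\<nu>. \<phi> z)"
      unfolding \<nu>_def integral_add_measure(2)[OF sC j(1) R(1)] eq[symmetric]
      by (simp add: set_lebesgue_integral_def ereal_max[symmetric] del: ereal_max)
  qed
  then have ddc_max: "ddc (\<lambda>z. max (ereal (u z)) (ereal r)) = \<nu>" by (rule ddc_eqI)
  have sub: "unit_disc - sublevel (\<lambda>z. ereal (u z)) r = C" by (simp add: sublevel_def C_def B_def)
  have em: "emeasure \<nu> A = emeasure \<mu> A + emeasure (Riesz UNIV) (A \<inter> C)" if A: "A \<in> sets borel_disc" for A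
  proof -
    have "unit_disc \<inter> C \<in> sets borel_disc" unfolding sets_restrict_space by (rule imageI) (rule Cb)
    then have "A \<inter> C \<in> sets borel_disc" using A by (simp add: C_def Int_Diff sets.Diff inf_commute)
      (metis C_def Diff_subset Int_absorb2 inf_commute sets.Int)
    then show ?thesis using A \<mu>(1)
      by (simp add: \<nu>_def emeasure_add_measure[OF sC] emeasure_Riesz Cb Int_assoc)
  qed
  show ?thesis
    unfolding level_measure_def ddc_max ddc_u sub
  proof (rule the_equality)
    show "sets \<mu> = sets borel_disc \<and> (\<forall>A\<in>sets borel_disc. emeasure \<nu> A = emeasure \<mu> A + emeasure (Riesz UNIV) (A \<inter> C))"
      using \<mu>(1) em by blast
    fix \<rho> assume \<rho>: "sets \<rho> = sets borel_disc \<and> (\<forall>A\<in>sets borel_disc. emeasure \<nu> A = emeasure \<rho> A + emeasure (Riesz UNIV) (A \<inter> C))"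
    show "\<rho> = \<mu>"
    proof (rule measure_eqI)
      show "sets \<rho> = sets \<mu>" using \<rho> \<mu>(1) by simp
      fix A assume "A \<in> sets \<rho>"
      then have A: "A \<in> sets borel_disc" using \<rho> by simp
      \<comment> \<open>A common summand can be cancelled in the extended nonnegative reals only if
        it is finite; here the assumption \<open>mass\<close> enters.\<close>
      have "emeasure (Riesz UNIV) (A \<inter> C) < \<infinity>" by (rule fin(2)) (auto simp: C_def)
      moreover have "emeasure \<rho> A + emeasure (Riesz UNIV) (A \<inter> C) = emeasure \<mu> A + emeasure (Riesz UNIV) (A \<inter> C)"
        using \<rho> A em[OF A] by metis
      ultimately show "emeasure \<rho> A = emeasure \<mu> A" by (auto simp: add.commute[of _ "emeasure (Riesz UNIV) (A \<inter> C)"] ennreal_add_left_cancel)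
    qed
  qed
qed

text \<open>The measure built from slices with the factor 1 / (2 pi) is the one singled out by the
  definite description. From here on only these four properties of \<open>level_measure\<close> are
  used.\<close>

lemma level_measure_props:
  fixes r :: real
  defines "B \<equiv> {z\<in>unit_disc. u z < r}" and "\<mu> \<equiv> level_measure (\<lambda>z. ereal (u z)) r"
  assumes cl: "closure B \<subseteq> unit_disc"
    and conv: "\<And>b s. b \<in> Basis \<Longrightarrow> convex {t. line_pt b s t \<in> unit_disc \<and> u (line_pt b s t) < r}"
    and mass: "emeasure (Riesz UNIV) unit_disc < \<infinity>"
  shows "sets \<mu> = sets borel_disc" "emeasure \<mu> unit_disc < \<infinity>"
    "emeasure \<mu> (unit_disc - {z\<in>unit_disc. u z = r}) = 0"
    "\<And>\<psi> \<psi>1 \<psi>2. (\<And>b. b \<in> Basis \<Longrightarrow> D2_along b \<psi> (\<psi>1 b) (\<psi>2 b) unit_disc) \<Longrightarrow> integrable \<mu> \<psi> \<and>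
       (LINT z|\<mu>. \<psi> z) = 1 / (2 * pi) * (LINT z|lborel. indicator B z *
          (\<psi> z * Lap z + (r - u z) * (\<Sum>b\<in>Basis. \<psi>2 b z)))"
proof -
  have pi0: "0 < 1 / (2 * pi)" by simp
  let ?J = "\<lambda>m \<psi> \<psi>2. integrable m \<psi> \<and> (LINT z|m. \<psi> z) = 1 / (2 * pi) *
      (LINT z|lborel. indicator {z\<in>unit_disc. u z < r} z * (\<psi> z * (\<Sum>b\<in>Basis. u2 b z) + (r - u z) * (\<Sum>b\<in>Basis. \<psi>2 b z)))"
  have "\<exists>m. sets m = sets borel_disc \<and> emeasure m unit_disc < \<infinity> \<and>
    emeasure m (unit_disc - {z\<in>unit_disc. u z = r}) = 0 \<and>
    (\<forall>\<psi> \<psi>1 \<psi>2. (\<forall>b\<in>Basis. D2_along b \<psi> (\<psi>1 b) (\<psi>2 b) unit_disc) \<longrightarrow> ?J m \<psi> \<psi>2)"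
  proof (rule level_measure_exists[OF D2_along_u cl[unfolded B_def] conv pi0])
    fix m assume m: "sets m = sets borel_disc" "emeasure m unit_disc < \<infinity>"
      "emeasure m (unit_disc - {z\<in>unit_disc. u z = r}) = 0"
      "\<And>\<psi> \<psi>1 \<psi>2. (\<And>b. b \<in> Basis \<Longrightarrow> D2_along b \<psi> (\<psi>1 b) (\<psi>2 b) unit_disc) \<Longrightarrow> ?J m \<psi> \<psi>2"
    show ?thesis by (intro exI[of _ m] conjI m(1-3) allI impI m(4)) auto
  qed
  then obtain m where m: "sets m = sets borel_disc" "emeasure m unit_disc < \<infinity>"
    "emeasure m (unit_disc - {z\<in>unit_disc. u z = r}) = 0" and
    mJ: "\<forall>\<psi> \<psi>1 \<psi>2. (\<forall>b\<in>Basis. D2_along b \<psi> (\<psi>1 b) (\<psi>2 b) unit_disc) \<longrightarrow> ?J m \<psi> \<psi>2"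
    by (elim exE conjE)
  have m4: "?J m \<psi> \<psi>2" if "\<And>b. b \<in> Basis \<Longrightarrow> D2_along b \<psi> (\<psi>1 b) (\<psi>2 b) unit_disc" for \<psi> \<psi>1 \<psi>2
    by (rule mJ[rule_format]) (rule that)
  have "\<mu> = m"
    unfolding \<mu>_def
  proof (rule level_measure_eqI[OF cl[unfolded B_def] mass m(1,2)])
    show "integrable m \<psi> \<and>
       (LINT z|m. \<psi> z) = 1 / (2 * pi) * (LINT z|lborel. indicator {z\<in>unit_disc. u z < r} z *
          (\<psi> z * Lap z + (r - u z) * (\<Sum>b\<in>Basis. \<psi>2 b z)))"
      if "\<And>b. b \<in> Basis \<Longrightarrow> D2_along b \<psi> (\<psi>1 b) (\<psi>2 b) unit_disc" for \<psi> \<psi>1 \<psi>2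
      using m4[OF that] unfolding Lap_def .
  qed
  then show "sets \<mu> = sets borel_disc" "emeasure \<mu> unit_disc < \<infinity>"
    "emeasure \<mu> (unit_disc - {z\<in>unit_disc. u z = r}) = 0" using m by simp_all
  show "integrable \<mu> \<psi> \<and>
       (LINT z|\<mu>. \<psi> z) = 1 / (2 * pi) * (LINT z|lborel. indicator B z *
          (\<psi> z * Lap z + (r - u z) * (\<Sum>b\<in>Basis. \<psi>2 b z)))"
      if "\<And>b. b \<in> Basis \<Longrightarrow> D2_along b \<psi> (\<psi>1 b) (\<psi>2 b) unit_disc" for \<psi> \<psi>1 \<psi>2
    using m4[OF that] unfolding Lap_def B_def \<open>\<mu> = m\<close> .
qed

end

section \<open>The exhaustion function\<close>

text \<open>This is |1 - z|^(2a). The square is taken as base because it is a quadratic polynomial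
  along every line; exponents in the code are therefore half of those for |1 - z|.\<close>

definition dist_powr :: "real \<Rightarrow> complex \<Rightarrow> real"
  where "dist_powr a z = (norm (1 - z))\<^sup>2 powr a"

lemma dist_powr_pos: "z \<in> unit_disc \<Longrightarrow> 0 < dist_powr a z"
  by (auto simp: dist_powr_def)

lemma dist_powr_mult: "dist_powr a z * dist_powr b z = dist_powr (a + b) z"
  by (simp add: dist_powr_def powr_add)

lemma one_notin_disc: "z \<in> unit_disc \<Longrightarrow> z \<noteq> 1"
  by auto

lemma norm2_le_dist_powr:
  assumes "z \<in> unit_disc" shows "(norm (1 - z))\<^sup>2 * dist_powr a z = dist_powr (a + 1) z"
  using one_notin_disc[OF assms] by (simp add: dist_powr_def powr_add)

lemma continuous_on_dist_powr [continuous_intros]: "continuous_on unit_disc (dist_powr a)"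
  unfolding dist_powr_def by (intro continuous_intros) (use one_notin_disc in auto)

lemma norm2_one_minus_line:
  fixes z b :: complex
  assumes "b \<in> Basis"
  shows "(norm (1 - (z + of_real t * b)))\<^sup>2 = (norm (1 - z))\<^sup>2 - 2 * t * ((1 - z) \<bullet> b) + t\<^sup>2"
  using norm_line[OF assms, of "1 - z" "- t"] by (simp add: algebra_simps)

lemma DERIV_dist_powr_line:
  assumes b: "b \<in> Basis" and z: "z \<in> unit_disc"
  shows "((\<lambda>t. dist_powr a (z + of_real t * b)) has_real_derivative (- 2 * a * ((1 - z) \<bullet> b) * dist_powr (a - 1) z)) (at 0)"
proof -
  have p: "0 < (norm (1 - z))\<^sup>2" using one_notin_disc[OF z] by simp
  show ?thesis
    unfolding dist_powr_def norm2_one_minus_line[OF b]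
    by (rule derivative_eq_intros refl | use p in simp)+
qed

lemma inner_one_minus_line:
  fixes z b :: complex
  assumes "b \<in> Basis"
  shows "(1 - (z + of_real t * b)) \<bullet> b = (1 - z) \<bullet> b - t"
  using inner_line[OF assms, of z t] by (simp add: inner_diff_left)

lemma DERIV_lines:
  fixes z b :: complex
  assumes b: "b \<in> Basis"
  shows "((\<lambda>t. (1 - (z + of_real t * b)) \<bullet> b) has_real_derivative -1) (at 0)"
    "((\<lambda>t. (z + of_real t * b) \<bullet> b) has_real_derivative 1) (at 0)"
    "((\<lambda>t. 1 - (norm (z + of_real t * b))\<^sup>2) has_real_derivative (- 2 * (z \<bullet> b))) (at 0)"
  unfolding inner_one_minus_line[OF b] inner_line[OF b] norm_line[OF b]
  by (rule derivative_eq_intros refl | simp)+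

lemma sum_Basis_complex: "(\<Sum>b\<in>Basis. f b) = f 1 + f \<i>" for f :: "complex \<Rightarrow> real"
  by (simp add: Basis_complex_def)

text \<open>The products of gradients that occur in the Laplacians below, summed over both
  directions and expressed by the two quantities |1 - z|^2 and 1 - |z|^2.\<close>

lemma inner_Basis_identities:
  fixes z :: complex
  shows "((1 - z) \<bullet> 1)\<^sup>2 + ((1 - z) \<bullet> \<i>)\<^sup>2 = (norm (1 - z))\<^sup>2"
    and "2 * ((z \<bullet> 1) * ((1 - z) \<bullet> 1) + (z \<bullet> \<i>) * ((1 - z) \<bullet> \<i>)) = (1 - (norm z)\<^sup>2) - (norm (1 - z))\<^sup>2"
  by (auto simp: inner_complex_def cmod_power2) (simp add: power2_eq_square algebra_simps)

text \<open>The factor |1 - z|^(-1/2) of the exhaustion function, and at the same time |f|^p for the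
  function that separates the two spaces.\<close>

definition pole_fun :: "complex \<Rightarrow> real" where "pole_fun = dist_powr (-1/4)"

definition pole_fun1 :: "complex \<Rightarrow> complex \<Rightarrow> real"
  where "pole_fun1 b z = ((1 - z) \<bullet> b) / 2 * dist_powr (-5/4) z"

definition pole_fun2 :: "complex \<Rightarrow> complex \<Rightarrow> real"
  where "pole_fun2 b z = - dist_powr (-5/4) z / 2 + 5/4 * ((1 - z) \<bullet> b)\<^sup>2 * dist_powr (-9/4) z"

lemma D2_along_pole_fun:
  assumes b: "b \<in> Basis"
  shows "D2_along b pole_fun (pole_fun1 b) (pole_fun2 b) unit_disc"
proof -
  have 1: "((\<lambda>t. pole_fun (z + of_real t * b)) has_real_derivative pole_fun1 b z) (at 0)" if z: "z \<in> unit_disc" for z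
    using DERIV_dist_powr_line[OF b z, of "-1/4"] by (simp add: pole_fun_def pole_fun1_def)
  have 2: "((\<lambda>t. pole_fun1 b (z + of_real t * b)) has_real_derivative pole_fun2 b z) (at 0)" if z: "z \<in> unit_disc" for z
  proof -
    have "((\<lambda>t. pole_fun1 b (z + of_real t * b)) has_real_derivative
       (-1) / 2 * dist_powr (-5/4) (z + of_real 0 * b) + (- 2 * (-5/4) * ((1 - z) \<bullet> b) * dist_powr (-5/4 - 1) z) * (((1 - (z + of_real 0 * b)) \<bullet> b) / 2)) (at 0)"
      unfolding pole_fun1_def by (intro DERIV_mult DERIV_cdivide DERIV_lines[OF b] DERIV_dist_powr_line[OF b z])
    then show ?thesis by (rule DERIV_cong) (simp add: pole_fun2_def power2_eq_square)
  qed
  have "continuous_on unit_disc pole_fun" "continuous_on unit_disc (pole_fun1 b)" "continuous_on unit_disc (pole_fun2 b)"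
    unfolding pole_fun_def pole_fun1_def pole_fun2_def by (intro continuous_intros; simp)+
  then show ?thesis unfolding D2_along_def using 1 2 by (simp del: mem_ball_0)
qed

lemma Lap_pole_fun:
  assumes "z \<in> unit_disc"
  shows "(\<Sum>b\<in>Basis. pole_fun2 b z) = dist_powr (-5/4) z / 4"
proof -
  have "(\<Sum>b\<in>Basis. pole_fun2 b z) = - dist_powr (-5/4) z + 5/4 * ((norm (1 - z))\<^sup>2 * dist_powr (-9/4) z)"
    unfolding sum_Basis_complex pole_fun2_def inner_Basis_identities(1)[symmetric] by (simp add: algebra_simps)
  also have "(norm (1 - z))\<^sup>2 * dist_powr (-9/4) z = dist_powr (-5/4) z" using norm2_le_dist_powr[OF assms, of "-9/4"] by simp
  finally show ?thesis by simp
qed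

definition exh_fun :: "complex \<Rightarrow> real" where "exh_fun z = - (1 - (norm z)\<^sup>2) * dist_powr (-1/4) z"

definition exh_fun1 :: "complex \<Rightarrow> complex \<Rightarrow> real"
  where "exh_fun1 b z = 2 * (z \<bullet> b) * dist_powr (-1/4) z - (1 - (norm z)\<^sup>2) * pole_fun1 b z"

definition exh_fun2 :: "complex \<Rightarrow> complex \<Rightarrow> real"
  where "exh_fun2 b z = 2 * dist_powr (-1/4) z + 4 * (z \<bullet> b) * pole_fun1 b z - (1 - (norm z)\<^sup>2) * pole_fun2 b z"

lemma D2_along_exh_fun:
  assumes b: "b \<in> Basis"
  shows "D2_along b exh_fun (exh_fun1 b) (exh_fun2 b) unit_disc"
proof -
  note G = D2_along_pole_fun[OF b]
  have g: "((\<lambda>t. dist_powr (-1/4) (z + of_real t * b)) has_real_derivative pole_fun1 b z) (at 0)"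
    "((\<lambda>t. pole_fun1 b (z + of_real t * b)) has_real_derivative pole_fun2 b z) (at 0)" if "z \<in> unit_disc" for z
    using G that unfolding D2_along_def pole_fun_def by blast+
  have 1: "((\<lambda>t. exh_fun (z + of_real t * b)) has_real_derivative exh_fun1 b z) (at 0)" if z: "z \<in> unit_disc" for z
  proof -
    have "((\<lambda>t. exh_fun (z + of_real t * b)) has_real_derivative
       (- (- 2 * (z \<bullet> b))) * dist_powr (-1/4) (z + of_real 0 * b) + pole_fun1 b z * (- (1 - (norm (z + of_real 0 * b))\<^sup>2))) (at 0)"
      unfolding exh_fun_def by (intro DERIV_mult DERIV_minus DERIV_lines[OF b] g z)
    then show ?thesis by (rule DERIV_cong) (simp add: exh_fun1_def algebra_simps)
  qed
  have 2: "((\<lambda>t. exh_fun1 b (z + of_real t * b)) has_real_derivative exh_fun2 b z) (at 0)" if z: "z \<in> unit_disc" for z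
  proof -
    have "((\<lambda>t. exh_fun1 b (z + of_real t * b)) has_real_derivative
       (2 * 1) * dist_powr (-1/4) (z + of_real 0 * b) + pole_fun1 b z * (2 * ((z + of_real 0 * b) \<bullet> b))
       - ((- 2 * (z \<bullet> b)) * pole_fun1 b (z + of_real 0 * b) + pole_fun2 b z * (1 - (norm (z + of_real 0 * b))\<^sup>2))) (at 0)"
      unfolding exh_fun1_def by (intro DERIV_diff DERIV_mult DERIV_cmult DERIV_lines[OF b] g z)
    then show ?thesis by (rule DERIV_cong) (simp add: exh_fun2_def algebra_simps)
  qed
  have "continuous_on unit_disc exh_fun" "continuous_on unit_disc (exh_fun1 b)" "continuous_on unit_disc (exh_fun2 b)"
    unfolding exh_fun_def exh_fun1_def exh_fun2_def by (intro continuous_intros D2_along_cont[OF G])+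
  then show ?thesis unfolding D2_along_def using 1 2 by (simp del: mem_ball_0)
qed

text \<open>Product rule with g = |1 - z|^(-1/2): the Laplacian of |z|^2 gives 4 g, and the cross
  term is ((1 - |z|^2) - |1 - z|^2) |1 - z|^(-5/2). Its second part takes away one g; its first
  part, reduced by a quarter through the Laplacian of g, leaves the coefficient 3/4.\<close>

lemma Lap_exh_fun:
  assumes "z \<in> unit_disc"
  shows "(\<Sum>b\<in>Basis. exh_fun2 b z) = 3 * dist_powr (-1/4) z + 3/4 * (1 - (norm z)\<^sup>2) * dist_powr (-5/4) z"
proof -
  have "(\<Sum>b\<in>Basis. exh_fun2 b z) = 4 * dist_powr (-1/4) z
     + (2 * ((z \<bullet> 1) * ((1 - z) \<bullet> 1) + (z \<bullet> \<i>) * ((1 - z) \<bullet> \<i>))) * dist_powr (-5/4) z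
     - (1 - (norm z)\<^sup>2) * (\<Sum>b\<in>Basis. pole_fun2 b z)"
    unfolding sum_Basis_complex exh_fun2_def pole_fun1_def by (simp add: field_simps)
  also have "\<dots> = 4 * dist_powr (-1/4) z + 3/4 * (1 - (norm z)\<^sup>2) * dist_powr (-5/4) z - (norm (1 - z))\<^sup>2 * dist_powr (-5/4) z"
    unfolding inner_Basis_identities(2) Lap_pole_fun[OF assms] by (simp add: field_simps)
  also have "(norm (1 - z))\<^sup>2 * dist_powr (-5/4) z = dist_powr (-1/4) z" using norm2_le_dist_powr[OF assms, of "-5/4"] by simp
  finally show ?thesis by simp
qed

lemma disc_norm2: "z \<in> unit_disc \<Longrightarrow> 0 < 1 - (norm z)\<^sup>2"
  by (simp add: power_less_one_iff abs_square_less_1)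

text \<open>The infimum is 2^(-1/2), so 1/4 is crude. It suffices for the two comparisons with the
  model |z|^2 - 1 that yield the inclusion: \<open>exh_fun_le\<close> bounds the function from above
  and \<open>Lap_exh_fun_ge\<close> its Laplacian from below.\<close>

lemma dist_powr_ge_quarter:
  assumes "z \<in> unit_disc" shows "1/4 \<le> dist_powr (-1/4) z"
proof -
  have "norm (1 - z) \<le> 2" using assms norm_triangle_ineq4[of 1 z] by simp
  then have "(norm (1 - z))\<^sup>2 \<le> 2\<^sup>2" by (rule power_mono) simp
  then have 4: "(norm (1 - z))\<^sup>2 \<le> 4" by simp
  have "1/4 = (4::real) powr (-1)" by (simp add: powr_minus)
  also have "\<dots> \<le> 4 powr (-1/4)" by (rule powr_mono) auto
  also have "\<dots> \<le> dist_powr (-1/4) z" unfolding dist_powr_def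
    using 4 one_notin_disc[OF assms] by (intro powr_mono2') auto
  finally show ?thesis .
qed

lemma exh_fun_le: "z \<in> unit_disc \<Longrightarrow> exh_fun z \<le> - (1 - (norm z)\<^sup>2) / 4"
  using mult_left_mono[OF dist_powr_ge_quarter, of z "1 - (norm z)\<^sup>2"] disc_norm2[of z] by (simp add: exh_fun_def)

lemma exh_fun_neg: "z \<in> unit_disc \<Longrightarrow> exh_fun z < 0"
  using disc_norm2[of z] dist_powr_pos[of z "-1/4"] mult_pos_pos[of "1 - (norm z)\<^sup>2" "dist_powr (-1/4) z"]
  by (simp add: exh_fun_def left_diff_distrib del: mem_ball_0)

lemma Lap_exh_fun_ge: "z \<in> unit_disc \<Longrightarrow> 3/4 \<le> (\<Sum>b\<in>Basis. exh_fun2 b z)"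
  using dist_powr_ge_quarter[of z] disc_norm2[of z] dist_powr_pos[of z "-5/4"]
  by (simp add: Lap_exh_fun add_increasing2 del: mem_ball_0)

interpretation exh: C2_subharmonic exh_fun exh_fun1 exh_fun2
proof
  show "0 \<le> (\<Sum>b\<in>Basis. exh_fun2 b z)" if "z \<in> unit_disc" for z using Lap_exh_fun_ge[OF that] by linarith
qed (rule D2_along_exh_fun)

text \<open>With y = 1 - |z| one has 1 - |z|^2 \<le> 2 y and |1 - z| \<ge> y, hence -u \<le> 2
  y^(1/2): the singular factor costs only half a power of the distance to the circle, and u < r
  forces y > r^2 / 4.\<close>

lemma exh_fun_exhaustion:
  assumes "r < 0"
  shows "closure {z\<in>unit_disc. exh_fun z < r} \<subseteq> unit_disc" "compact (closure {z\<in>unit_disc. exh_fun z < r})"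
proof -
  have sub: "{z\<in>unit_disc. exh_fun z < r} \<subseteq> cball 0 (1 - r\<^sup>2 / 4)"
  proof
    fix z assume "z \<in> {z\<in>unit_disc. exh_fun z < r}"
    then have z: "z \<in> unit_disc" "- r < (1 - (norm z)\<^sup>2) * dist_powr (-1/4) z" by (auto simp: exh_fun_def algebra_simps)
    define y where "y = 1 - norm z"
    have y: "y > 0" using z(1) by (simp add: y_def)
    have "y \<le> norm (1 - z)" using norm_triangle_ineq2[of 1 z] by (simp add: y_def)
    then have "y\<^sup>2 \<le> (norm (1 - z))\<^sup>2" using y by (intro power_mono) auto
    then have p: "dist_powr (-1/4) z \<le> (y\<^sup>2) powr (-1/4)" unfolding dist_powr_def
      using y by (intro powr_mono2') auto
    have "1 - (norm z)\<^sup>2 = y * (1 + norm z)" by (simp add: y_def power2_eq_square algebra_simps)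
    also have "\<dots> \<le> y * 2" using z(1) y by (intro mult_left_mono) auto
    finally have A: "1 - (norm z)\<^sup>2 \<le> 2 * y" by simp
    have "- r < (1 - (norm z)\<^sup>2) * dist_powr (-1/4) z" by fact
    also have "\<dots> \<le> (2 * y) * (y\<^sup>2) powr (-1/4)"
      using A p y disc_norm2[OF z(1)] dist_powr_pos[OF z(1), of "-1/4"] by (intro mult_mono) auto
    also have "(y\<^sup>2) powr (-1/4) = y powr (-1/2)" using y powr_powr[of y 2 "-1/4"] by (simp add: powr_numeral)
    also have "(2 * y) * y powr (-1/2) = 2 * y powr (1/2)"
      using y powr_add[of y 1 "-1/2"] by simp
    finally have "- r < 2 * sqrt y" using y by (simp add: powr_half_sqrt)
    then have "(- r)\<^sup>2 < (2 * sqrt y)\<^sup>2" using assms by (intro power_strict_mono) auto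
    then have "r\<^sup>2 < 4 * y" using y by (simp add: power_mult_distrib)
    then show "z \<in> cball 0 (1 - r\<^sup>2 / 4)" by (simp add: y_def field_simps)
  qed
  have "closure {z\<in>unit_disc. exh_fun z < r} \<subseteq> cball 0 (1 - r\<^sup>2 / 4)"
    by (rule closure_minimal[OF sub closed_cball])
  also have "cball 0 (1 - r\<^sup>2 / 4) \<subseteq> (unit_disc :: complex set)"
    using assms by (simp add: cball_subset_ball_iff)
  finally show "closure {z\<in>unit_disc. exh_fun z < r} \<subseteq> unit_disc" .
  show "compact (closure {z\<in>unit_disc. exh_fun z < r})"
    by (rule compact_closure_disc) auto
qed

lemma neg_subharmonic_exhaustion_exh_fun: "neg_subharmonic_exhaustion (\<lambda>z. ereal (exh_fun z))"
proof -
  have "subharmonic_on (\<lambda>z. ereal (exh_fun z)) unit_disc"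
    by (rule subharmonic_on_C2[OF D2_along_exh_fun]) (use Lap_exh_fun_ge in force)+
  moreover have "exhaustion (\<lambda>z. ereal (exh_fun z))"
    unfolding exhaustion_def sublevel_def using exh_fun_exhaustion by simp
  moreover have "continuous_on unit_disc (\<lambda>z. ereal (exh_fun z))"
    by (intro continuous_on_ereal exh.cont_u)
  ultimately show ?thesis using exh_fun_neg by (auto simp: neg_subharmonic_exhaustion_def simp del: mem_ball_0)
qed

section \<open>Slices of the sublevel sets of the exhaustion function are intervals\<close>

lemma convex_sublevel:
  fixes F :: "real \<Rightarrow> real"
  assumes "convex_on S F" "convex S"
  shows "convex {t\<in>S. F t < c}"
proof (rule convexI)
  fix x y a b :: real
  assume x: "x \<in> {t\<in>S. F t < c}" and y: "y \<in> {t\<in>S. F t < c}" and ab: "0 \<le> a" "0 \<le> b" "a + b = 1"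
  have S: "a *\<^sub>R x + b *\<^sub>R y \<in> S" using convexD[OF assms(2), of x y a b] x y ab by blast
  have "F (a *\<^sub>R x + b *\<^sub>R y) \<le> a * F x + b * F y"
    using assms(1) x y ab unfolding convex_on_def by blast
  also have "\<dots> < a * c + b * c"
  proof (cases "a = 0")
    case True then show ?thesis using y ab by simp
  next
    case False
    then have "a * F x < a * c" using x ab by simp
    moreover have "b * F y \<le> b * c" using y ab by (intro mult_left_mono) auto
    ultimately show ?thesis by linarith
  qed
  also have "\<dots> = c" using ab by (simp add: distrib_right[symmetric])
  finally show "a *\<^sub>R x + b *\<^sub>R y \<in> {t\<in>S. F t < c}" using S by simp
qed

text \<open>The expression is the second derivative of - ln A + (ln M) / 4. The last bracket can be
  negative, but not below -1 / (2 X^2) with X = 1 - t; as A \<le> 2 X, the first two terms are at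
  least 1 / X and t^2 / X^2.\<close>

lemma slice_second_derivative_nonneg:
  fixes t s :: real
  assumes "t\<^sup>2 + s\<^sup>2 < 1"
  defines "A \<equiv> 1 - t\<^sup>2 - s\<^sup>2" and "M \<equiv> (1 - t)\<^sup>2 + s\<^sup>2"
  shows "0 \<le> 2 / A + 4 * t\<^sup>2 / A\<^sup>2 + (1 / (2 * M) - (1 - t)\<^sup>2 / M\<^sup>2)"
proof -
  define X where "X = 1 - t"
  have "t\<^sup>2 < 1" using assms(1) zero_le_power2[of s] by linarith
  then have "\<bar>t\<bar> < 1" by (simp add: abs_square_less_1)
  then have X: "X > 0" by (simp add: X_def)
  have A: "A > 0" using assms(1) by (simp add: A_def)
  have "2 * X - A = X\<^sup>2 + s\<^sup>2" by (simp add: A_def X_def power2_eq_square algebra_simps)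
  then have AX: "A \<le> 2 * X" using sum_power2_ge_zero[of X s] by linarith
  have M: "M > 0" "M = X\<^sup>2 + s\<^sup>2" using X by (auto simp: M_def X_def add_pos_nonneg)
  have a: "1 / X \<le> 2 / A" using A AX X by (simp add: field_simps)
  have "A\<^sup>2 \<le> (2 * X)\<^sup>2" using A AX by (intro power_mono) auto
  then have b: "t\<^sup>2 / X\<^sup>2 \<le> 4 * t\<^sup>2 / A\<^sup>2"
    using A X mult_left_mono[of "A\<^sup>2" "4 * X\<^sup>2" "t\<^sup>2"] by (simp add: field_simps power_mult_distrib)
  have "X\<^sup>2 * (X\<^sup>2 - s\<^sup>2) \<le> M\<^sup>2"
    using zero_le_power2[of "X * s"] zero_le_power2[of "s\<^sup>2"] by (simp add: M(2) power2_eq_square algebra_simps)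
  then have "(X\<^sup>2 - s\<^sup>2) / (2 * M\<^sup>2) \<le> 1 / (2 * X\<^sup>2)" using X M(1) by (simp add: field_simps)
  moreover have "1 / (2 * M) - X\<^sup>2 / M\<^sup>2 = - ((X\<^sup>2 - s\<^sup>2) / (2 * M\<^sup>2))"
  proof -
    have "1 / (2 * M) = M / (2 * M\<^sup>2)" using M(1) by (simp add: power2_eq_square)
    then have "1 / (2 * M) - X\<^sup>2 / M\<^sup>2 = (M - 2 * X\<^sup>2) / (2 * M\<^sup>2)" by (simp add: diff_divide_distrib)
    also have "M - 2 * X\<^sup>2 = - (X\<^sup>2 - s\<^sup>2)" by (simp add: M(2))
    finally show ?thesis by (simp only: minus_divide_left)
  qed
  ultimately have c: "- (1 / (2 * X\<^sup>2)) \<le> 1 / (2 * M) - X\<^sup>2 / M\<^sup>2" by simp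
  \<comment> \<open>The sum of the three lower bounds over the common denominator X^2; its numerator
    is (t - 1/2)^2 + 1/4.\<close>
  have "0 \<le> X + t\<^sup>2 - 1/2" using zero_le_power2[of "t - 1/2"] by (simp add: X_def power2_eq_square algebra_simps)
  then have "0 \<le> (X + t\<^sup>2 - 1/2) / X\<^sup>2" by simp
  also have "\<dots> = 1 / X + t\<^sup>2 / X\<^sup>2 + - (1 / (2 * X\<^sup>2))" using X by (simp add: field_simps power2_eq_square)
  also have "\<dots> \<le> 2 / A + 4 * t\<^sup>2 / A\<^sup>2 + (1 / (2 * M) - X\<^sup>2 / M\<^sup>2)" by (intro add_mono a b c)
  finally show ?thesis by (simp add: X_def)
qed

text \<open>
  On horizontal lines \<open>- ln (- u)\<close> is convex; on vertical lines \<open>u\<close> increases with \<open>|Im z|\<close>.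
\<close>

lemma exh_fun_slice_convex:
  assumes b: "b \<in> Basis" and r: "r < 0"
  shows "convex {t. line_pt b s t \<in> unit_disc \<and> exh_fun (line_pt b s t) < r}"
proof (cases "b = 1")
  case True
  define S where "S = {t. line_pt b s t \<in> unit_disc}"
  define A where "A t = 1 - t\<^sup>2 - s\<^sup>2" for t
  define M where "M t = (1 - t)\<^sup>2 + s\<^sup>2" for t
  have S: "t \<in> S \<longleftrightarrow> t\<^sup>2 + s\<^sup>2 < 1" for t
    using norm_line_pt[OF b, of s t] abs_square_less_1[of "norm (line_pt b s t)"] by (simp add: S_def add.commute)
  have "convex S"
  proof -
    have "S = ball 0 (sqrt (1 - s\<^sup>2))"
    proof (rule set_eqI)
      fix t
      have "t\<^sup>2 < 1 - s\<^sup>2 \<longleftrightarrow> \<bar>t\<bar> < sqrt (1 - s\<^sup>2)"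
        using real_sqrt_less_iff[of "t\<^sup>2" "1 - s\<^sup>2"] by simp
      then show "t \<in> S \<longleftrightarrow> t \<in> ball 0 (sqrt (1 - s\<^sup>2))" by (simp add: S) linarith
    qed
    then show ?thesis by simp
  qed
  have AM: "A t > 0" "M t > 0" if "t \<in> S" for t
  proof -
    show "A t > 0" using that by (simp add: S A_def)
    have "\<bar>t\<bar> < 1" using that zero_le_power2[of s] abs_square_less_1[of t] unfolding S by linarith
    then show "M t > 0" by (auto simp: M_def intro!: add_pos_nonneg)
  qed
  have exh_fun: "exh_fun (line_pt b s t) = - A t * M t powr (-1/4)" for t
    by (simp add: exh_fun_def dist_powr_def True line_pt_1 A_def M_def cmod_power2 diff_diff_eq)
  have conv: "convex_on S (\<lambda>t. - ln (A t) + ln (M t) / 4)"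
  proof (rule f''_ge0_imp_convex[OF \<open>convex S\<close>])
    fix t assume t: "t \<in> S"
    note AMt = AM[OF t]
    have dA: "(A has_real_derivative (- 2 * t)) (at t)" unfolding A_def
      by (auto intro!: derivative_eq_intros)
    have dM: "(M has_real_derivative (- 2 * (1 - t))) (at t)" unfolding M_def
      by (auto intro!: derivative_eq_intros)
    show "((\<lambda>t. - ln (A t) + ln (M t) / 4) has_real_derivative (2 * t / A t - (1 - t) / (2 * M t))) (at t)"
      using AMt by (auto intro!: derivative_eq_intros dA dM simp: field_simps)
    show "((\<lambda>t. 2 * t / A t - (1 - t) / (2 * M t)) has_real_derivative
        (2 / A t + 4 * t\<^sup>2 / (A t)\<^sup>2 + (1 / (2 * M t) - (1 - t)\<^sup>2 / (M t)\<^sup>2))) (at t)"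
      using AMt by (auto intro!: derivative_eq_intros dA dM simp: field_simps power2_eq_square)
    show "0 \<le> 2 / A t + 4 * t\<^sup>2 / (A t)\<^sup>2 + (1 / (2 * M t) - (1 - t)\<^sup>2 / (M t)\<^sup>2)"
      unfolding A_def M_def using t by (intro slice_second_derivative_nonneg) (simp add: S)
  qed
  have "exh_fun (line_pt b s t) < r \<longleftrightarrow> - ln (A t) + ln (M t) / 4 < - ln (- r)" if "t \<in> S" for t
  proof -
    have "exh_fun (line_pt b s t) < r \<longleftrightarrow> - r < A t * M t powr (-1/4)" unfolding exh_fun by auto
    also have "\<dots> \<longleftrightarrow> ln (- r) < ln (A t * M t powr (-1/4))"
      using AM[OF that] r by (subst ln_less_cancel_iff) auto
    also have "ln (A t * M t powr (-1/4)) = ln (A t) - ln (M t) / 4"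
      using AM[OF that] by (simp add: ln_mult ln_powr)
    finally show ?thesis by auto
  qed
  then have "{t. line_pt b s t \<in> unit_disc \<and> exh_fun (line_pt b s t) < r} = {t\<in>S. - ln (A t) + ln (M t) / 4 < - ln (- r)}"
    by (auto simp: S_def simp del: mem_ball_0)
  then show ?thesis using convex_sublevel[OF conv \<open>convex S\<close>] by simp
next
  case False
  then have bi: "b = \<i>" using b by (auto simp: Basis_complex_def)
  let ?T = "{t. line_pt b s t \<in> unit_disc \<and> exh_fun (line_pt b s t) < r}"
  have mono: "t \<in> ?T" if t': "t' \<in> ?T" and le: "\<bar>t\<bar> \<le> \<bar>t'\<bar>" for t t'
  proof -
    have sq: "t\<^sup>2 \<le> t'\<^sup>2" using le by (simp add: abs_le_square_iff)
    have "(norm (line_pt b s t))\<^sup>2 \<le> (norm (line_pt b s t'))\<^sup>2" using sq by (simp add: norm_line_pt[OF b])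
    then have n: "norm (line_pt b s t) \<le> norm (line_pt b s t')" by (rule power2_le_imp_le) simp
    then have D: "line_pt b s t \<in> unit_disc" "line_pt b s t' \<in> unit_disc" using t' by auto
    have "(norm (1 - line_pt b s t))\<^sup>2 \<le> (norm (1 - line_pt b s t'))\<^sup>2"
      using sq by (simp add: bi line_pt_i cmod_power2)
    then have p: "dist_powr (-1/4) (line_pt b s t') \<le> dist_powr (-1/4) (line_pt b s t)" unfolding dist_powr_def
      using one_notin_disc[OF D(1)] by (intro powr_mono2') auto
    have "(1 - (norm (line_pt b s t'))\<^sup>2) * dist_powr (-1/4) (line_pt b s t') \<le> (1 - (norm (line_pt b s t))\<^sup>2) * dist_powr (-1/4) (line_pt b s t)"
      using n p disc_norm2[OF D(1)] dist_powr_pos[OF D(2), of "-1/4"] by (intro mult_mono) (auto intro: power_mono)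
    then have "exh_fun (line_pt b s t) \<le> exh_fun (line_pt b s t')" by (simp add: exh_fun_def algebra_simps)
    then show ?thesis using D(1) t' by auto
  qed
  have "is_interval ?T"
    unfolding is_interval_1
  proof (intro ballI allI impI)
    fix a c x assume a: "a \<in> ?T" and c: "c \<in> ?T" and x: "a \<le> x \<and> x \<le> c"
    have "\<bar>x\<bar> \<le> \<bar>a\<bar> \<or> \<bar>x\<bar> \<le> \<bar>c\<bar>" using x by linarith
    then show "x \<in> ?T" using mono[OF a] mono[OF c] by blast
  qed
  then show ?thesis by (simp add: is_interval_convex_1)
qed

text \<open>Since |1 - z| \<le> 2 and 1 - |z|^2 \<le> 2 |1 - z|, both summands of the Laplacian are
  multiples of at most |1 - z|^(-3/2), with factors 6 and 3/2. This power is integrable in the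
  plane.\<close>

lemma Lap_exh_fun_le:
  assumes "z \<in> unit_disc"
  shows "(\<Sum>b\<in>Basis. exh_fun2 b z) \<le> 8 * dist_powr (-3/4) z"
proof -
  define m where "m = norm (1 - z)"
  have m: "m > 0" using one_notin_disc[OF assms] by (simp add: m_def)
  have m2: "m \<le> 2" using assms norm_triangle_ineq4[of 1 z] by (simp add: m_def)
  have h: "dist_powr (1/2) z = m" using m by (simp add: dist_powr_def m_def[symmetric] powr_half_sqrt)
  have "dist_powr (-1/4) z = dist_powr (1/2) z * dist_powr (-3/4) z" by (simp add: dist_powr_mult)
  then have 1: "dist_powr (-1/4) z \<le> 2 * dist_powr (-3/4) z"
    using m2 dist_powr_pos[OF assms, of "-3/4"] unfolding h by (simp add: mult_right_mono)
  have "1 - norm z \<le> m" using norm_triangle_ineq2[of 1 z] by (simp add: m_def)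
  then have "(1 - norm z) * (1 + norm z) \<le> m * 2" using assms m by (intro mult_mono) auto
  then have "(1 - (norm z)\<^sup>2) \<le> 2 * m" by (simp add: power2_eq_square algebra_simps)
  then have "(1 - (norm z)\<^sup>2) * dist_powr (-5/4) z \<le> (2 * dist_powr (1/2) z) * dist_powr (-5/4) z"
    using dist_powr_pos[OF assms, of "-5/4"] unfolding h by (intro mult_right_mono) auto
  also have "\<dots> = 2 * dist_powr (-3/4) z" by (simp add: mult.assoc dist_powr_mult)
  finally have 2: "(1 - (norm z)\<^sup>2) * dist_powr (-5/4) z \<le> 2 * dist_powr (-3/4) z" .
  show ?thesis unfolding Lap_exh_fun[OF assms] mult.assoc using 1 2 dist_powr_pos[OF assms, of "-3/4"] by linarith
qed

lemma nn_integral_abs_powr_finite: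
  "(\<integral>\<^sup>+s. indicator {-2..2} s * ennreal (\<bar>s\<bar> powr (-3/4)) \<partial>lborel) < \<infinity>"
proof -
  let ?f = "\<lambda>s::real. indicator {0..2} s * ennreal (\<bar>s\<bar> powr (-3/4))"
  have "(\<lambda>x. x powr (-3/4)) integrable_on {0..2::real}"
    by (rule integrable_on_powr_from_0) auto
  then have "(\<lambda>x. \<bar>x\<bar> powr (-3/4)) integrable_on {0..2::real}"
    by (rule integrable_eq) auto
  then obtain I where "((\<lambda>x. \<bar>x\<bar> powr (-3/4)) has_integral I) {0..2::real}" by blast
  then have "(\<integral>\<^sup>+x. ennreal (indicator {0..2} x * (\<bar>x\<bar> powr (-3/4))) \<partial>lborel) = ennreal I"
    by (intro nn_integral_has_integral_lebesgue) auto
  then have "(\<integral>\<^sup>+x. ennreal (indicator {0..2} x * (\<bar>x\<bar> powr (-3/4))) \<partial>lborel) < \<infinity>"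
    by simp
  moreover have "ennreal (indicator {0..2} x * (\<bar>x\<bar> powr (-3/4))) = ?f x" for x
    by (simp add: indicator_def)
  ultimately have fin: "(\<integral>\<^sup>+x. ?f x \<partial>lborel) < \<infinity>" by simp
  have "(\<integral>\<^sup>+x. ?f x \<partial>lborel) = (\<integral>\<^sup>+x. ?f (- x) \<partial>lborel)"
    using nn_integral_real_affine[of ?f "-1" 0] by simp
  then have fin2: "(\<integral>\<^sup>+x. ?f (- x) \<partial>lborel) < \<infinity>" using fin by simp
  have "(\<integral>\<^sup>+s. indicator {-2..2} s * ennreal (\<bar>s\<bar> powr (-3/4)) \<partial>lborel) \<le> (\<integral>\<^sup>+s. ?f s + ?f (- s) \<partial>lborel)"
    by (rule nn_integral_mono) (auto simp: indicator_def)
  also have "\<dots> = (\<integral>\<^sup>+s. ?f s \<partial>lborel) + (\<integral>\<^sup>+s. ?f (- s) \<partial>lborel)"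
    by (rule nn_integral_add) auto
  also have "\<dots> < \<infinity>" using fin fin2 by simp
  finally show ?thesis .
qed

text \<open>Instead of polar coordinates at 1, the power |1 - z|^(-3/2) is bounded by the product of
  the powers -3/4 of the two coordinate distances, each integrable on an interval.\<close>

lemma exh_fun_finite_mass: "emeasure (exh.Riesz UNIV) unit_disc < \<infinity>"
proof -
  define k where "k s = indicator {-2..2} s * ennreal (\<bar>s\<bar> powr (-3/4))" for s :: real
  have km[measurable]: "k \<in> borel_measurable borel" unfolding k_def by measurable
  define W where "W = (\<integral>\<^sup>+s. k s \<partial>lborel)"
  have W: "W < \<infinity>" using nn_integral_abs_powr_finite by (simp add: W_def k_def)
  define f where "f z = indicator unit_disc z * ennreal (exh.Lap z / (2 * pi))" for z
  have fm: "f \<in> borel_measurable borel"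
  proof -
    have "(\<lambda>z. indicator unit_disc z *\<^sub>R (exh.Lap z / (2 * pi))) \<in> borel_measurable borel"
      by (rule borel_measurable_continuous_on_indicator) (auto intro!: continuous_intros exh.cont_Lap)
    then have "(\<lambda>z. ennreal (indicator unit_disc z *\<^sub>R (exh.Lap z / (2 * pi)))) \<in> borel_measurable borel" by measurable
    moreover have "(\<lambda>z. ennreal (indicator unit_disc z *\<^sub>R (exh.Lap z / (2 * pi)))) = f"
      by (auto simp: f_def fun_eq_iff indicator_def)
    ultimately show ?thesis by simp
  qed
  have one: "(1::complex) \<in> Basis" by (simp add: Basis_complex_def)
  \<comment> \<open>For \<open>s = 0\<close> the bound fails, because \<open>0 powr a\<close> is 0
    and so \<open>k 0\<close> is 0; this is a null set of slices.\<close>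
  have le: "f (line_pt 1 s t) \<le> 8 * (k s * k (1 - t))" if "s \<noteq> 0" for s t
  proof (cases "line_pt 1 s t \<in> unit_disc")
    case False then show ?thesis by (simp add: f_def)
  next
    case True
    define m where "m = (norm (1 - line_pt 1 s t))\<^sup>2"
    have mm: "m = (1 - t)\<^sup>2 + s\<^sup>2" by (simp add: m_def line_pt_1 cmod_power2)
    have b: "\<bar>s\<bar> < 1" "\<bar>t\<bar> < 1" using abs_le_norm_line_pt[OF one, of s t] abs_le_norm_line_pt[OF one, of t s] True
      by (auto intro: le_less_trans)
    \<comment> \<open>\<open>m\<close> is |1 - z|^2, and its power -3/4 is split evenly: each
      coordinate alone bounds one factor \<open>m powr (-3/8)\<close>.\<close>
    have "m powr (-3/8) \<le> (s\<^sup>2) powr (-3/8)" "m powr (-3/8) \<le> ((1 - t)\<^sup>2) powr (-3/8)"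
      using that b by (auto intro!: powr_mono2' simp: mm)
    moreover have "(x\<^sup>2) powr (-3/8) = \<bar>x\<bar> powr (-3/4)" if "x \<noteq> 0" for x :: real
      using that powr_powr[of "\<bar>x\<bar>" 2 "-3/8"] by (simp add: powr_numeral)
    ultimately have "m powr (-3/8) * m powr (-3/8) \<le> \<bar>s\<bar> powr (-3/4) * \<bar>1 - t\<bar> powr (-3/4)"
      using that b by (intro mult_mono) auto
    then have "dist_powr (-3/4) (line_pt 1 s t) \<le> \<bar>s\<bar> powr (-3/4) * \<bar>1 - t\<bar> powr (-3/4)"
      by (simp add: dist_powr_def m_def powr_add[symmetric])
    moreover have "exh.Lap (line_pt 1 s t) / (2 * pi) \<le> exh.Lap (line_pt 1 s t)"
      using exh.Lap_ge_0[OF True] pi_gt3 by (simp add: divide_le_eq mult_left_le_one_le) (simp add: mult_le_cancel_left1)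
    ultimately have "exh.Lap (line_pt 1 s t) / (2 * pi) \<le> 8 * (\<bar>s\<bar> powr (-3/4) * \<bar>1 - t\<bar> powr (-3/4))"
      using Lap_exh_fun_le[OF True] unfolding exh.Lap_def by linarith
    then have "f (line_pt 1 s t) \<le> ennreal (8 * (\<bar>s\<bar> powr (-3/4) * \<bar>1 - t\<bar> powr (-3/4)))"
      using True by (simp add: f_def ennreal_leI del: mem_ball_0)
    also have "\<dots> = ennreal 8 * (ennreal (\<bar>s\<bar> powr (-3/4)) * ennreal (\<bar>1 - t\<bar> powr (-3/4)))"
      by (simp only: ennreal_mult powr_ge_zero mult_nonneg_nonneg zero_le_numeral)
    also have "\<dots> = 8 * (k s * k (1 - t))" using b by (auto simp: k_def indicator_def)
    finally show ?thesis .
  qed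
  have "emeasure (exh.Riesz UNIV) unit_disc = (\<integral>\<^sup>+z. f z \<partial>lborel)"
    using sets.top[of borel_disc] by (subst exh.emeasure_Riesz) (simp_all add: f_def[abs_def])
  also have "\<dots> = (\<integral>\<^sup>+s. \<integral>\<^sup>+t. f (line_pt 1 s t) \<partial>lborel \<partial>lborel)" by (rule nn_integral_line_pt[OF one fm])
  also have "\<dots> \<le> (\<integral>\<^sup>+s. 8 * (k s * W) \<partial>lborel)"
  proof (rule nn_integral_mono_AE)
    show "AE s in lborel. (\<integral>\<^sup>+t. f (line_pt 1 s t) \<partial>lborel) \<le> 8 * (k s * W)"
      using AE_lborel_singleton[of 0]
    proof eventually_elim
      fix s :: real assume "s \<noteq> 0"
      then have "(\<integral>\<^sup>+t. f (line_pt 1 s t) \<partial>lborel) \<le> (\<integral>\<^sup>+t. 8 * k s * k (1 - t) \<partial>lborel)"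
        by (intro nn_integral_mono) (use le in \<open>simp add: mult.assoc\<close>)
      also have "\<dots> = 8 * k s * (\<integral>\<^sup>+t. k (1 - t) \<partial>lborel)"
        by (rule nn_integral_cmult) simp
      also have "(\<integral>\<^sup>+t. k (1 - t) \<partial>lborel) = W"
        using nn_integral_real_affine[of k "-1" 1] by (simp add: W_def)
      finally show "(\<integral>\<^sup>+t. f (line_pt 1 s t) \<partial>lborel) \<le> 8 * (k s * W)" by (simp add: mult.assoc)
    qed
  qed
  also have "\<dots> = 8 * (W * W)"
    by (simp add: nn_integral_cmult nn_integral_multc W_def)
  also have "\<dots> < \<infinity>" using W by (simp add: ennreal_mult_less_top)
  finally show ?thesis .
qed

section \<open>Membership in the weighted space forces a harmonic majorant\<close>

lemma D2_along_power2:
  assumes "D2_along b f f1 f2 S"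
  shows "D2_along b (\<lambda>z. (f z)\<^sup>2) (\<lambda>z. 2 * f z * f1 z) (\<lambda>z. 2 * (f1 z)\<^sup>2 + 2 * f z * f2 z) S"
  unfolding D2_along_def
proof (intro conjI ballI)
  fix z assume "z \<in> S"
  then have d: "((\<lambda>t. f (z + of_real t * b)) has_real_derivative f1 z) (at 0)"
    "((\<lambda>t. f1 (z + of_real t * b)) has_real_derivative f2 z) (at 0)"
    using assms unfolding D2_along_def by blast+
  show "((\<lambda>t. (f (z + of_real t * b))\<^sup>2) has_real_derivative 2 * f z * f1 z) (at 0)"
    by (rule DERIV_cong[OF DERIV_power[OF d(1)]]) simp
  show "((\<lambda>t. 2 * f (z + of_real t * b) * f1 (z + of_real t * b)) has_real_derivative 2 * (f1 z)\<^sup>2 + 2 * f z * f2 z) (at 0)"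
    by (rule DERIV_cong[OF DERIV_mult[OF DERIV_cmult[OF d(1)] d(2)]]) (simp add: power2_eq_square algebra_simps)
qed (intro continuous_intros D2_along_cont[OF assms])+

lemma D2_along_powr:
  assumes s: "D2_along b s s1 s2 S" and pos: "\<And>z. z \<in> S \<Longrightarrow> 0 < s z"
  shows "D2_along b (\<lambda>z. s z powr a) (\<lambda>z. a * s z powr (a - 1) * s1 z)
    (\<lambda>z. a * (a - 1) * s z powr (a - 2) * (s1 z)\<^sup>2 + a * s z powr (a - 1) * s2 z) S"
proof -
  have p: "((\<lambda>t. s (z + of_real t * b) powr c) has_real_derivative c * s z powr (c - 1) * s1 z) (at 0)"
    and d: "((\<lambda>t. s1 (z + of_real t * b)) has_real_derivative s2 z) (at 0)" if z: "z \<in> S" for z c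
  proof -
    have d: "((\<lambda>t. s (z + of_real t * b)) has_real_derivative s1 z) (at 0)"
      "((\<lambda>t. s1 (z + of_real t * b)) has_real_derivative s2 z) (at 0)"
      using s z unfolding D2_along_def by blast+
    have "((\<lambda>x. x powr c) has_real_derivative c * s z powr (c - 1)) (at (s (z + of_real 0 * b)))"
      using has_real_derivative_powr[OF pos[OF z], of c] by simp
    from DERIV_chain2[OF this d(1)]
    show "((\<lambda>t. s (z + of_real t * b) powr c) has_real_derivative c * s z powr (c - 1) * s1 z) (at 0)" .
    show "((\<lambda>t. s1 (z + of_real t * b)) has_real_derivative s2 z) (at 0)" by (rule d(2))
  qed
  have 2: "((\<lambda>t. a * s (z + of_real t * b) powr (a - 1) * s1 (z + of_real t * b)) has_real_derivative
     a * (a - 1) * s z powr (a - 2) * (s1 z)\<^sup>2 + a * s z powr (a - 1) * s2 z) (at 0)" if z: "z \<in> S" for z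
    by (rule DERIV_cong[OF DERIV_mult[OF DERIV_cmult[OF p[OF z, of "a - 1"]] d[OF z]]])
       (simp add: power2_eq_square algebra_simps)
  have c: "continuous_on S (\<lambda>z. s z powr c)" for c
  proof (rule continuous_on_powr[OF D2_along_cont(1)[OF s] continuous_on_const])
    show "\<forall>z\<in>S. s z \<noteq> 0" using pos by force
  qed
  show ?thesis unfolding D2_along_def
  proof (intro conjI ballI)
    show "continuous_on S (\<lambda>z. s z powr a)" by (rule c)
    show "continuous_on S (\<lambda>z. a * s z powr (a - 1) * s1 z)"
      by (intro continuous_on_mult continuous_on_const c D2_along_cont(2)[OF s])
    show "continuous_on S (\<lambda>z. a * (a - 1) * s z powr (a - 2) * (s1 z)\<^sup>2 + a * s z powr (a - 1) * s2 z)"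
      by (intro continuous_on_add continuous_on_mult continuous_on_const continuous_on_power c D2_along_cont(2,3)[OF s])
  qed (fact p(1) 2)+
qed

text \<open>The summand 1 keeps the base positive, so the power is twice differentiable even at
  zeros of \<open>f\<close> and for small exponents. With m = |f|^2 and n = |f'|^2 the Laplacian is
  4 a n (m + 1)^(a - 2) (a m + 1).\<close>

lemma psi_subharmonic:
  assumes f: "f holomorphic_on unit_disc" and a: "a > 0"
  obtains \<psi>1 \<psi>2 where "\<And>b. b \<in> Basis \<Longrightarrow> D2_along b (\<lambda>z. ((norm (f z))\<^sup>2 + 1) powr a) (\<psi>1 b) (\<psi>2 b) unit_disc"
    "\<And>z. z \<in> unit_disc \<Longrightarrow> 0 \<le> (\<Sum>b\<in>Basis. \<psi>2 b z)"
proof -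
  \<comment> \<open>The imaginary part of \<open>f\<close> is written as
    \<open>Re (- \<i> * f z)\<close>, so that the rules for real parts cover both squares.\<close>
  define s where "s z = (Re (f z))\<^sup>2 + (Re (- \<i> * f z))\<^sup>2 + 1" for z
  have seq: "s z = (norm (f z))\<^sup>2 + 1" for z by (simp add: s_def cmod_power2)
  have spos: "s z > 0" for z by (simp add: seq add_nonneg_pos)
  define s1 where "s1 b z = 2 * Re (f z) * Re (deriv f z * b) + 2 * Re (- \<i> * f z) * Re (- \<i> * deriv f z * b)" for b z
  define s2 where "s2 b z = 2 * (Re (deriv f z * b))\<^sup>2 + 2 * Re (f z) * Re (deriv (deriv f) z * b * b)
      + (2 * (Re (- \<i> * deriv f z * b))\<^sup>2 + 2 * Re (- \<i> * f z) * Re (- \<i> * deriv (deriv f) z * b * b))" for b z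
  have hi: "(\<lambda>z. - \<i> * f z) holomorphic_on unit_disc" using f by (intro holomorphic_intros)
  have f': "deriv f holomorphic_on unit_disc" by (rule holomorphic_deriv[OF f open_ball])
  have d1: "deriv (\<lambda>z. - \<i> * f z) z = - \<i> * deriv f z" if "z \<in> unit_disc" for z
    by (rule deriv_cmult[OF holomorphic_on_imp_differentiable_at[OF f open_ball that]])
  have d2: "deriv (deriv (\<lambda>z. - \<i> * f z)) z = - \<i> * deriv (deriv f) z" if z: "z \<in> unit_disc" for z
  proof -
    have "deriv (deriv (\<lambda>z. - \<i> * f z)) z = deriv (\<lambda>z. - \<i> * deriv f z) z"
    proof (rule deriv_cong_ev[OF _ refl])
      show "\<forall>\<^sub>F x in nhds z. deriv (\<lambda>z. - \<i> * f z) x = - \<i> * deriv f x"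
        using eventually_nhds_in_open[OF open_ball z] by (rule eventually_mono) (rule d1)
    qed
    also have "\<dots> = - \<i> * deriv (deriv f) z"
      by (rule deriv_cmult[OF holomorphic_on_imp_differentiable_at[OF f' open_ball z]])
    finally show ?thesis .
  qed
  have D2s: "D2_along b s (s1 b) (s2 b) unit_disc" for b
  proof -
    have "D2_along b (\<lambda>z. Re (- \<i> * f z)) (\<lambda>z. Re (- \<i> * deriv f z * b)) (\<lambda>z. Re (- \<i> * deriv (deriv f) z * b * b)) unit_disc"
    proof -
      note D = D2_along_Re[OF hi open_ball, of b]
      have c: "continuous_on unit_disc (\<lambda>z. Re (- \<i> * deriv f z * b))"
        "continuous_on unit_disc (\<lambda>z. Re (- \<i> * deriv (deriv f) z * b * b))"
        using holomorphic_on_imp_continuous_on[OF f'] holomorphic_on_imp_continuous_on[OF holomorphic_deriv[OF f' open_ball]]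
        by (auto intro!: continuous_intros)
      show ?thesis unfolding D2_along_def
      proof (intro conjI ballI c)
        show "continuous_on unit_disc (\<lambda>z. Re (- \<i> * f z))" by (rule D2_along_cont(1)[OF D])
        fix z assume z: "z \<in> unit_disc"
        show "((\<lambda>t. Re (- \<i> * f (z + of_real t * b))) has_real_derivative Re (- \<i> * deriv f z * b)) (at 0)"
          using has_real_derivative_Re_line[OF hi open_ball z, of b] unfolding d1[OF z] .
        have h2: "(\<lambda>z. - \<i> * deriv f z * b) holomorphic_on unit_disc"
          by (intro holomorphic_on_mult holomorphic_on_const f')
        have "deriv (\<lambda>z. - \<i> * deriv f z * b) z = - \<i> * deriv (deriv f) z * b"
        proof -
          have fd: "(\<lambda>z. - \<i> * deriv f z) field_differentiable at z"
            by (rule holomorphic_on_imp_differentiable_at[OF holomorphic_on_mult[OF holomorphic_on_const f'] open_ball z])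
          have "deriv (\<lambda>z. - \<i> * deriv f z * b) z = deriv (\<lambda>z. - \<i> * deriv f z) z * b"
            by (rule deriv_cmult_right[OF fd])
          also have "deriv (\<lambda>z. - \<i> * deriv f z) z = - \<i> * deriv (deriv f) z"
            by (rule deriv_cmult[OF holomorphic_on_imp_differentiable_at[OF f' open_ball z]])
          finally show ?thesis .
        qed
        then show "((\<lambda>t. Re (- \<i> * deriv f (z + of_real t * b) * b)) has_real_derivative Re (- \<i> * deriv (deriv f) z * b * b)) (at 0)"
          using has_real_derivative_Re_line[OF h2 open_ball z, of b] by simp
      qed
    qed
    from D2_along_add[OF D2_along_add[OF D2_along_power2[OF D2_along_Re[OF f open_ball]] D2_along_power2[OF this]] D2_along_const, of 1]
    show ?thesis unfolding s_def s1_def s2_def by simp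
  qed
  let ?\<psi>2 = "\<lambda>b z. a * (a - 1) * s z powr (a - 2) * (s1 b z)\<^sup>2 + a * s z powr (a - 1) * s2 b z"
  show ?thesis
  proof (rule that)
    show "D2_along b (\<lambda>z. ((norm (f z))\<^sup>2 + 1) powr a) (\<lambda>z. a * s z powr (a - 1) * s1 b z) (?\<psi>2 b) unit_disc" for b
      using D2_along_powr[OF D2s spos, of b a] unfolding seq .
    fix z :: complex assume "z \<in> unit_disc"
    define m where "m = (norm (f z))\<^sup>2"
    define n where "n = (norm (deriv f z))\<^sup>2"
    have S1: "(s1 1 z)\<^sup>2 + (s1 \<i> z)\<^sup>2 = 4 * m * n"
      unfolding s1_def m_def n_def cmod_power2 by (simp add: power2_eq_square algebra_simps)
    have S2: "s2 1 z + s2 \<i> z = 4 * n"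
      unfolding s2_def n_def cmod_power2 by (simp add: power2_eq_square algebra_simps)
    have dist_powr: "(m + 1) powr (a - 1) = (m + 1) powr (a - 2) * (m + 1)"
      using powr_add[of "m + 1" "a - 2" 1] by (simp add: m_def add_nonneg_pos)
    have "(\<Sum>b\<in>Basis. ?\<psi>2 b z) = a * (a - 1) * s z powr (a - 2) * ((s1 1 z)\<^sup>2 + (s1 \<i> z)\<^sup>2) + a * s z powr (a - 1) * (s2 1 z + s2 \<i> z)"
      unfolding sum_Basis_complex by (simp add: algebra_simps)
    also have "\<dots> = 4 * a * n * s z powr (a - 2) * (a * m + 1)"
      unfolding S1 S2 seq m_def[symmetric] dist_powr by (simp add: algebra_simps)
    also have "\<dots> \<ge> 0" using a by (intro mult_nonneg_nonneg) (auto simp: m_def n_def)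
    finally show "0 \<le> (\<Sum>b\<in>Basis. ?\<psi>2 b z)" .
  qed
qed

section \<open>Level measures of the exhaustion function and uniform bounds\<close>

definition exh_level :: "real \<Rightarrow> complex measure"
  where "exh_level r = level_measure (\<lambda>z. ereal (exh_fun z)) r"

lemma exh_level_props:
  assumes "r < 0"
  shows "sets (exh_level r) = sets borel_disc" "emeasure (exh_level r) unit_disc < \<infinity>"
    "emeasure (exh_level r) (unit_disc - {z\<in>unit_disc. exh_fun z = r}) = 0"
    "\<And>\<psi> \<psi>1 \<psi>2. (\<And>b. b \<in> Basis \<Longrightarrow> D2_along b \<psi> (\<psi>1 b) (\<psi>2 b) unit_disc) \<Longrightarrow> integrable (exh_level r) \<psi> \<and>
       (LINT z|exh_level r. \<psi> z) = 1 / (2 * pi) * (LINT z|lborel. indicator {z\<in>unit_disc. exh_fun z < r} z *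
          (\<psi> z * exh.Lap z + (r - exh_fun z) * (\<Sum>b\<in>Basis. \<psi>2 b z)))"
  unfolding exh_level_def using exh.level_measure_props[OF exh_fun_exhaustion(1)[OF assms] exh_fun_slice_convex[OF _ assms] exh_fun_finite_mass]
  by blast+

text \<open>The level measure has no mass off the level set, so the restriction of the integral in
  the definition of the weighted space changes nothing. Integrals over the whole disc are what the
  Lelong-Jensen formula handles.\<close>

lemma nn_integral_level:
  assumes r: "r < 0" and h: "h \<in> borel_measurable (exh_level r)"
  shows "(\<integral>\<^sup>+z\<in>level (\<lambda>z. ereal (exh_fun z)) r. h z \<partial>level_measure (\<lambda>z. ereal (exh_fun z)) r) = (\<integral>\<^sup>+z. h z \<partial>exh_level r)"
proof -
  note L = exh_level_props[OF r]
  have sp: "space (exh_level r) = unit_disc" using sets_eq_imp_space_eq[OF L(1)] by simp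
  have "unit_disc - {z\<in>unit_disc. exh_fun z = r} \<in> sets (exh_level r)"
    by (rule level_complement_sets[OF exh.cont_u L(1)])
  then have "unit_disc - {z\<in>unit_disc. exh_fun z = r} \<in> null_sets (exh_level r)" using L(3) by (simp add: null_sets_def)
  then have "AE z in exh_level r. z \<in> level (\<lambda>z. ereal (exh_fun z)) r"
    by (rule AE_I') (auto simp: level_def sp simp del: mem_ball_0)
  then have "AE z in exh_level r. h z * indicator (level (\<lambda>z. ereal (exh_fun z)) r) z = h z"
    by (rule AE_mp) (auto simp: indicator_def)
  then show ?thesis unfolding exh_level_def[symmetric] by (rule nn_integral_cong_AE)
qed

lemma Hardy_exhE:
  assumes "f \<in> Hardy_exh (\<lambda>z. ereal (exh_fun z)) p"
  obtains C where "0 \<le> C" "\<forall>\<^sub>F r in at_left 0. r < 0 \<and> (\<integral>\<^sup>+z. ennreal (norm (f z) powr p) \<partial>exh_level r) \<le> ennreal C"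
proof -
  let ?I = "\<lambda>r. \<integral>\<^sup>+z\<in>level (\<lambda>z. ereal (exh_fun z)) r. ennreal (norm (f z) powr p) \<partial>level_measure (\<lambda>z. ereal (exh_fun z)) r"
  have f: "f holomorphic_on unit_disc" and L: "Limsup (at_left 0) ?I < \<infinity>"
    using assms by (auto simp: Hardy_exh_def)
  obtain C where C: "Limsup (at_left 0) ?I < C" "C < \<infinity>" using dense[OF L] by blast
  have ev: "\<forall>\<^sub>F r in at_left 0. ?I r < C" by (rule Limsup_lessD[OF C(1)])
  have neg: "\<forall>\<^sub>F r in at_left (0::real). r < 0" by (simp add: eventually_at_filter)
  show ?thesis
  proof (rule that[of "enn2real C"])
    show "\<forall>\<^sub>F r in at_left 0. r < 0 \<and> (\<integral>\<^sup>+z. ennreal (norm (f z) powr p) \<partial>exh_level r) \<le> ennreal (enn2real C)"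
      using ev neg
    proof eventually_elim
      case (elim r)
      have fm: "f \<in> borel_measurable (exh_level r)"
        by (rule borel_measurable_disc[OF holomorphic_on_imp_continuous_on[OF f] exh_level_props(1)[OF elim(2)]])
      have "(\<lambda>z. ennreal (norm (f z) powr p)) \<in> borel_measurable (exh_level r)" using fm by measurable
      from nn_integral_level[OF elim(2) this] show ?case using elim C(2) by (simp add: less_imp_le)
    qed
  qed simp
qed

lemma integrable_Lap: "integrable lborel (\<lambda>z. indicator unit_disc z * exh.Lap z)"
proof -
  have m: "(\<lambda>z. indicator unit_disc z *\<^sub>R exh.Lap z) \<in> borel_measurable borel"
    by (rule borel_measurable_continuous_on_indicator) (auto intro!: exh.cont_Lap)
  have "(\<integral>\<^sup>+z. ennreal (norm (indicator unit_disc z * exh.Lap z)) \<partial>lborel)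
     = (\<integral>\<^sup>+z. ennreal (2 * pi) * (indicator unit_disc z * ennreal (exh.Lap z / (2 * pi))) \<partial>lborel)"
  proof (rule nn_integral_cong)
    fix z
    show "ennreal (norm (indicator unit_disc z * exh.Lap z)) = ennreal (2 * pi) * (indicator unit_disc z * ennreal (exh.Lap z / (2 * pi)))"
      using exh.Lap_ge_0[of z] by (cases "z \<in> unit_disc") (simp_all add: ennreal_mult[symmetric] del: mem_ball_0)
  qed
  also have "\<dots> = ennreal (2 * pi) * emeasure (exh.Riesz UNIV) unit_disc"
  proof -
    have "(\<lambda>z. ennreal (indicator unit_disc z *\<^sub>R exh.Lap z / (2 * pi))) \<in> borel_measurable borel" using m by measurable
    moreover have "(\<lambda>z. ennreal (indicator unit_disc z *\<^sub>R exh.Lap z / (2 * pi))) = (\<lambda>z. indicator unit_disc z * ennreal (exh.Lap z / (2 * pi)))"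
      by (auto simp: fun_eq_iff indicator_def)
    ultimately have "(\<lambda>z. indicator unit_disc z * ennreal (exh.Lap z / (2 * pi))) \<in> borel_measurable lborel" by simp
    then show ?thesis using sets.top[of borel_disc] by (simp add: nn_integral_cmult exh.emeasure_Riesz)
  qed
  also have "\<dots> < \<infinity>" using exh_fun_finite_mass by (simp add: ennreal_mult_less_top)
  finally show ?thesis using m by (simp add: integrable_iff_bounded)
qed

lemma exh_fun_sublevel_sets: "{z\<in>unit_disc. exh_fun z < r} \<in> sets borel"
  using open_sublevel[OF exh.cont_u] by simp

text \<open>Lelong-Jensen for the constant 1: the mass of the level measure is the Riesz mass of the
  sublevel set, hence at most the finite total mass. It controls the summand 1 by which |f|^p is
  regularised.\<close>

lemma exh_level_total_bounded:
  obtains C where "\<And>r. r < 0 \<Longrightarrow> emeasure (exh_level r) unit_disc \<le> ennreal C" "0 \<le> C"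
proof (rule that)
  fix r :: real assume r: "r < 0"
  note L = exh_level_props[OF r]
  let ?B = "{z\<in>unit_disc. exh_fun z < r}"
  have sp: "space (exh_level r) = unit_disc" using sets_eq_imp_space_eq[OF L(1)] by simp
  have "(LINT z|exh_level r. 1) = 1 / (2 * pi) * (LINT z|lborel. indicator ?B z * (1 * exh.Lap z + (r - exh_fun z) * (\<Sum>b\<in>(Basis::complex set). 0)))"
    by (rule L(4)[THEN conjunct2]) (rule D2_along_const)
  also have "\<dots> \<le> 1 / (2 * pi) * (LINT z|lborel. indicator unit_disc z * exh.Lap z)"
  proof (intro mult_left_mono integral_mono integrable_Lap)
    show "integrable lborel (\<lambda>z. indicator ?B z * (1 * exh.Lap z + (r - exh_fun z) * (\<Sum>b\<in>(Basis::complex set). 0)))"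
      by (rule integrable_indicator_disc[OF exh_fun_sublevel_sets exh_fun_exhaustion(1)[OF r]]) (simp add: exh.cont_Lap)
    fix z
    show "indicator ?B z * (1 * exh.Lap z + (r - exh_fun z) * (\<Sum>b\<in>(Basis::complex set). 0)) \<le> indicator unit_disc z * exh.Lap z"
      using exh.Lap_ge_0[of z] by (cases "z \<in> unit_disc") (auto simp: indicator_def simp del: mem_ball_0)
  qed simp
  finally have le: "measure (exh_level r) unit_disc \<le> 1 / (2 * pi) * (LINT z|lborel. indicator unit_disc z * exh.Lap z)"
    by (simp add: sp)
  have "emeasure (exh_level r) unit_disc = ennreal (measure (exh_level r) unit_disc)"
    using L(2) by (intro emeasure_eq_ennreal_measure) auto
  then show "emeasure (exh_level r) unit_disc \<le> ennreal (1 / (2 * pi) * (LINT z|lborel. indicator unit_disc z * exh.Lap z))"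
    using le by (simp only: ennreal_leI)
next
  have "0 \<le> indicator unit_disc z * exh.Lap z" for z
    using exh.Lap_ge_0[of z] by (cases "z \<in> unit_disc") (simp_all del: mem_ball_0)
  then have "0 \<le> (LINT z|lborel. indicator unit_disc z * exh.Lap z)"
    by (intro integral_nonneg_AE AE_I2)
  then show "0 \<le> 1 / (2 * pi) * (LINT z|lborel. indicator unit_disc z * exh.Lap z)" by simp
qed

text \<open>On the ball of radius \<open>R\<close> the Laplacian of u is at least 3/4 and, for r
  close enough to 0, r - u is at least (R^2 - |z|^2) / 4. Both terms of the Lelong-Jensen formula
  thus dominate, up to a factor 4, those of the corresponding formula for |z|^2.\<close>

lemma psi_bound:
  fixes f :: "complex \<Rightarrow> complex"
  assumes p: "p > 0" and f: "f \<in> Hardy_exh (\<lambda>z. ereal (exh_fun z)) p"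
    and \<psi>: "\<And>b. b \<in> Basis \<Longrightarrow> D2_along b (\<lambda>z. ((norm (f z))\<^sup>2 + 1) powr (p / 2)) (\<psi>1 b) (\<psi>2 b) unit_disc"
    and sub: "\<And>z. z \<in> unit_disc \<Longrightarrow> 0 \<le> (\<Sum>b\<in>Basis. \<psi>2 b z)"
  shows "\<exists>C. \<forall>R. 0 < R \<longrightarrow> R < 1 \<longrightarrow> (LINT z|lborel. indicator (ball 0 R) z *
      (((norm (f z))\<^sup>2 + 1) powr (p / 2) + (R\<^sup>2 - (norm z)\<^sup>2) * (\<Sum>b\<in>Basis. \<psi>2 b z))) \<le> C"
proof -
  define \<psi> where "\<psi> z = ((norm (f z))\<^sup>2 + 1) powr (p / 2)" for z
  define L\<psi> where "L\<psi> z = (\<Sum>b\<in>Basis. \<psi>2 b z)" for z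
  note \<psi>D = \<psi>[folded \<psi>_def]
  have one: "(1::complex) \<in> Basis" by (simp add: Basis_complex_def)
  have \<psi>c: "continuous_on unit_disc \<psi>" using D2_along_cont(1)[OF \<psi>D[OF one]] .
  have L\<psi>c: "continuous_on unit_disc L\<psi>" unfolding L\<psi>_def by (intro continuous_on_sum D2_along_cont(3)[OF \<psi>D])
  have \<psi>0: "\<psi> z \<ge> 0" for z by (simp add: \<psi>_def)
  have L\<psi>0: "L\<psi> z \<ge> 0" if "z \<in> unit_disc" for z using sub[OF that] by (simp add: L\<psi>_def)
  obtain C1 where C1: "0 \<le> C1" "\<forall>\<^sub>F r in at_left 0. r < 0 \<and> (\<integral>\<^sup>+z. ennreal (norm (f z) powr p) \<partial>exh_level r) \<le> ennreal C1"
    by (rule Hardy_exhE[OF f])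
  obtain C2 where C2: "\<And>r. r < 0 \<Longrightarrow> emeasure (exh_level r) unit_disc \<le> ennreal C2" "0 \<le> C2"
    by (rule exh_level_total_bounded) (rule that; assumption)
  \<comment> \<open>From (x + 1)^(p/2) \<le> (2 max (x, 1))^(p/2) with x = |f|^2.\<close>
  define K where "K = 2 powr (p / 2)"
  have K: "K \<ge> 0" by (simp add: K_def)
  have \<psi>le: "\<psi> z \<le> K * (norm (f z) powr p + 1)" for z
  proof -
    define m where "m = max ((norm (f z))\<^sup>2) 1"
    have "\<psi> z \<le> (2 * m) powr (p / 2)" unfolding \<psi>_def m_def using p by (intro powr_mono2) auto
    also have "\<dots> = K * m powr (p / 2)" by (simp add: K_def m_def powr_mult)
    also have "m powr (p / 2) \<le> norm (f z) powr p + 1"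
    proof (cases "(norm (f z))\<^sup>2 \<le> 1")
      case True then show ?thesis by (simp add: m_def)
    next
      case False
      then have "norm (f z) > 0" by auto
      then have "((norm (f z))\<^sup>2) powr (p / 2) = norm (f z) powr p"
        using powr_powr[of "norm (f z)" 2 "p / 2"] by (simp add: powr_numeral)
      then show ?thesis using False by (simp add: m_def)
    qed
    finally show ?thesis using K by (simp add: mult_left_mono)
  qed
  have fh: "f holomorphic_on unit_disc" using f by (simp add: Hardy_exh_def)
  \<comment> \<open>\<open>K * (C1 + C2)\<close> bounds the integral of \<open>\<psi>\<close> over
    the level measure, 2 pi undoes the normalisation, and 4 is the loss in comparing u with |z|^2 -
    1.\<close>
  define C where "C = 4 * (2 * pi * (K * (C1 + C2)))"
  show ?thesis
  proof (intro exI[of _ C] allI impI)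
    fix R :: real assume R: "0 < R" "R < 1"
    have R2: "R\<^sup>2 < 1" using R by (simp add: power_less_one_iff)
    \<comment> \<open>With \<open>exh_fun_le\<close> this places the ball of radius \<open>R\<close>
      inside the sublevel set and gives r - u \<ge> (R^2 - |z|^2) / 4 there.\<close>
    have "\<forall>\<^sub>F r in at_left 0. - (1 - R\<^sup>2) / 4 < r"
      using R2 by (intro order_tendstoD[OF tendsto_ident_at]) simp
    with C1(2) have "\<forall>\<^sub>F r in at_left (0::real). r < 0 \<and> (\<integral>\<^sup>+z. ennreal (norm (f z) powr p) \<partial>exh_level r) \<le> ennreal C1 \<and> - (1 - R\<^sup>2) / 4 < r"
      by eventually_elim simp
    then obtain r where r: "r < 0" "(\<integral>\<^sup>+z. ennreal (norm (f z) powr p) \<partial>exh_level r) \<le> ennreal C1" "- (1 - R\<^sup>2) / 4 < r"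
      using eventually_happens[of _ "at_left (0::real)"] by (auto simp: trivial_limit_at_left_real)
    note L = exh_level_props[OF r(1)]
    let ?B = "{z\<in>unit_disc. exh_fun z < r}"
    have sp: "space (exh_level r) = unit_disc" using sets_eq_imp_space_eq[OF L(1)] by simp
    have j: "integrable (exh_level r) \<psi>" "(LINT z|exh_level r. \<psi> z) = 1 / (2 * pi) * (LINT z|lborel. indicator ?B z * (\<psi> z * exh.Lap z + (r - exh_fun z) * L\<psi> z))"
      using L(4)[OF \<psi>D] unfolding L\<psi>_def by blast+
    have fm: "f \<in> borel_measurable (exh_level r)"
      by (rule borel_measurable_disc[OF holomorphic_on_imp_continuous_on[OF fh] L(1)])
    have "ennreal (LINT z|exh_level r. \<psi> z) = (\<integral>\<^sup>+z. ennreal (\<psi> z) \<partial>exh_level r)"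
      using j(1) \<psi>0 by (intro nn_integral_eq_integral[symmetric]) auto
    also have "\<dots> \<le> (\<integral>\<^sup>+z. ennreal K * (ennreal (norm (f z) powr p) + 1) \<partial>exh_level r)"
    proof (rule nn_integral_mono)
      fix z
      have "ennreal (\<psi> z) \<le> ennreal (K * (norm (f z) powr p + 1))" by (rule ennreal_leI[OF \<psi>le])
      also have "\<dots> = ennreal K * (ennreal (norm (f z) powr p) + 1)"
        using K by (simp add: ennreal_mult)
      finally show "ennreal (\<psi> z) \<le> ennreal K * (ennreal (norm (f z) powr p) + 1)" .
    qed
    also have "\<dots> = ennreal K * ((\<integral>\<^sup>+z. ennreal (norm (f z) powr p) \<partial>exh_level r) + emeasure (exh_level r) unit_disc)"
      using fm by (simp add: nn_integral_cmult nn_integral_add sp)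
    also have "\<dots> \<le> ennreal K * (ennreal C1 + ennreal C2)"
      by (intro mult_left_mono add_mono r(2) C2(1)[OF r(1)]) simp
    also have "\<dots> = ennreal (K * (C1 + C2))" using K C1 C2 by (simp add: ennreal_mult)
    finally have "(LINT z|exh_level r. \<psi> z) \<le> K * (C1 + C2)"
      using K C1 C2 by (subst (asm) ennreal_le_iff) auto
    then have I: "(LINT z|lborel. indicator ?B z * (\<psi> z * exh.Lap z + (r - exh_fun z) * L\<psi> z)) \<le> 2 * pi * (K * (C1 + C2))"
      unfolding j(2) by (simp add: field_simps)
    have cb: "cball 0 R \<subseteq> (unit_disc :: complex set)" using R by (simp add: cball_subset_ball_iff)
    have "(LINT z|lborel. indicator (ball 0 R) z * (\<psi> z + (R\<^sup>2 - (norm z)\<^sup>2) * L\<psi> z))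
        \<le> (LINT z|lborel. 4 * (indicator ?B z * (\<psi> z * exh.Lap z + (r - exh_fun z) * L\<psi> z)))"
    proof (rule integral_mono)
      show "integrable lborel (\<lambda>z. indicator (ball 0 R) z * (\<psi> z + (R\<^sup>2 - (norm z)\<^sup>2) * L\<psi> z))"
        by (rule integrable_indicator_disc) (use R cb in \<open>auto intro!: continuous_intros \<psi>c L\<psi>c\<close>)
      show "integrable lborel (\<lambda>z. 4 * (indicator ?B z * (\<psi> z * exh.Lap z + (r - exh_fun z) * L\<psi> z)))"
        by (intro integrable_mult_right integrable_indicator_disc[OF exh_fun_sublevel_sets exh_fun_exhaustion(1)[OF r(1)]]
          continuous_intros \<psi>c L\<psi>c exh.cont_Lap exh.cont_u)
      fix z :: complex
      show "indicator (ball 0 R) z * (\<psi> z + (R\<^sup>2 - (norm z)\<^sup>2) * L\<psi> z) \<le> 4 * (indicator ?B z * (\<psi> z * exh.Lap z + (r - exh_fun z) * L\<psi> z))"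
      proof (cases "z \<in> ball 0 R")
        case False
        have "0 \<le> indicator ?B z * (\<psi> z * exh.Lap z + (r - exh_fun z) * L\<psi> z)"
        proof (cases "z \<in> ?B")
          case True
          then show ?thesis using \<psi>0[of z] L\<psi>0[of z] exh.Lap_ge_0[of z] by simp
        qed simp
        then show ?thesis using False by simp
      next
        case True
        then have z: "z \<in> unit_disc" using R by simp
        have "norm z < R" using True by simp
        then have "(norm z)\<^sup>2 < R\<^sup>2" by (intro power_strict_mono) auto
        moreover have rz: "(R\<^sup>2 - (norm z)\<^sup>2) / 4 \<le> r - exh_fun z" using exh_fun_le[OF z] r(3) by (simp add: field_simps)
        ultimately have zB: "z \<in> ?B" using z by auto
        have "\<psi> z \<le> 4 * (\<psi> z * exh.Lap z)"
          using Lap_exh_fun_ge[OF z] \<psi>0[of z] mult_left_mono[of "3/4" "exh.Lap z" "\<psi> z"] by (simp add: exh.Lap_def)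
        moreover have "(R\<^sup>2 - (norm z)\<^sup>2) * L\<psi> z \<le> 4 * ((r - exh_fun z) * L\<psi> z)"
          using mult_right_mono[OF rz L\<psi>0[OF z]] by simp
        ultimately show ?thesis using True zB by (simp add: distrib_left)
      qed
    qed
    also have "\<dots> \<le> C" unfolding C_def integral_mult_right_zero by (rule mult_left_mono[OF I]) simp
    finally show "(LINT z|lborel. indicator (ball 0 R) z *
      (((norm (f z))\<^sup>2 + 1) powr (p / 2) + (R\<^sup>2 - (norm z)\<^sup>2) * (\<Sum>b\<in>Basis. \<psi>2 b z))) \<le> C"
      unfolding \<psi>_def L\<psi>_def .
  qed
qed

text \<open>By the slice construction for |z|^2, whose Laplacian is 4, the right side is the
  integral of \<open>\<psi>\<close> against a positive measure carried by the circle of radius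
  \<open>R\<close>. So only the sign on the circle matters, and no arc length is needed.\<close>

lemma circle_nonneg:
  assumes R: "0 < R" "R < 1"
    and \<psi>: "\<And>b. b \<in> Basis \<Longrightarrow> D2_along b \<psi> (\<psi>1 b) (\<psi>2 b) unit_disc"
    and nn: "\<And>z. norm z = R \<Longrightarrow> 0 \<le> \<psi> z"
  shows "0 \<le> (LINT z|lborel. indicator (ball 0 R) z * (4 * \<psi> z + (R\<^sup>2 - (norm z)\<^sup>2) * (\<Sum>b\<in>Basis. \<psi>2 b z)))"
proof -
  let ?q = "\<lambda>z::complex. (norm z)\<^sup>2"
  have B: "{z\<in>unit_disc. ?q z < R\<^sup>2} = ball 0 R"
  proof -
    have iff: "(norm z)\<^sup>2 < R\<^sup>2 \<longleftrightarrow> norm z < R" for z :: complex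
    proof
      show "(norm z)\<^sup>2 < R\<^sup>2 \<Longrightarrow> norm z < R" by (rule power2_less_imp_less) (use R in simp_all)
      show "norm z < R \<Longrightarrow> (norm z)\<^sup>2 < R\<^sup>2" by (rule power_strict_mono) auto
    qed
    show ?thesis
    proof (rule set_eqI)
      fix z show "z \<in> {z\<in>unit_disc. ?q z < R\<^sup>2} \<longleftrightarrow> z \<in> ball 0 R"
        unfolding mem_Collect_eq iff mem_ball_0 using R by linarith
    qed
  qed
  have Q: "{z\<in>unit_disc. ?q z = R\<^sup>2} \<subseteq> {z. norm z = R}"
    using R by (auto simp: power2_eq_iff_nonneg)
  have cl: "closure {z\<in>unit_disc. ?q z < R\<^sup>2} \<subseteq> unit_disc"
    unfolding B using R by (simp add: cball_subset_ball_iff)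
  have conv: "convex {t. line_pt b s t \<in> unit_disc \<and> ?q (line_pt b s t) < R\<^sup>2}" if "b \<in> Basis" for b s
  proof -
    have "{t. line_pt b s t \<in> unit_disc \<and> ?q (line_pt b s t) < R\<^sup>2} = {t. line_pt b s t \<in> ball 0 R}" using B by blast
    also have "\<dots> = {t. line_pt b s t \<in> {z\<in>unit_disc. ?q z < R\<^sup>2}}" by (simp only: B)
    also have "convex \<dots>"
    proof (rule convexI)
      fix x y a c :: real
      assume x: "x \<in> {t. line_pt b s t \<in> {z\<in>unit_disc. ?q z < R\<^sup>2}}" and y: "y \<in> {t. line_pt b s t \<in> {z\<in>unit_disc. ?q z < R\<^sup>2}}"
        and ac: "0 \<le> a" "0 \<le> c" "a + c = 1"
      have "line_pt b s x \<in> ball 0 R" "line_pt b s y \<in> ball 0 R" using x y B by blast+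
      then have "a *\<^sub>R line_pt b s x + c *\<^sub>R line_pt b s y \<in> ball 0 R" using ac by (intro convexD[OF convex_ball])
      also have "a *\<^sub>R line_pt b s x + c *\<^sub>R line_pt b s y = line_pt b s (a *\<^sub>R x + c *\<^sub>R y)"
      proof -
        have c: "c = 1 - a" using ac(3) by simp
        show ?thesis by (simp add: line_pt_def c scaleR_conv_of_real algebra_simps)
      qed
      finally show "a *\<^sub>R x + c *\<^sub>R y \<in> {t. line_pt b s t \<in> {z\<in>unit_disc. ?q z < R\<^sup>2}}" using B by blast
    qed
    finally show ?thesis .
  qed
  show ?thesis
  proof (rule level_measure_exists[OF D2_along_norm2 cl conv zero_less_one])
    fix \<mu> :: "complex measure"
    assume \<mu>: "sets \<mu> = sets borel_disc" "emeasure \<mu> (unit_disc - {z\<in>unit_disc. ?q z = R\<^sup>2}) = 0"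
      and J: "\<And>\<psi> \<psi>1 \<psi>2. (\<And>b. b \<in> Basis \<Longrightarrow> D2_along b \<psi> (\<psi>1 b) (\<psi>2 b) unit_disc) \<Longrightarrow> integrable \<mu> \<psi> \<and>
       (LINT z|\<mu>. \<psi> z) = 1 * (LINT z|lborel. indicator {z\<in>unit_disc. ?q z < R\<^sup>2} z *
          (\<psi> z * (\<Sum>b\<in>(Basis::complex set). 2) + (R\<^sup>2 - ?q z) * (\<Sum>b\<in>Basis. \<psi>2 b z)))"
    have sp: "space \<mu> = unit_disc" using sets_eq_imp_space_eq[OF \<mu>(1)] by simp
    have "unit_disc - {z\<in>unit_disc. ?q z = R\<^sup>2} \<in> sets \<mu>"
      by (rule level_complement_sets[OF _ \<mu>(1)]) (intro continuous_intros)
    then have "unit_disc - {z\<in>unit_disc. ?q z = R\<^sup>2} \<in> null_sets \<mu>" using \<mu>(2) by (simp add: null_sets_def)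
    then have "AE z in \<mu>. 0 \<le> \<psi> z"
    proof (rule AE_I')
      show "{z \<in> space \<mu>. \<not> 0 \<le> \<psi> z} \<subseteq> unit_disc - {z\<in>unit_disc. ?q z = R\<^sup>2}"
        using nn Q unfolding sp by blast
    qed
    then have "0 \<le> (LINT z|\<mu>. \<psi> z)" by (rule integral_nonneg_AE)
    also have "\<dots> = 1 * (LINT z|lborel. indicator {z\<in>unit_disc. ?q z < R\<^sup>2} z *
          (\<psi> z * (\<Sum>b\<in>(Basis::complex set). 2) + (R\<^sup>2 - ?q z) * (\<Sum>b\<in>Basis. \<psi>2 b z)))"
      by (rule J[THEN conjunct2]) (rule \<psi>)
    finally show ?thesis unfolding B by (simp add: mult.commute[of _ 4])
  qed
qed

section \<open>Boundary values of harmonic polynomials on a circle\<close>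

definition trig_on :: "real \<Rightarrow> (complex \<Rightarrow> real) \<Rightarrow> bool"
  where "trig_on R h \<longleftrightarrow> (\<exists>P. \<forall>z. norm z = R \<longrightarrow> h z = Re (poly P z))"

lemma trig_on_poly: "(\<And>z. norm z = R \<Longrightarrow> h z = Re (poly P z)) \<Longrightarrow> trig_on R h"
  unfolding trig_on_def by blast

lemma trig_on_add:
  assumes "trig_on R g" "trig_on R h" shows "trig_on R (\<lambda>z. g z + h z)"
proof -
  obtain P Q where "\<And>z. norm z = R \<Longrightarrow> g z = Re (poly P z)" "\<And>z. norm z = R \<Longrightarrow> h z = Re (poly Q z)"
    using assms unfolding trig_on_def by blast
  then show ?thesis by (intro trig_on_poly[of _ _ "P + Q"]) simp
qed

lemma trig_on_cmult:
  assumes "trig_on R g" shows "trig_on R (\<lambda>z. c * g z)"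
proof -
  obtain P where "\<And>z. norm z = R \<Longrightarrow> g z = Re (poly P z)"
    using assms unfolding trig_on_def by blast
  then show ?thesis by (intro trig_on_poly[of _ _ "smult (of_real c) P"]) simp
qed

text \<open>
  On the circle, \<open>z\<close> times its conjugate is constant, so that products of harmonic polynomials
  reduce to harmonic polynomials.
\<close>

lemma trig_on_poly_cnj: "trig_on R (\<lambda>z. Re (poly P z * cnj (poly Q z)))"
proof (induction P arbitrary: Q)
  case 0
  show ?case by (rule trig_on_poly[of _ _ 0]) simp
next
  case (pCons a P)
  obtain b Q' where Q: "Q = pCons b Q'" by (cases Q)
  have 1: "trig_on R (\<lambda>z. Re (cnj a * poly Q z))" by (rule trig_on_poly[of _ _ "smult (cnj a) Q"]) simp
  have 2: "trig_on R (\<lambda>z. Re (cnj b * (z * poly P z)))" by (rule trig_on_poly[of _ _ "smult (cnj b) (pCons 0 P)"]) (simp add: algebra_simps)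
  have "trig_on R (\<lambda>z. Re (cnj a * poly Q z) + Re (cnj b * (z * poly P z)) + R\<^sup>2 * Re (poly P z * cnj (poly Q' z)))"
    by (intro trig_on_add trig_on_cmult 1 2 pCons.IH)
  moreover have "Re (poly (pCons a P) z * cnj (poly Q z)) =
      Re (cnj a * poly Q z) + Re (cnj b * (z * poly P z)) + R\<^sup>2 * Re (poly P z * cnj (poly Q' z))" if "norm z = R" for z
  proof -
    have zz: "z * cnj z = of_real (R\<^sup>2)" using that complex_norm_square[of z] by simp
    have "poly (pCons a P) z * cnj (poly Q z) = a * cnj (poly Q z) + cnj b * (z * poly P z) + (z * cnj z) * (poly P z * cnj (poly Q' z))"
      by (simp add: Q algebra_simps)
    also have "Re \<dots> = Re (a * cnj (poly Q z)) + Re (cnj b * (z * poly P z)) + R\<^sup>2 * Re (poly P z * cnj (poly Q' z))"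
      unfolding zz by simp
    also have "Re (a * cnj (poly Q z)) = Re (cnj a * poly Q z)" by simp
    finally show ?thesis .
  qed
  ultimately show ?case unfolding trig_on_def by simp
qed

text \<open>2 Re a Re b = Re (a b) + Re (a cnj b); the second summand is the subject of
  \<open>trig_on_poly_cnj\<close>.\<close>

lemma trig_on_mult:
  assumes "trig_on R g" "trig_on R h" shows "trig_on R (\<lambda>z. g z * h z)"
proof -
  obtain P Q where PQ: "\<And>z. norm z = R \<Longrightarrow> g z = Re (poly P z)" "\<And>z. norm z = R \<Longrightarrow> h z = Re (poly Q z)"
    using assms unfolding trig_on_def by blast
  have "trig_on R (\<lambda>z. 1/2 * Re (poly (P * Q) z) + 1/2 * Re (poly P z * cnj (poly Q z)))"
    by (intro trig_on_add trig_on_cmult trig_on_poly_cnj trig_on_poly[of _ _ "P * Q"]) simp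
  moreover have "g z * h z = 1/2 * Re (poly (P * Q) z) + 1/2 * Re (poly P z * cnj (poly Q z))" if "norm z = R" for z
    using PQ[OF that] by (simp add: algebra_simps)
  ultimately show ?thesis unfolding trig_on_def by simp
qed

lemma trig_on_real_polynomial:
  fixes g :: "complex \<Rightarrow> real"
  assumes "real_polynomial_function g" shows "trig_on R g"
  using assms
proof (induction g)
  case (linear f)
  interpret bounded_linear f by fact
  have "f z = Re (poly [:0, Complex (f 1) (- f \<i>):] z)" for z
  proof -
    have "z = Re z *\<^sub>R 1 + Im z *\<^sub>R \<i>" by (simp add: complex_eq_iff)
    then have "f z = f (Re z *\<^sub>R 1 + Im z *\<^sub>R \<i>)" by simp
    also have "\<dots> = Re z * f 1 + Im z * f \<i>" unfolding add scaleR by simp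
    finally show ?thesis by simp
  qed
  then show ?case by (intro trig_on_poly) blast
next
  case (const c)
  show ?case by (rule trig_on_poly[of _ _ "[:of_real c:]"]) simp
qed (auto intro: trig_on_add trig_on_mult)

text \<open>Stone-Weierstrass gives a polynomial in two real variables, which is replaced by a
  harmonic one with the same values on the circle. This takes the place of the Poisson integral;
  accuracy one is enough, as only uniform bounds are needed later.\<close>

lemma circle_approximation:
  fixes \<psi> :: "complex \<Rightarrow> real"
  assumes "continuous_on (sphere 0 R) \<psi>"
  obtains P where "\<And>z. norm z = R \<Longrightarrow> \<bar>Re (poly P z) - \<psi> z\<bar> < 1"
proof -
  obtain g where g: "real_polynomial_function g" "\<And>z. z \<in> sphere 0 R \<Longrightarrow> \<bar>\<psi> z - g z\<bar> < 1"
    by (rule Stone_Weierstrass_real_polynomial_function[OF compact_sphere assms zero_less_one]) (rule that; assumption)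
  obtain P where "\<And>z. norm z = R \<Longrightarrow> g z = Re (poly P z)"
    using trig_on_real_polynomial[OF g(1), of R] unfolding trig_on_def by blast
  then show ?thesis using g(2) that[of P] by (force simp: abs_minus_commute)
qed

lemma fmeasurable_ball: "ball x r \<in> fmeasurable lborel" for x :: complex
  using emeasure_bounded_finite[OF bounded_ball[of x r]] by (intro fmeasurableI) auto

text \<open>\<open>Re F\<close> differs from \<open>\<psi>\<close> by at most one on the circle. The
  maximum principle carries \<open>\<psi> \<le> Re F + 1\<close> inside; the opposite inequality on
  the circle, fed into \<open>circle_nonneg\<close>, bounds the integral of \<open>Re F\<close> by
  the quantities in \<open>psi_bound\<close>.\<close>

lemma majorant_on_ball:
  assumes p: "p > 0" and f: "f \<in> Hardy_exh (\<lambda>z. ereal (exh_fun z)) p"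
  shows "\<exists>C. \<forall>R. 0 < R \<longrightarrow> R < 1 \<longrightarrow> (\<exists>F. F holomorphic_on UNIV \<and>
    (\<forall>z\<in>ball 0 R. norm (f z) powr p \<le> Re (F z) + 1) \<and> (LINT z|lborel. indicator (ball 0 R) z * Re (F z)) \<le> C)"
proof -
  have fh: "f holomorphic_on unit_disc" using f by (simp add: Hardy_exh_def)
  define \<psi> where "\<psi> z = ((norm (f z))\<^sup>2 + 1) powr (p / 2)" for z
  have p2: "p / 2 > 0" using p by simp
  obtain \<psi>1 \<psi>2 where \<psi>0: "\<And>b. b \<in> Basis \<Longrightarrow> D2_along b (\<lambda>z. ((norm (f z))\<^sup>2 + 1) powr (p / 2)) (\<psi>1 b) (\<psi>2 b) unit_disc"
    "\<And>z. z \<in> unit_disc \<Longrightarrow> 0 \<le> (\<Sum>b\<in>Basis. \<psi>2 b z)"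
    by (rule psi_subharmonic[OF fh p2]) (rule that; assumption)
  note \<psi> = \<psi>0(1)[folded \<psi>_def] and sub = \<psi>0(2)
  have "\<exists>C. \<forall>R. 0 < R \<longrightarrow> R < 1 \<longrightarrow> (LINT z|lborel. indicator (ball 0 R) z *
      (\<psi> z + (R\<^sup>2 - (norm z)\<^sup>2) * (\<Sum>b\<in>Basis. \<psi>2 b z))) \<le> C"
    unfolding \<psi>_def by (rule psi_bound[OF p f \<psi>0])
  then obtain C where C0: "\<forall>R. 0 < R \<longrightarrow> R < 1 \<longrightarrow> (LINT z|lborel. indicator (ball 0 R) z *
      (\<psi> z + (R\<^sup>2 - (norm z)\<^sup>2) * (\<Sum>b\<in>Basis. \<psi>2 b z))) \<le> C" by (elim exE)
  note C = C0[rule_format]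
  have one: "(1::complex) \<in> Basis" by (simp add: Basis_complex_def)
  have \<psi>c: "continuous_on unit_disc \<psi>" using D2_along_cont(1)[OF \<psi>[OF one]] .
  have Lc: "continuous_on unit_disc (\<lambda>z. \<Sum>b\<in>Basis. \<psi>2 b z)" by (intro continuous_on_sum D2_along_cont(3)[OF \<psi>])
  have f\<psi>: "norm (f z) powr p \<le> \<psi> z" for z
  proof (cases "f z = 0")
    case True then show ?thesis by (simp add: \<psi>_def)
  next
    case False
    have "norm (f z) powr p = ((norm (f z))\<^sup>2) powr (p / 2)"
      using powr_powr[of "norm (f z)" 2 "p / 2"] False by (simp add: powr_numeral)
    also have "\<dots> \<le> \<psi> z" unfolding \<psi>_def using p by (intro powr_mono2) auto
    finally show ?thesis .
  qed
  define M where "M = measure lborel (ball (0::complex) 1)"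
  show ?thesis
  \<comment> \<open>\<open>C\<close> is the constant of \<open>psi_bound\<close>; the area
    \<open>M\<close> of the unit disc pays for the approximation error of one.\<close>
  proof (intro exI[of _ "C + M"] allI impI)
    fix R :: real assume R: "0 < R" "R < 1"
    have cb: "cball 0 R \<subseteq> (unit_disc :: complex set)" using R by (simp add: cball_subset_ball_iff)
    have clb: "closure (ball 0 R) \<subseteq> (unit_disc :: complex set)" using R cb by simp
    have bb: "ball 0 R \<subseteq> (unit_disc :: complex set)" using R by (simp add: subset_ball)
    have sp: "sphere 0 R \<subseteq> (unit_disc :: complex set)" using R by auto
    obtain P where P: "\<And>z. norm z = R \<Longrightarrow> \<bar>Re (poly P z) - \<psi> z\<bar> < 1"
      by (rule circle_approximation[OF continuous_on_subset[OF \<psi>c sp]]) (rule that; assumption)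
    define F where "F = poly P"
    have Fh: "F holomorphic_on S" for S unfolding F_def by (intro holomorphic_intros)
    define F2 where "F2 b z = Re (deriv (deriv F) z * b * b)" for b z
    have FD: "D2_along b (\<lambda>z. Re (F z)) (\<lambda>z. Re (deriv F z * b)) (F2 b) unit_disc" for b
      unfolding F2_def by (rule D2_along_Re[OF Fh open_ball])
    have F20: "(\<Sum>b\<in>Basis. F2 b z) = 0" for z unfolding sum_Basis_complex F2_def by simp
    have Fc: "continuous_on S (\<lambda>z. Re (F z))" for S
      by (intro continuous_intros holomorphic_on_imp_continuous_on Fh)
    have maj: "\<psi> z - Re (F z) - 1 \<le> 0" if z: "z \<in> ball 0 R" for z
    proof (rule maximum_principle[OF open_ball bounded_ball _ _ _ _ z])
      show "continuous_on (closure (ball 0 R)) (\<lambda>z. \<psi> z - Re (F z) - 1)"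
        by (intro continuous_intros continuous_on_subset[OF \<psi>c clb] Fc)
      show "\<psi> z - Re (F z) - 1 \<le> 0" if "z \<in> frontier (ball 0 R)" for z
        using P[of z] that R by (simp add: F_def)
      show "D2_along b (\<lambda>z. \<psi> z - Re (F z) - 1) (\<lambda>z. \<psi>1 b z - Re (deriv F z * b) - 0) (\<lambda>z. \<psi>2 b z - F2 b z - 0) (ball 0 R)"
        if "b \<in> Basis" for b
        by (intro D2_along_diff D2_along_const D2_along_subset[OF FD bb] D2_along_subset[OF \<psi>[OF that] bb])
      show "0 \<le> (\<Sum>b\<in>Basis. \<psi>2 b z - F2 b z - 0)" if "z \<in> ball 0 R" for z
        using sub[OF subsetD[OF bb that]] F20[of z] by (simp add: sum_subtractf)
    qed
    have I: "integrable lborel (\<lambda>z. indicator (ball 0 R) z * h z)" if "continuous_on unit_disc h" for h :: "complex \<Rightarrow> real"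
      by (rule integrable_indicator_disc[OF _ clb that]) simp
    have 1: "integrable lborel (\<lambda>z. indicator (ball 0 R) z * (\<psi> z + (R\<^sup>2 - (norm z)\<^sup>2) * (\<Sum>b\<in>Basis. \<psi>2 b z)))"
      by (rule I) (intro continuous_on_add continuous_on_mult continuous_on_diff continuous_on_const \<psi>c Fc Lc continuous_on_power continuous_on_norm continuous_on_id)
    have 2: "integrable lborel (\<lambda>z. indicator (ball 0 R) z * Re (F z))" by (rule I[OF Fc])
    have 3: "integrable lborel (\<lambda>z::complex. indicator (ball 0 R) z * (1::real))" by (rule I[OF continuous_on_const])
    have "0 \<le> (LINT z|lborel. indicator (ball 0 R) z * (4 * (\<psi> z - Re (F z) + 1) + (R\<^sup>2 - (norm z)\<^sup>2) * (\<Sum>b\<in>Basis. \<psi>2 b z - F2 b z + 0)))"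
    proof (rule circle_nonneg[OF R])
      show "D2_along b (\<lambda>z. \<psi> z - Re (F z) + 1) (\<lambda>z. \<psi>1 b z - Re (deriv F z * b) + 0) (\<lambda>z. \<psi>2 b z - F2 b z + 0) unit_disc"
        if "b \<in> Basis" for b
        by (intro D2_along_add D2_along_diff D2_along_const FD \<psi> that)
      show "0 \<le> \<psi> z - Re (F z) + 1" if "norm z = R" for z using P[OF that] by (simp add: F_def)
    qed
    \<comment> \<open>\<open>F\<close> contributes nothing to the Laplacian term. That term is
      nonnegative, so its coefficient may be raised from 1 to 4 to match the integrand of
      \<open>psi_bound\<close>.\<close>
    also have "\<dots> \<le> (LINT z|lborel. 4 * (indicator (ball 0 R) z * (\<psi> z + (R\<^sup>2 - (norm z)\<^sup>2) * (\<Sum>b\<in>Basis. \<psi>2 b z)))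
        - 4 * (indicator (ball 0 R) z * Re (F z)) + 4 * (indicator (ball 0 R) z * 1))"
    proof (rule integral_mono)
      have E: "(\<lambda>z. \<Sum>b\<in>Basis. \<psi>2 b z - F2 b z + 0) = (\<lambda>z. \<Sum>b\<in>Basis. \<psi>2 b z)"
        using F20 by (simp add: sum_subtractf fun_eq_iff)
      have Lc2: "continuous_on unit_disc (\<lambda>z. \<Sum>b\<in>Basis. \<psi>2 b z - F2 b z + 0)" unfolding E by (rule Lc)
      show "integrable lborel (\<lambda>z. indicator (ball 0 R) z * (4 * (\<psi> z - Re (F z) + 1) + (R\<^sup>2 - (norm z)\<^sup>2) * (\<Sum>b\<in>Basis. \<psi>2 b z - F2 b z + 0)))"
        by (rule I) (intro continuous_on_add continuous_on_mult continuous_on_diff continuous_on_const \<psi>c Fc Lc2 continuous_on_power continuous_on_norm continuous_on_id)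
      show "integrable lborel (\<lambda>z. 4 * (indicator (ball 0 R) z * (\<psi> z + (R\<^sup>2 - (norm z)\<^sup>2) * (\<Sum>b\<in>Basis. \<psi>2 b z)))
        - 4 * (indicator (ball 0 R) z * Re (F z)) + 4 * (indicator (ball 0 R) z * 1))"
        by (intro Bochner_Integration.integrable_add Bochner_Integration.integrable_diff integrable_mult_right 1 2 3)
      fix z :: complex
      show "indicator (ball 0 R) z * (4 * (\<psi> z - Re (F z) + 1) + (R\<^sup>2 - (norm z)\<^sup>2) * (\<Sum>b\<in>Basis. \<psi>2 b z - F2 b z + 0))
        \<le> 4 * (indicator (ball 0 R) z * (\<psi> z + (R\<^sup>2 - (norm z)\<^sup>2) * (\<Sum>b\<in>Basis. \<psi>2 b z)))
        - 4 * (indicator (ball 0 R) z * Re (F z)) + 4 * (indicator (ball 0 R) z * 1)"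
      proof (cases "z \<in> ball 0 R")
        case True
        then have "(norm z)\<^sup>2 \<le> R\<^sup>2" by (intro power_mono) auto
        then have "0 \<le> (R\<^sup>2 - (norm z)\<^sup>2) * (\<Sum>b\<in>Basis. \<psi>2 b z)"
          using sub[OF subsetD[OF bb True]] by simp
        moreover have "(\<Sum>b\<in>Basis. \<psi>2 b z - F2 b z + 0) = (\<Sum>b\<in>Basis. \<psi>2 b z)" using F20[of z] by (simp add: sum_subtractf)
        ultimately show ?thesis using True by (simp add: mult.commute)
      qed simp
    qed
    also have "\<dots> = 4 * (LINT z|lborel. indicator (ball 0 R) z * (\<psi> z + (R\<^sup>2 - (norm z)\<^sup>2) * (\<Sum>b\<in>Basis. \<psi>2 b z)))
        - 4 * (LINT z|lborel. indicator (ball 0 R) z * Re (F z)) + 4 * (LINT z|lborel. indicator (ball (0::complex) R) z * 1)"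
    proof -
      show ?thesis using 1 2 3
        by (simp only: Bochner_Integration.integral_add Bochner_Integration.integral_diff Bochner_Integration.integrable_diff integrable_mult_right integral_mult_right_zero)
    qed
    finally have "(LINT z|lborel. indicator (ball 0 R) z * Re (F z)) \<le>
       (LINT z|lborel. indicator (ball 0 R) z * (\<psi> z + (R\<^sup>2 - (norm z)\<^sup>2) * (\<Sum>b\<in>Basis. \<psi>2 b z))) + (LINT z|lborel. indicator (ball (0::complex) R) z * 1)"
      by linarith
    also have "(LINT z|lborel. indicator (ball (0::complex) R) z * (1::real)) \<le> M"
    proof -
      have "(LINT z|lborel. indicator (ball (0::complex) R) z * (1::real)) = measure lborel (ball (0::complex) R)"
        by simp
      also have "\<dots> \<le> M" unfolding M_def
        by (rule measure_mono_fmeasurable[OF bb _ fmeasurable_ball]) simp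
      finally show ?thesis .
    qed
    finally have "(LINT z|lborel. indicator (ball 0 R) z * Re (F z)) \<le> C + M" using C[OF R] by simp
    moreover have "norm (f z) powr p \<le> Re (F z) + 1" if "z \<in> ball 0 R" for z
      using f\<psi>[of z] maj[OF that] by linarith
    ultimately show "\<exists>F. F holomorphic_on UNIV \<and>
      (\<forall>z\<in>ball 0 R. norm (f z) powr p \<le> Re (F z) + 1) \<and> (LINT z|lborel. indicator (ball 0 R) z * Re (F z)) \<le> C + M"
      using Fh[of UNIV] by blast
  qed
qed

text \<open>
  Up to scaling to the unit disc and an imaginary constant, the functions \<open>1 / (F + 3)\<close> form a
  normal family of functions without zeros; the integral bound keeps them away from zero at one point,
  so that by Hurwitz the limit has no zeros either.
\<close>

lemma Hardy_of_majorants: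
  assumes f: "f holomorphic_on unit_disc"
    and C: "\<And>R. 0 < R \<Longrightarrow> R < 1 \<Longrightarrow> \<exists>F. F holomorphic_on UNIV \<and>
      (\<forall>z\<in>ball 0 R. norm (f z) powr p \<le> Re (F z) + 1) \<and> (LINT z|lborel. indicator (ball 0 R) z * Re (F z)) \<le> C"
  shows "f \<in> Hardy p"
proof -
  \<comment> \<open>Starting at 3/4 leaves room around the half disc: its points, divided by
    \<open>R n\<close>, have norm at most 2/3.\<close>
  define R where "R n = 1 - 1 / (real n + 4)" for n
  have R: "0 < R n" "R n < 1" "3/4 \<le> R n" for n by (auto simp: R_def field_simps)
  have Rlim: "R \<longlonglongrightarrow> 1" unfolding R_def by real_asymp
  have "\<forall>n. \<exists>F. F holomorphic_on UNIV \<and>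
      (\<forall>z\<in>ball 0 (R n). norm (f z) powr p \<le> Re (F z) + 1) \<and> (LINT z|lborel. indicator (ball 0 (R n)) z * Re (F z)) \<le> C"
    by (intro allI C R)
  then obtain F where F: "\<And>n. F n holomorphic_on UNIV"
     "\<And>n z. z \<in> ball 0 (R n) \<Longrightarrow> norm (f z) powr p \<le> Re (F n z) + 1"
     "\<And>n. (LINT z|lborel. indicator (ball 0 (R n)) z * Re (F n z)) \<le> C"
    by metis
  define M where "M = measure lborel (ball (0::complex) 1)"
  define m where "m = measure lborel (ball (0::complex) (1/2))"
  have m: "m > 0" unfolding m_def by (rule content_ball_pos) simp
  define c where "c = (C + M) / m"
  have Fpos: "0 \<le> Re (F n z) + 1" if "z \<in> ball 0 (R n)" for n z
    using F(2)[OF that] powr_ge_zero[of "norm (f z)" p] by linarith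
  \<comment> \<open>Otherwise the nonnegative function \<open>Re (F n) + 1\<close> has integral at
    least \<open>m * (c + 1)\<close>, which is \<open>C + M + m\<close>, over the half disc alone,
    although its integral over the larger ball is at most \<open>C + M\<close>.\<close>
  have "\<exists>w\<in>ball 0 (1/2). Re (F n w) \<le> c" for n
  proof (rule ccontr)
    assume "\<not> ?thesis"
    then have gt: "c < Re (F n w)" if "w \<in> ball 0 (1/2)" for w using that by force
    have cl: "closure (ball 0 (R n)) \<subseteq> (unit_disc::complex set)" "closure (ball 0 (1/2)) \<subseteq> (unit_disc::complex set)"
      using R[of n] by (simp_all add: cball_subset_ball_iff)
    have bs: "ball 0 (1/2) \<subseteq> (ball 0 (R n) :: complex set)" "ball 0 (R n) \<subseteq> (ball 0 1 :: complex set)"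
      using R[of n] by (simp_all add: subset_ball)
    have Fc: "continuous_on unit_disc (\<lambda>z. Re (F n z))"
      by (intro continuous_intros holomorphic_on_imp_continuous_on holomorphic_on_subset[OF F(1)]) simp
    have i1: "integrable lborel (\<lambda>z. indicator (ball 0 (R n)) z * Re (F n z))"
      by (rule integrable_indicator_disc[OF _ cl(1) Fc]) simp
    have i2: "integrable lborel (\<lambda>z::complex. indicator (ball 0 (R n)) z * (1::real))"
      by (rule integrable_indicator_disc[OF _ cl(1) continuous_on_const]) simp
    have i3: "integrable lborel (\<lambda>z::complex. indicator (ball 0 (1/2)) z * (c + 1))"
      by (rule integrable_indicator_disc[OF _ cl(2) continuous_on_const]) simp
    have "m * (c + 1) = (LINT z|lborel. indicator (ball (0::complex) (1/2)) z * (c + 1))"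
      by (simp add: m_def)
    also have "\<dots> \<le> (LINT z|lborel. indicator (ball 0 (R n)) z * Re (F n z) + indicator (ball 0 (R n)) z * 1)"
    proof (rule integral_mono[OF i3 Bochner_Integration.integrable_add[OF i1 i2]])
      fix z :: complex
      show "indicator (ball 0 (1/2)) z * (c + 1) \<le> indicator (ball 0 (R n)) z * Re (F n z) + indicator (ball 0 (R n)) z * 1"
      proof (cases "z \<in> ball 0 (1/2)")
        case True
        then have "z \<in> ball 0 (R n)" using bs(1) by blast
        then show ?thesis using True gt[OF True] by simp
      next
        case False
        then show ?thesis using Fpos[of z n] by (cases "z \<in> ball 0 (R n)") simp_all
      qed
    qed
    also have "\<dots> = (LINT z|lborel. indicator (ball 0 (R n)) z * Re (F n z)) + (LINT z|lborel. indicator (ball (0::complex) (R n)) z * 1)"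
      by (rule Bochner_Integration.integral_add[OF i1 i2])
    also have "(LINT z|lborel. indicator (ball (0::complex) (R n)) z * (1::real)) = measure lborel (ball (0::complex) (R n))"
      by simp
    also have "measure lborel (ball (0::complex) (R n)) \<le> M" unfolding M_def
      by (rule measure_mono_fmeasurable[OF bs(2) _ fmeasurable_ball]) simp
    finally have "m * (c + 1) \<le> C + M" using F(3)[of n] by linarith
    moreover have "m * c = C + M" using m by (simp add: c_def)
    ultimately show False using m by (simp add: distrib_left)
  qed
  then have "\<forall>n. \<exists>w. w \<in> ball 0 (1/2) \<and> Re (F n w) \<le> c" by blast
  then obtain w where w: "\<And>n. w n \<in> ball 0 (1/2)" "\<And>n. Re (F n (w n)) \<le> c" by metis
  \<comment> \<open>As Re F + 1 \<ge> 0, the added 3 yields Re g \<ge> 2, so the inverses are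
    bounded by one. The imaginary constant makes the function real at the rescaled point
    \<open>w n\<close>, where its modulus is then at most \<open>c + 3\<close>.\<close>
  define g where "g n z = F n (of_real (R n) * z) + 3 - \<i> * of_real (Im (F n (w n)))" for n z
  have inR: "of_real (R n) * z \<in> ball 0 (R n)" if "z \<in> unit_disc" for n z
    using that R(1)[of n] by (simp add: norm_mult)
  have gre: "norm (f (of_real (R n) * z)) powr p + 2 \<le> Re (g n z)" if "z \<in> unit_disc" for n z
    using F(2)[OF inR[OF that, of n]] by (simp add: g_def)
  have g2: "2 \<le> Re (g n z)" if "z \<in> unit_disc" for n z
    using gre[OF that, of n] powr_ge_zero[of "norm (f (of_real (R n) * z))" p] by linarith
  have g0: "g n z \<noteq> 0" if "z \<in> unit_disc" for n z using g2[OF that, of n] by auto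
  have gh: "g n holomorphic_on unit_disc" for n
  proof -
    have "F n \<circ> (\<lambda>z. of_real (R n) * z) holomorphic_on unit_disc"
      by (rule holomorphic_on_compose_gen[OF _ F(1)]) (auto intro!: holomorphic_intros)
    then show ?thesis unfolding g_def by (intro holomorphic_intros) (simp add: o_def)
  qed
  define G where "G n z = inverse (g n z)" for n z
  have Gh: "G n holomorphic_on unit_disc" for n
    unfolding G_def using g0 by (intro holomorphic_intros gh) auto
  have G1: "norm (G n z) \<le> 1" if "z \<in> unit_disc" for n z
  proof -
    have "1 \<le> norm (g n z)" using g2[OF that, of n] complex_Re_le_cmod[of "g n z"] by linarith
    then show ?thesis by (simp add: G_def norm_inverse inverse_le_1_iff)
  qed
  define H where "H = {h. h holomorphic_on unit_disc \<and> (\<forall>z\<in>unit_disc. norm (h z) \<le> 1)}"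
  obtain L r where L: "L holomorphic_on unit_disc" "strict_mono (r :: nat \<Rightarrow> nat)"
    "\<And>x. x \<in> unit_disc \<Longrightarrow> ((\<lambda>n. G (r n) x) \<longlongrightarrow> L x) sequentially"
    "\<And>K. compact K \<Longrightarrow> K \<subseteq> unit_disc \<Longrightarrow> uniform_limit K (G \<circ> r) L sequentially"
  proof (rule Montel[of unit_disc H G])
    show "\<exists>B. \<forall>h\<in>H. \<forall>z\<in>K. norm (h z) \<le> B" if "compact K" "K \<subseteq> unit_disc" for K
      using that by (intro exI[of _ 1]) (auto simp: H_def)
    show "range G \<subseteq> H" using Gh G1 by (auto simp: H_def)
  qed (auto simp: H_def)
  have "c + 3 > 0"
  proof -
    have "w 0 \<in> ball 0 (R 0)" using w(1)[of 0] R(3)[of 0] by simp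
    then show ?thesis using Fpos[of "w 0" 0] w(2)[of 0] by linarith
  qed
  have nz: "\<exists>v\<in>unit_disc. L v \<noteq> 0"
  proof -
    have K: "cball 0 (2/3) \<subseteq> (unit_disc::complex set)" by (simp add: cball_subset_ball_iff)
    have "\<forall>\<^sub>F n in sequentially. \<forall>x\<in>cball 0 (2/3). dist ((G \<circ> r) n x) (L x) < 1 / (c + 3)"
      by (rule uniform_limitD[OF L(4)[OF compact_cball K]]) (use \<open>c + 3 > 0\<close> in simp)
    then obtain n where n0: "\<forall>x\<in>cball 0 (2/3). dist ((G \<circ> r) n x) (L x) < 1 / (c + 3)"
      unfolding eventually_sequentially by blast
    have n: "dist (G (r n) x) (L x) < 1 / (c + 3)" if "x \<in> cball 0 (2/3)" for x
      using bspec[OF n0 that] by simp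
    \<comment> \<open>The point where the inverse is known to be large moves with \<open>n\<close>,
      so pointwise convergence would not do. It stays in the disc of radius 2/3, where uniform
      convergence within 1 / (c + 3) rules out a zero of the limit.\<close>
    define v where "v = w (r n) / of_real (R (r n))"
    have Rp: "R (r n) > 0" by (rule R)
    have "norm v = norm (w (r n)) / R (r n)" using Rp by (simp add: v_def norm_divide)
    also have "\<dots> \<le> (1/2) / (3/4)" using w(1)[of "r n"] R(3)[of "r n"] by (intro frac_le) auto
    finally have v: "v \<in> cball 0 (2/3)" by simp
    then have vD: "v \<in> unit_disc" using K by blast
    have wv: "of_real (R (r n)) * v = w (r n)" using Rp by (simp add: v_def)
    have "g (r n) v = of_real (Re (F (r n) (w (r n))) + 3)" unfolding g_def wv by (simp add: complex_eq_iff)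
    then have "norm (g (r n) v) = Re (F (r n) (w (r n))) + 3"
      using g2[OF vD, of "r n"] by simp
    also have "\<dots> \<le> c + 3" using w(2) by simp
    finally have "inverse (c + 3) \<le> inverse (norm (g (r n) v))"
      using g0[OF vD, of "r n"] by (intro le_imp_inverse_le) auto
    then have "1 / (c + 3) \<le> norm (G (r n) v)"
      unfolding G_def norm_inverse by (simp only: inverse_eq_divide)
    then have "L v \<noteq> 0" using n[OF v] by (auto simp: dist_norm)
    then show ?thesis using vD by blast
  qed
  have L0: "L z \<noteq> 0" if z: "z \<in> unit_disc" for z
  \<comment> \<open>Hurwitz speaks of nonconstant limits only; a constant limit is nonzero by
    \<open>nz\<close>.\<close>
  proof (cases "L constant_on unit_disc")
    case True
    then show ?thesis using nz z unfolding constant_on_def by metis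
  next
    case False
    show ?thesis
    proof (rule Hurwitz_no_zeros[OF open_ball _ _ L(1) L(4) False _ z])
      show "(G \<circ> r) n holomorphic_on unit_disc" for n using Gh by simp
      show "(G \<circ> r) n z \<noteq> 0" if "z \<in> unit_disc" for n z using g0[OF that] by (simp add: G_def)
    qed auto
  qed
  \<comment> \<open>Of the 3 added to \<open>F\<close>, one belongs to the majorant
    \<open>Re F + 1\<close>; the other 2 are given back.\<close>
  define h where "h z = inverse (L z) - 2" for z
  have "h holomorphic_on unit_disc" unfolding h_def using L0 by (intro holomorphic_intros L(1)) auto
  then have "harmonic_on (\<lambda>z. Re (h z)) unit_disc" by (rule harmonic_on_Re) simp
  moreover have "norm (f z) powr p \<le> Re (h z)" if z: "z \<in> unit_disc" for z
  \<comment> \<open>Continuity of \<open>powr\<close> is used only at a nonzero base. Where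
    \<open>f\<close> vanishes, \<open>0 powr p\<close> is 0 and the limit of
    \<open>2 \<le> Re (g n z)\<close> suffices.\<close>
  proof (cases "f z = 0")
    case True
    have "(\<lambda>n. Re (inverse (G (r n) z))) \<longlonglongrightarrow> Re (inverse (L z))"
      by (intro tendsto_intros L(3)[OF z] L0[OF z])
    moreover have "2 \<le> Re (inverse (G (r n) z))" for n using g2[OF z] by (simp add: G_def)
    ultimately have "2 \<le> Re (inverse (L z))" by (intro LIMSEQ_le_const) auto
    then show ?thesis using True by (simp add: h_def)
  next
    case False
    have "(\<lambda>n. Re (inverse (G (r n) z))) \<longlonglongrightarrow> Re (inverse (L z))"
      by (intro tendsto_intros L(3)[OF z] L0[OF z])
    moreover have "(\<lambda>n. norm (f (of_real (R (r n)) * z)) powr p + 2) \<longlonglongrightarrow> norm (f z) powr p + 2"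
    proof -
      have "(\<lambda>n. R (r n)) \<longlonglongrightarrow> 1" using LIMSEQ_subseq_LIMSEQ[OF Rlim L(2)] by (simp add: o_def)
      then have "(\<lambda>n. of_real (R (r n)) * z) \<longlonglongrightarrow> of_real 1 * z" by (intro tendsto_intros)
      then have lim: "(\<lambda>n. of_real (R (r n)) * z) \<longlonglongrightarrow> z" by simp
      have "isCont f z" using holomorphic_on_imp_continuous_on[OF f] z by (simp add: continuous_on_eq_continuous_at)
      then have "(\<lambda>n. f (of_real (R (r n)) * z)) \<longlonglongrightarrow> f z" by (rule isCont_tendsto_compose[OF _ lim])
      then show ?thesis using False by (intro tendsto_intros) auto
    qed
    moreover have "norm (f (of_real (R (r n)) * z)) powr p + 2 \<le> Re (inverse (G (r n) z))" for n
      using gre[OF z, of "r n"] by (simp add: G_def)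
    ultimately have "norm (f z) powr p + 2 \<le> Re (inverse (L z))" by (intro LIMSEQ_le) auto
    then show ?thesis by (simp add: h_def)
  qed
  ultimately show ?thesis using f unfolding Hardy_def by blast
qed

lemma Hardy_exh_subset_Hardy:
  assumes "p > 0"
  shows "Hardy_exh (\<lambda>z. ereal (exh_fun z)) p \<subseteq> Hardy p"
proof
  fix f assume f: "f \<in> Hardy_exh (\<lambda>z. ereal (exh_fun z)) p"
  obtain C where C: "\<forall>R. 0 < R \<longrightarrow> R < 1 \<longrightarrow> (\<exists>F. F holomorphic_on UNIV \<and>
    (\<forall>z\<in>ball 0 R. norm (f z) powr p \<le> Re (F z) + 1) \<and> (LINT z|lborel. indicator (ball 0 R) z * Re (F z)) \<le> C)"
    using majorant_on_ball[OF assms f] by (elim exE)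
  have "f holomorphic_on unit_disc" using f by (simp add: Hardy_exh_def)
  then show "f \<in> Hardy p" by (rule Hardy_of_majorants[OF _ C[rule_format]])
qed

section \<open>A function of the Hardy space outside the weighted space\<close>

definition pole_root :: "real \<Rightarrow> complex \<Rightarrow> complex"
  where "pole_root p z = exp (- of_real (1 / (2 * p)) * Ln (1 - z))"

lemma one_minus_disc:
  assumes "z \<in> unit_disc" shows "0 < Re (1 - z)" "1 - z \<notin> \<real>\<^sub>\<le>\<^sub>0"
proof -
  have "Re z < 1" using assms complex_Re_le_cmod[of z] by simp
  then show "0 < Re (1 - z)" "1 - z \<notin> \<real>\<^sub>\<le>\<^sub>0" by (simp_all add: complex_nonpos_Reals_iff)
qed

lemma holomorphic_pole_root: "pole_root p holomorphic_on unit_disc"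
  unfolding pole_root_def using one_minus_disc(2) by (intro holomorphic_intros) auto

lemma dist_powr_norm: "z \<in> unit_disc \<Longrightarrow> dist_powr (-1/4) z = norm (1 - z) powr (-1/2)"
  using powr_powr[of "norm (1 - z)" 2 "-1/4"] one_notin_disc[of z] by (simp add: dist_powr_def powr_numeral)

lemma norm_pole_root:
  assumes p: "p > 0" and z: "z \<in> unit_disc"
  shows "norm (pole_root p z) powr p = pole_fun z"
proof -
  have nz: "1 - z \<noteq> 0" using one_notin_disc[OF z] by simp
  have "norm (pole_root p z) = exp (- (1 / (2 * p)) * ln (norm (1 - z)))"
    using nz by (simp add: pole_root_def norm_exp_eq_Re)
  then have "norm (pole_root p z) powr p = exp (p * (- (1 / (2 * p)) * ln (norm (1 - z))))"
    by (simp add: powr_def)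
  also have "p * (- (1 / (2 * p)) * ln (norm (1 - z))) = (-1/2) * ln (norm (1 - z))" using p by simp
  also have "exp \<dots> = norm (1 - z) powr (-1/2)" using nz by (simp add: powr_def)
  finally show ?thesis using dist_powr_norm[OF z] by (simp add: pole_fun_def)
qed

text \<open>As Re (1 - z) > 0, the square root c of 1 - z satisfies |Im c| \<le> Re c, so |c| \<le>
  2^(1/2) Re c. Hence 1 / |c| is at most 2^(1/2) times the real part of 1 / c.\<close>

lemma pole_root_Hardy:
  assumes p: "p > 0" shows "pole_root p \<in> Hardy p"
proof -
  define h where "h z = of_real (sqrt 2) * inverse (csqrt (1 - z))" for z
  have "h holomorphic_on unit_disc"
    unfolding h_def using one_minus_disc(2) one_notin_disc by (intro holomorphic_intros) force+
  then have "harmonic_on (\<lambda>z. Re (h z)) unit_disc" by (rule harmonic_on_Re) simp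
  moreover have "norm (pole_root p z) powr p \<le> Re (h z)" if z: "z \<in> unit_disc" for z
  proof -
    define c where "c = csqrt (1 - z)"
    have c2: "c\<^sup>2 = 1 - z" by (simp add: c_def)
    have c0: "c \<noteq> 0" using one_notin_disc[OF z] by (simp add: c_def)
    have "(Re c)\<^sup>2 - (Im c)\<^sup>2 = Re (c\<^sup>2)" by (simp add: power2_eq_square)
    then have "(Im c)\<^sup>2 \<le> (Re c)\<^sup>2" using one_minus_disc(1)[OF z] unfolding c2 by linarith
    then have "(norm c)\<^sup>2 \<le> 2 * (Re c)\<^sup>2" unfolding cmod_power2 by linarith
    then have "sqrt ((norm c)\<^sup>2) \<le> sqrt (2 * (Re c)\<^sup>2)" by (rule real_sqrt_le_mono)
    moreover have "Re c \<ge> 0" unfolding c_def by (rule Re_csqrt)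
    ultimately have le: "norm c \<le> sqrt 2 * Re c" by (simp add: real_sqrt_mult)
    have nc: "norm c > 0" using c0 by simp
    have "norm (pole_root p z) powr p = norm (1 - z) powr (-1/2)" using norm_pole_root[OF p z] dist_powr_norm[OF z] by (simp add: pole_fun_def)
    also have "\<dots> = inverse (norm c)"
      by (simp add: c_def norm_csqrt powr_minus powr_half_sqrt)
    also have "\<dots> = norm c / (norm c)\<^sup>2" using nc by (simp add: power2_eq_square field_simps)
    also have "\<dots> \<le> sqrt 2 * Re c / (norm c)\<^sup>2" using le by (intro divide_right_mono) auto
    also have "\<dots> = Re (h z)" by (simp add: h_def c_def[symmetric] cmod_power2)
    finally show ?thesis .
  qed
  ultimately show ?thesis using holomorphic_pole_root unfolding Hardy_def by blast
qed

text \<open>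
  Disjoint boxes that approach \<open>1\<close> nontangentially; the integral of \<open>|f|^p \<Delta>u\<close> over each of them
  is bounded from below by the same constant.
\<close>

definition cell :: "nat \<Rightarrow> complex set"
  where "cell k = box (Complex (1 - 2 / 2 ^ (k + 2)) (- 1 / 2 ^ (k + 2))) (Complex (1 - 1 / 2 ^ (k + 2)) (1 / 2 ^ (k + 2)))"

lemma mem_cell: "z \<in> cell k \<longleftrightarrow> 1 / 2 ^ (k + 2) < 1 - Re z \<and> 1 - Re z < 2 / 2 ^ (k + 2) \<and> \<bar>Im z\<bar> < 1 / 2 ^ (k + 2)"
  by (auto simp: cell_def box_def Basis_complex_def abs_less_iff)

text \<open>On a cell both 1 - |z| and |1 - z| are comparable to the side length h, so the product
  (1 - |z|^2) |1 - z|^(-3) is of order h^(-2), which cancels the area 2 h^2. The constant is 1/48 =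
  (3/4) (3/4) / 27, from 1 - |z|^2 \<ge> (3/4) h and |1 - z| \<le> 3 h.\<close>

lemma cell_bounds:
  assumes z: "z \<in> cell k"
  defines "h \<equiv> 1 / 2 ^ (k + 2) :: real"
  shows "norm z \<le> 1 - h / 4" "1 / (48 * h\<^sup>2) \<le> pole_fun z * (3/4 * (1 - (norm z)\<^sup>2) * dist_powr (-5/4) z)"
proof -
  define X where "X = 1 - Re z"
  have h: "0 < h" "h \<le> 1/4"
  proof -
    show "0 < h" by (simp add: h_def)
    have "(2::real) ^ 2 \<le> 2 ^ (k + 2)" by (rule power_increasing) auto
    then show "h \<le> 1/4" by (simp add: h_def field_simps)
  qed
  have X: "h < X" "X < 2 * h" "\<bar>Im z\<bar> < h" using z by (auto simp: mem_cell h_def X_def)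
  have "\<bar>X\<bar> \<le> \<bar>2 * h\<bar>" "\<bar>Im z\<bar> \<le> \<bar>h\<bar>" using X h by auto
  then have sq: "X\<^sup>2 \<le> (2 * h)\<^sup>2" "(Im z)\<^sup>2 \<le> h\<^sup>2" by (simp_all only: abs_le_square_iff)
  have N: "(norm (1 - z))\<^sup>2 = X\<^sup>2 + (Im z)\<^sup>2" by (simp add: cmod_power2 X_def)
  have nz: "(norm z)\<^sup>2 = 1 - 2 * X + X\<^sup>2 + (Im z)\<^sup>2"
    unfolding cmod_power2 X_def by (simp add: power2_eq_square algebra_simps)
  have hh: "h\<^sup>2 \<le> h / 4" using h mult_left_mono[of h "1/4" h] by (simp add: power2_eq_square)
  \<comment> \<open>With X = 1 - Re z, 1 - |z|^2 = 2 X - X^2 - (Im z)^2 is at least 2 h - 5 h^2, and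
    h \<le> 1/4.\<close>
  have A: "3/4 * h \<le> 1 - (norm z)\<^sup>2" unfolding nz using sq X h hh by (simp add: power_mult_distrib)
  show "norm z \<le> 1 - h / 4"
  proof (rule power2_le_imp_le)
    have "(norm z)\<^sup>2 \<le> 1 - h / 2" using A h by linarith
    also have "\<dots> \<le> (1 - h / 4)\<^sup>2" by (simp add: power2_eq_square algebra_simps)
    finally show "(norm z)\<^sup>2 \<le> (1 - h / 4)\<^sup>2" .
    show "0 \<le> 1 - h / 4" using h by linarith
  qed
  have N9: "(norm (1 - z))\<^sup>2 \<le> (3 * h)\<^sup>2" 
  proof -
    have "X\<^sup>2 \<le> 4 * h\<^sup>2" using sq(1) by (simp add: power_mult_distrib)
    moreover have "(3 * h)\<^sup>2 = 9 * h\<^sup>2" by (simp add: power_mult_distrib)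
    ultimately show ?thesis unfolding N using sq(2) zero_le_power2[of h] by linarith
  qed
  have N0: "0 < (norm (1 - z))\<^sup>2" unfolding N using X h by (intro add_pos_nonneg) auto
  have "1 / (27 * h^3) = ((3 * h)\<^sup>2) powr (-3/2)"
  proof -
    have "((3 * h)\<^sup>2) powr (-3/2) = (3 * h) powr (-3)"
      using powr_powr[of "3 * h" 2 "-3/2"] h by (simp add: powr_numeral)
    also have "\<dots> = inverse ((3 * h) powr 3)" by (rule powr_minus)
    also have "(3 * h) powr 3 = (3 * h) ^ 3" using h by (intro powr_numeral) simp
    also have "inverse \<dots> = 1 / (3 * h) ^ 3" by (rule inverse_eq_divide)
    finally show ?thesis by (simp add: power_mult_distrib)
  qed
  also have "\<dots> \<le> dist_powr (-3/2) z" unfolding dist_powr_def using N9 N0 by (intro powr_mono2') auto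
  finally have P: "1 / (27 * h^3) \<le> dist_powr (-3/2) z" .
  have "1 / (48 * h\<^sup>2) = 3/4 * (3/4 * h) * (1 / (27 * h^3))"
    using h by (simp add: field_simps power2_eq_square power3_eq_cube)
  also have "\<dots> \<le> 3/4 * (1 - (norm z)\<^sup>2) * dist_powr (-3/2) z"
    using A P h by (intro mult_mono) auto
  also have "\<dots> = pole_fun z * (3/4 * (1 - (norm z)\<^sup>2) * dist_powr (-5/4) z)"
    using dist_powr_mult[of "-1/4" z "-5/4"] by (simp add: pole_fun_def algebra_simps)
  finally show "1 / (48 * h\<^sup>2) \<le> pole_fun z * (3/4 * (1 - (norm z)\<^sup>2) * dist_powr (-5/4) z)" .
qed

lemma cell_disjoint:
  assumes "z \<in> cell j" "z \<in> cell k" shows "j = k"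
proof (rule ccontr)
  have *: False if "z \<in> cell j" "z \<in> cell k" "j < k" for j k
  proof -
    have "(2::real) * 2 ^ (j + 2) \<le> 2 ^ (k + 2)"
      using power_increasing[of "j + 3" "k + 2" "2::real"] that(3) by (simp add: power_add)
    then have "2 / (2::real) ^ (k + 2) \<le> 1 / 2 ^ (j + 2)" by (simp add: field_simps)
    then show False using that(1,2) unfolding mem_cell by linarith
  qed
  assume "j \<noteq> k" then show False using *[of j k] *[of k j] assms by linarith
qed

lemma measure_cell: "measure lborel (cell k) = 2 * (1 / 2 ^ (k + 2))\<^sup>2"
proof -
  define h :: real where "h = 1 / 2 ^ (k + 2)"
  have "h > 0" by (simp add: h_def)
  moreover have "cell k = box (Complex (1 - 2 * h) (- h)) (Complex (1 - h) h)" by (simp add: cell_def h_def)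
  ultimately show ?thesis unfolding h_def[symmetric]
    by (simp add: measure_lborel_box_eq Basis_complex_def power2_eq_square)
qed

text \<open>In the Lelong-Jensen formula for \<open>pole_fun\<close> both terms are nonnegative.
  Keeping only part of the Laplacian of u on finitely many cells already exceeds any prescribed
  bound.\<close>

lemma pole_root_notin_Hardy_exh:
  assumes p: "p > 0" shows "pole_root p \<notin> Hardy_exh (\<lambda>z. ereal (exh_fun z)) p"
proof
  assume f: "pole_root p \<in> Hardy_exh (\<lambda>z. ereal (exh_fun z)) p"
  obtain C where C: "0 \<le> C" "\<forall>\<^sub>F r in at_left 0. r < 0 \<and> (\<integral>\<^sup>+z. ennreal (norm (pole_root p z) powr p) \<partial>exh_level r) \<le> ennreal C"
    by (rule Hardy_exhE[OF f])
  \<comment> \<open>Each cell contributes at least 2 h^2 / (48 h^2) = 1/24, so \<open>N\<close> of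
    them exceed the bound 2 pi C.\<close>
  obtain N :: nat where N: "2 * pi * C * 24 < real N" using reals_Archimedean2 by blast
  \<comment> \<open>By \<open>cell_bounds\<close> a disc of this radius contains the first
    \<open>N\<close> cells; r is then taken so close to 0 that the disc lies in the sublevel
    set.\<close>
  define \<rho> :: real where "\<rho> = 1 - (1 / 2 ^ (N + 2)) / 4"
  have \<rho>1: "\<rho> < 1" by (simp add: \<rho>_def)
  have \<rho>0: "0 \<le> \<rho>"
  proof -
    have "(1::real) \<le> 2 ^ (N + 2)" by (rule one_le_power) simp
    then show ?thesis by (simp add: \<rho>_def field_simps)
  qed
  have cells: "norm z \<le> \<rho>" if "z \<in> cell k" "k < N" for z k
  proof -
    have "(2::real) ^ (k + 2) \<le> 2 ^ (N + 2)" using that(2) by (intro power_increasing) auto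
    then have "1 / (2::real) ^ (N + 2) \<le> 1 / 2 ^ (k + 2)" by (simp add: frac_le)
    then have "1 - 1 / 2 ^ (k + 2) / 4 \<le> \<rho>" unfolding \<rho>_def
      by (intro diff_left_mono divide_right_mono) simp_all
    then show ?thesis by (rule order_trans[OF cell_bounds(1)[OF that(1)]])
  qed
  have r2: "\<rho>\<^sup>2 < 1" using \<rho>0 \<rho>1 by (simp add: power_less_one_iff)
  have "\<forall>\<^sub>F r in at_left 0. - (1 - \<rho>\<^sup>2) / 4 < r"
    using r2 by (intro order_tendstoD[OF tendsto_ident_at]) simp
  with C(2) have "\<forall>\<^sub>F r in at_left (0::real). r < 0 \<and> (\<integral>\<^sup>+z. ennreal (norm (pole_root p z) powr p) \<partial>exh_level r) \<le> ennreal C \<and> - (1 - \<rho>\<^sup>2) / 4 < r"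
    by eventually_elim simp
  then obtain r where r: "r < 0" "(\<integral>\<^sup>+z. ennreal (norm (pole_root p z) powr p) \<partial>exh_level r) \<le> ennreal C" "- (1 - \<rho>\<^sup>2) / 4 < r"
    using eventually_happens[of _ "at_left (0::real)"] by (auto simp: trivial_limit_at_left_real)
  note L = exh_level_props[OF r(1)]
  let ?B = "{z\<in>unit_disc. exh_fun z < r}"
  have sp: "space (exh_level r) = unit_disc" using sets_eq_imp_space_eq[OF L(1)] by simp
  have gc: "continuous_on unit_disc pole_fun" unfolding pole_fun_def by (intro continuous_intros)
  have g0: "0 \<le> pole_fun z" for z by (simp add: pole_fun_def dist_powr_def)
  have j: "integrable (exh_level r) pole_fun" "(LINT z|exh_level r. pole_fun z) = 1 / (2 * pi) * (LINT z|lborel. indicator ?B z * (pole_fun z * exh.Lap z + (r - exh_fun z) * (\<Sum>b\<in>Basis. pole_fun2 b z)))"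
    using L(4)[OF D2_along_pole_fun] by blast+
  have "ennreal (LINT z|exh_level r. pole_fun z) = (\<integral>\<^sup>+z. ennreal (pole_fun z) \<partial>exh_level r)"
    using j(1) g0 by (intro nn_integral_eq_integral[symmetric]) auto
  also have "\<dots> = (\<integral>\<^sup>+z. ennreal (norm (pole_root p z) powr p) \<partial>exh_level r)"
    by (rule nn_integral_cong) (use norm_pole_root[OF p] in \<open>simp add: sp\<close>)
  also have "\<dots> \<le> ennreal C" by (rule r(2))
  finally have "(LINT z|exh_level r. pole_fun z) \<le> C" using C(1) by (subst (asm) ennreal_le_iff) auto
  then have up: "(LINT z|lborel. indicator ?B z * (pole_fun z * exh.Lap z + (r - exh_fun z) * (\<Sum>b\<in>Basis. pole_fun2 b z))) \<le> 2 * pi * C"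
    unfolding j(2) by (simp add: field_simps)
  have mc: "integrable lborel (indicator (cell k) :: complex \<Rightarrow> real)" for k
    unfolding cell_def using emeasure_bounded_finite[OF bounded_box] by (intro integrable_real_indicator) auto
  have "real N / 24 = (\<Sum>k<N. 1 / (48 * (1 / 2 ^ (k + 2))\<^sup>2) * measure lborel (cell k))"
    unfolding measure_cell by simp
  also have "\<dots> = (LINT z|lborel. (\<Sum>k<N. 1 / (48 * (1 / 2 ^ (k + 2))\<^sup>2) * indicator (cell k) z))"
    using mc by (subst Bochner_Integration.integral_sum) (auto intro!: integrable_mult_right)
  also have "\<dots> \<le> (LINT z|lborel. indicator ?B z * (pole_fun z * exh.Lap z + (r - exh_fun z) * (\<Sum>b\<in>Basis. pole_fun2 b z)))"
  proof (rule integral_mono)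
    show "integrable lborel (\<lambda>z. \<Sum>k<N. 1 / (48 * (1 / 2 ^ (k + 2))\<^sup>2) * indicator (cell k) z :: real)"
      using mc by (intro Bochner_Integration.integrable_sum integrable_mult_right) auto
    show "integrable lborel (\<lambda>z. indicator ?B z * (pole_fun z * exh.Lap z + (r - exh_fun z) * (\<Sum>b\<in>Basis. pole_fun2 b z)))"
      by (intro integrable_indicator_disc[OF exh_fun_sublevel_sets exh_fun_exhaustion(1)[OF r(1)]] continuous_on_add continuous_on_mult
         continuous_on_diff continuous_on_const gc exh.cont_Lap exh.cont_u continuous_on_sum D2_along_cont(3)[OF D2_along_pole_fun])
    fix z :: complex
    have zB: "pole_fun z * (3/4 * (1 - (norm z)\<^sup>2) * dist_powr (-5/4) z) \<le> indicator ?B z * (pole_fun z * exh.Lap z + (r - exh_fun z) * (\<Sum>b\<in>Basis. pole_fun2 b z))"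
      if "norm z \<le> \<rho>"
    proof -
      have zD: "z \<in> unit_disc" using that \<rho>1 by simp
      have "(norm z)\<^sup>2 \<le> \<rho>\<^sup>2" using that by (intro power_mono) auto
      then have ru: "exh_fun z < r" using exh_fun_le[OF zD] r(3) by (simp add: field_simps)
      have "3/4 * (1 - (norm z)\<^sup>2) * dist_powr (-5/4) z \<le> exh.Lap z"
        using Lap_exh_fun[OF zD] dist_powr_pos[OF zD, of "-1/4"] by (simp add: exh.Lap_def)
      then have "pole_fun z * (3/4 * (1 - (norm z)\<^sup>2) * dist_powr (-5/4) z) \<le> pole_fun z * exh.Lap z" using g0 by (rule mult_left_mono)
      moreover have "0 \<le> (r - exh_fun z) * (\<Sum>b\<in>Basis. pole_fun2 b z)"
        unfolding Lap_pole_fun[OF zD] using ru dist_powr_pos[OF zD, of "-5/4"] by simp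
      ultimately show ?thesis using zD ru by simp
    qed
    show "(\<Sum>k<N. 1 / (48 * (1 / 2 ^ (k + 2))\<^sup>2) * indicator (cell k) z) \<le> indicator ?B z * (pole_fun z * exh.Lap z + (r - exh_fun z) * (\<Sum>b\<in>Basis. pole_fun2 b z))"
    proof (cases "\<exists>k<N. z \<in> cell k")
      case True
      then obtain k where k: "k < N" "z \<in> cell k" by blast
      have "(\<Sum>j<N. 1 / (48 * (1 / 2 ^ (j + 2))\<^sup>2) * indicator (cell j) z) = (\<Sum>j\<in>{k}. 1 / (48 * (1 / 2 ^ (j + 2))\<^sup>2) * indicator (cell j) z :: real)"
      proof (rule sum.mono_neutral_right)
        show "{k} \<subseteq> {..<N}" using k(1) by simp
        show "\<forall>j\<in>{..<N} - {k}. 1 / (48 * (1 / 2 ^ (j + 2))\<^sup>2) * indicator (cell j) z = (0::real)"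
        proof
          fix j assume "j \<in> {..<N} - {k}"
          then have "z \<notin> cell j" using cell_disjoint[OF k(2), of j] by blast
          then show "1 / (48 * (1 / 2 ^ (j + 2))\<^sup>2) * indicator (cell j) z = (0::real)" by simp
        qed
      qed simp
      also have "\<dots> = 1 / (48 * (1 / 2 ^ (k + 2))\<^sup>2)" using k by simp
      also have "\<dots> \<le> pole_fun z * (3/4 * (1 - (norm z)\<^sup>2) * dist_powr (-5/4) z)" by (rule cell_bounds(2)[OF k(2)])
      also have "\<dots> \<le> indicator ?B z * (pole_fun z * exh.Lap z + (r - exh_fun z) * (\<Sum>b\<in>Basis. pole_fun2 b z))"
        by (rule zB[OF cells[OF k(2,1)]])
      finally show ?thesis .
    next
      case False
      then have "(\<Sum>k<N. 1 / (48 * (1 / 2 ^ (k + 2))\<^sup>2) * indicator (cell k) z) = (0::real)" by (intro sum.neutral) auto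
      moreover have "0 \<le> indicator ?B z * (pole_fun z * exh.Lap z + (r - exh_fun z) * (\<Sum>b\<in>Basis. pole_fun2 b z))"
      proof (cases "z \<in> ?B")
        case True
        then have zD: "z \<in> unit_disc" by blast
        then show ?thesis using True g0[of z] exh.Lap_ge_0[OF zD] dist_powr_pos[OF zD, of "-5/4"] unfolding Lap_pole_fun[OF zD] by simp
      qed simp
      ultimately show ?thesis by simp
    qed
  qed
  also have "\<dots> \<le> 2 * pi * C" by (rule up)
  finally show False using N by simp
qed

theorem theorem1p3:
  fixes p :: real
  assumes "p > 0"
  shows "\<exists>u. neg_subharmonic_exhaustion u \<and>
             emeasure (ddc u) unit_disc < \<infinity> \<and>
             Hardy_exh u p \<subset> Hardy p"
proof (intro exI[of _ "\<lambda>z. ereal (exh_fun z)"] conjI)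
  show "neg_subharmonic_exhaustion (\<lambda>z. ereal (exh_fun z))" by (rule neg_subharmonic_exhaustion_exh_fun)
  show "emeasure (ddc (\<lambda>z. ereal (exh_fun z))) unit_disc < \<infinity>" unfolding exh.ddc_u by (rule exh_fun_finite_mass)
  show "Hardy_exh (\<lambda>z. ereal (exh_fun z)) p \<subset> Hardy p"
    using Hardy_exh_subset_Hardy[OF assms] pole_root_Hardy[OF assms] pole_root_notin_Hardy_exh[OF assms] by blast
qed

end
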